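(* In the linear-quadratic setting described in the context, let $v\colon[0,T]\times H\to\mathbb{R}$ be $v(t,y)=\langle a(t),y\rangle+b(t)$, with $a$ and $b$ as defined in the context. Then: 1. For all $(t,y)\in[0,T]\times H$ one has $v(t,y)\ge V(t,y)$, where $$V(t,y)=\sup\{\mathcal{J}(t,y;\tilde u)\colon \tilde u=(u,z)\in\mathcal{U}\times\mathcal{U},\ u=z\}.$$ 2. Let $t\in[0,T]$, $y\in H$. For $q\in\mathbb{R}^2$ set $u^*(q)=\dfrac{\langle q-\tilde\beta,(1,1)\rangle}{2(\gamma_0+\gamma_1)}$, and let $\tilde u^*(s)=\big(u^*(B^*a(s)),u^*(B^*a(s))\big)$ for $s\in[t,T]$. Then the pair $(\tilde u^*,Y^{t,y,\tilde u^*})$ is optimal for the control problem defining $V(t,y)$, and $$V(t,y)=v(t,y)=\mathcal{J}(t,y;\tilde u^* ).$$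
   Context: **Data.** $T>0$, $d>0$, $r\in\mathbb{R}$ (discount rate), $\sigma\in\mathbb{R}$; $a_0,a_1\in\mathbb{R}$; $b_0\ge 0$; $b_1\in L^2([-d,0];\mathbb{R}^+)$. $W$ is a real Brownian motion on a filtered probability space $(\Omega,\mathcal{F},(\mathcal{F}_t)_{t\ge0},\mathbb{P})$, with $(\Omega,\mathcal F,\mathbb P)$ complete and the filtration being the augmentation of the one generated by $W$. The control set is $U=\mathbb{R}$, and $\mathcal{U}=L^2_{\mathcal{P}}(\Omega\times[0,T];U)$ is the space of $U$-valued square integrable progressively measurable processes. **Hilbert space and operators.** $H=\mathbb{R}^2\times L^2([-d,0],\mathbb{R}^2)$ with the product inner product $\langle\cdot,\cdot\rangle$; write $y=(y_0,y_1)\in H$. Let $A_0=\begin{bmatrix}a_0&a_1\\0&a_0+a_1\end{bmatrix}$, with transpose $A_0^*$. The operator $Ay=(A_0y_0+y_1(0),-\dot y_1)$, with domain $\{y\in H\colon y_1\in W^{1,2}([-d,0],\mathbb{R}^2),\ y_1(-d)=0\}$, generates the $C_0$-semigroup $$e^{tA}y=\Big(e^{tA_0}y_0+\int_{-d}^0\mathbf{1}_{[-t,0]}(s)e^{(t+s)A_0}y_1(s)\,ds,\ y_1(\cdot-t)\mathbf{1}_{[-d+t,0]}(\cdot)\Big),$$ and its adjoint $A^*$ generates $$e^{tA^*}y=\Big(e^{tA_0^*}y_0,\ e^{(\cdot+t)A_0^*}y_0\mathbf{1}_{[-t,0]}(\cdot)+y_1(\cdot+t)\mathbf{1}_{[-d,-t]}(\cdot)\Big).$$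 $G\colon\mathbb{R}\to H$, $Gx=((\sigma x,0),0)$. $B\colon\mathbb{R}^2\to H$, $Bq=(b_0q,b_1(\cdot)q)$, with adjoint $B^*y=b_0y_0+\int_{-d}^0b_1(\xi)y_1(\xi)\,d\xi$. **State.** For $t\in[0,T]$, $y\in H$, $\tilde u=(u,z)\in\mathcal{U}\times\mathcal{U}$, $Y^{t,y,\tilde u}$ is the mild solution of $dY(s)=(AY(s)+B\tilde u(s))ds+G\,dW(s)$, $Y(t)=y$, i.e. $$Y^{t,y,\tilde u}(s)=e^{(s-t)A}y+\int_t^se^{(s-\rho)A}B\tilde u(\rho)\,d\rho+\int_t^se^{(s-\rho)A}G\,dW(\rho),\quad s\in[t,T].$$ $Y_0^{t,y,\tilde u}$ denotes its $\mathbb{R}^2$-component. Only the restriction of $\tilde u$ to $[t,T]$ matters. **Linear-quadratic objective.** $\alpha_0,\alpha_1,\beta_0,\beta_1,\lambda_0,\lambda_1\in\mathbb{R}$, $\gamma_0,\gamma_1>0$; $\tilde\alpha=(\alpha_0,-\alpha_1)$, $\tilde\beta=(\beta_0,\beta_1)$, $\tilde\lambda=(\lambda_0,-\lambda_1)$. Then $$\mathcal{J}(t,y;\tilde u)=\mathbb{E}\Big[\int_t^Te^{-r(s-t)}\big(\langle\tilde\alpha,Y_0^{t,y,\tilde u}(s)\rangle-\langle\tilde\beta,\tilde u(s)\rangle-\gamma_0u(s)^2-\gamma_1z(s)^2\big)ds+e^{-r(T-t)}\langle\tilde\lambda,Y_0^{t,y,\tilde u}(T)\rangle\Big].$$ **The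 functions $a$ and $b$.** For $t\in[0,T]$, $$a(t)=e^{(T-t)(A^*-r)}(\tilde\lambda,0)+\int_t^Te^{(s-t)(A^*-r)}(\tilde\alpha,0)\,ds\in H,\qquad e^{\tau(A^*-r)}:=e^{-r\tau}e^{\tau A^*},$$ $$b(t)=\int_t^Te^{-r(s-t)}\frac{\big(\langle B^*a(s)-\tilde\beta,(1,1)\rangle\big)^2}{4(\gamma_0+\gamma_1)}\,ds\in\mathbb{R}.$$ *)

theory Defs
  imports "HOL-Probability.Probability"
begin

section \<open>The Hilbert space of square integrable functions on the real line\<close>

text \<open>Elements of \<open>'b L2\<close> are the classes, modulo equality almost everywhere, of square integrable
  Borel functions on the real line. The space over an interval \<open>S\<close> is the closed subspace
  \<open>supported_L2 S\<close> of the classes vanishing outside of \<open>S\<close> (extension by 0). Together with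
  completeness and separability this makes the Bochner integral available.\<close>


definition square_integrable :: "(real \<Rightarrow> 'b::euclidean_space) \<Rightarrow> bool" where
  "square_integrable f \<longleftrightarrow>
     f \<in> borel_measurable lborel \<and> integrable lborel (\<lambda>x. (norm (f x))\<^sup>2)"

definition L2_rel :: "(real \<Rightarrow> 'b::euclidean_space) \<Rightarrow> (real \<Rightarrow> 'b) \<Rightarrow> bool" where
  "L2_rel f g \<longleftrightarrow>
     square_integrable f \<and> square_integrable g \<and> (AE x in lborel. f x = g x)"

lemma square_integrable_zero: "square_integrable (\<lambda>x. 0)"
  by (simp add: square_integrable_def)

lemma square_integrable_measurable [measurable_dest]:
  "square_integrable f \<Longrightarrow> f \<in> borel_measurable borel"
  by (simp add: square_integrable_def)

lemma square_integrable_integrable: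
  "square_integrable f \<Longrightarrow> integrable lborel (\<lambda>x. (norm (f x))\<^sup>2)"
  by (simp add: square_integrable_def)

lemma integrable_inner_square_integrable:
  fixes f g :: "real \<Rightarrow> 'b::euclidean_space"
  assumes f: "square_integrable f" and g: "square_integrable g"
  shows "integrable lborel (\<lambda>x. f x \<bullet> g x)"
proof (rule Bochner_Integration.integrable_bound)
  show "integrable lborel (\<lambda>x. (norm (f x))\<^sup>2 + (norm (g x))\<^sup>2)"
    using f g by (auto simp: square_integrable_def)
  show "(\<lambda>x. f x \<bullet> g x) \<in> borel_measurable lborel"
    using f g by (auto simp: square_integrable_def)
  have "\<bar>f x \<bullet> g x\<bar> \<le> (norm (f x))\<^sup>2 + (norm (g x))\<^sup>2" for x
  proof -
    have "\<bar>f x \<bullet> g x\<bar> \<le> norm (f x) * norm (g x)" by (rule Cauchy_Schwarz_ineq2)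
    also have "2 * norm (f x) * norm (g x) \<le> (norm (f x))\<^sup>2 + (norm (g x))\<^sup>2"
      by (rule sum_squares_bound)
    then have "norm (f x) * norm (g x) \<le> (norm (f x))\<^sup>2 + (norm (g x))\<^sup>2"
      using mult_nonneg_nonneg[OF norm_ge_zero norm_ge_zero, of "f x" "g x"] by linarith
    finally show ?thesis .
  qed
  then show "AE x in lborel. norm (f x \<bullet> g x) \<le> norm ((norm (f x))\<^sup>2 + (norm (g x))\<^sup>2)"
    by (intro AE_I2) (simp add: order_trans[OF _ abs_ge_self])
qed

lemma square_integrable_bound:
  fixes f :: "real \<Rightarrow> 'b::euclidean_space"
  assumes "integrable lborel h" "f \<in> borel_measurable lborel"
    and "\<And>x. (norm (f x))\<^sup>2 \<le> h x"
  shows "square_integrable f"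
  unfolding square_integrable_def
proof
  show "integrable lborel (\<lambda>x. (norm (f x))\<^sup>2)"
    by (rule Bochner_Integration.integrable_bound[OF assms(1)])
      (use assms(2,3) in \<open>auto intro!: order_trans[OF _ abs_ge_self]\<close>)
qed fact

lemma norm_add_squared_le: "(norm (a + b))\<^sup>2 \<le> 2 * (norm a)\<^sup>2 + 2 * (norm b)\<^sup>2"
  for a b :: "'b::real_normed_vector"
proof -
  have "(norm (a + b))\<^sup>2 \<le> (norm a + norm b)\<^sup>2"
    by (intro power_mono norm_triangle_ineq norm_ge_zero)
  also have "\<dots> \<le> 2 * (norm a)\<^sup>2 + 2 * (norm b)\<^sup>2"
    using sum_squares_bound[of "norm a" "norm b"] by (simp add: power2_sum)
  finally show ?thesis .
qed

lemma square_integrable_add: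
  fixes f g :: "real \<Rightarrow> 'b::euclidean_space"
  assumes f: "square_integrable f" and g: "square_integrable g"
  shows "square_integrable (\<lambda>x. f x + g x)"
  by (rule square_integrable_bound[where h="\<lambda>x. 2 * (norm (f x))\<^sup>2 + 2 * (norm (g x))\<^sup>2"])
    (use f g in \<open>auto simp: square_integrable_def norm_add_squared_le\<close>)

lemma square_integrable_scaleR:
  "square_integrable f \<Longrightarrow> square_integrable (\<lambda>x. c *\<^sub>R f x)"
  by (auto simp: square_integrable_def power_mult_distrib)

lemma square_integrable_uminus:
  "square_integrable f \<Longrightarrow> square_integrable (\<lambda>x. - f x)"
  by (auto simp: square_integrable_def)

lemma square_integrable_diff:
  "square_integrable f \<Longrightarrow> square_integrable g \<Longrightarrow> square_integrable (\<lambda>x. f x - g x)"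
  using square_integrable_add[OF _ square_integrable_uminus, of f g] by simp

quotient_type (overloaded) 'b L2 = "real \<Rightarrow> 'b::euclidean_space" / partial: L2_rel
  morphisms rep_L2 L2_of
proof (rule part_equivpI)
  show "\<exists>f :: real \<Rightarrow> 'b. L2_rel f f"
    by (rule exI[of _ "\<lambda>x. 0"]) (simp add: L2_rel_def square_integrable_zero)
  show "symp (L2_rel :: (real \<Rightarrow> 'b) \<Rightarrow> _)"
    by (rule sympI) (auto simp: L2_rel_def elim: eventually_mono)
  show "transp (L2_rel :: (real \<Rightarrow> 'b) \<Rightarrow> _)"
    by (rule transpI) (auto simp: L2_rel_def elim: eventually_elim2)
qed

instantiation L2 :: (euclidean_space) real_vector
begin

lift_definition zero_L2 :: "'a L2" is "\<lambda>x. 0"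
  by (simp add: L2_rel_def square_integrable_zero)

lift_definition plus_L2 :: "'a L2 \<Rightarrow> 'a L2 \<Rightarrow> 'a L2" is "\<lambda>f g x. f x + g x"
  by (auto simp: L2_rel_def square_integrable_add)

lift_definition uminus_L2 :: "'a L2 \<Rightarrow> 'a L2" is "\<lambda>f x. - f x"
  by (auto simp: L2_rel_def square_integrable_uminus)

lift_definition minus_L2 :: "'a L2 \<Rightarrow> 'a L2 \<Rightarrow> 'a L2" is "\<lambda>f g x. f x - g x"
  by (auto simp: L2_rel_def square_integrable_diff)

lift_definition scaleR_L2 :: "real \<Rightarrow> 'a L2 \<Rightarrow> 'a L2" is "\<lambda>c f x. c *\<^sub>R f x"
  by (auto simp: L2_rel_def square_integrable_scaleR elim: eventually_mono)

instance
proof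
  fix f g h :: "'a L2" and a b :: real
  show "f + g + h = f + (g + h)"
    by transfer (auto simp: L2_rel_def square_integrable_add algebra_simps)
  show "f + g = g + f"
    by transfer (auto simp: L2_rel_def square_integrable_add algebra_simps)
  show "0 + f = f"
    by transfer (auto simp: L2_rel_def)
  show "- f + f = 0"
    by transfer (auto simp: L2_rel_def square_integrable_zero)
  show "f - g = f + - g"
    by transfer (auto simp: L2_rel_def square_integrable_diff)
  show "a *\<^sub>R (f + g) = a *\<^sub>R f + a *\<^sub>R g"
    by transfer (auto simp: L2_rel_def square_integrable_add square_integrable_scaleR
        scaleR_add_right[symmetric])
  show "(a + b) *\<^sub>R f = a *\<^sub>R f + b *\<^sub>R f"
    by transfer (auto simp: L2_rel_def square_integrable_add square_integrable_scaleR
        scaleR_add_left[symmetric])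
  show "a *\<^sub>R b *\<^sub>R f = (a * b) *\<^sub>R f"
    by transfer (auto simp: L2_rel_def square_integrable_scaleR)
  show "1 *\<^sub>R f = f"
    by transfer (auto simp: L2_rel_def)
qed

end

instantiation L2 :: (euclidean_space) real_inner
begin

lift_definition inner_L2 :: "'a L2 \<Rightarrow> 'a L2 \<Rightarrow> real" is "\<lambda>f g. LINT x|lborel. f x \<bullet> g x"
  by (rule integral_cong_AE)
    (auto simp: L2_rel_def intro!: borel_measurable_inner dest: square_integrable_measurable)

definition norm_L2 :: "'a L2 \<Rightarrow> real" where "norm_L2 f = sqrt (f \<bullet> f)"

definition dist_L2 :: "'a L2 \<Rightarrow> 'a L2 \<Rightarrow> real" where "dist_L2 f g = norm (f - g)"

definition sgn_L2 :: "'a L2 \<Rightarrow> 'a L2" where "sgn_L2 f = f /\<^sub>R norm f"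

definition uniformity_L2 :: "('a L2 \<times> 'a L2) filter" where
  "uniformity_L2 = (INF e\<in>{0<..}. principal {(x, y). dist x y < e})"

definition open_L2 :: "'a L2 set \<Rightarrow> bool" where
  "open_L2 U \<longleftrightarrow> (\<forall>x\<in>U. \<forall>\<^sub>F (x', y) in uniformity. x' = x \<longrightarrow> y \<in> U)"

instance
proof
  fix f g h :: "'a L2" and a :: real
  show "dist f g = norm (f - g)" by (rule dist_L2_def)
  show "sgn f = f /\<^sub>R norm f" by (rule sgn_L2_def)
  show "(uniformity :: ('a L2 \<times> 'a L2) filter) = (INF e\<in>{0<..}. principal {(x, y). dist x y < e})"
    by (rule uniformity_L2_def)
  show "open U \<longleftrightarrow> (\<forall>x\<in>U. \<forall>\<^sub>F (x', y) in uniformity. x' = x \<longrightarrow> y \<in> U)" for U :: "'a L2 set"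
    by (rule open_L2_def)
  show "f \<bullet> g = g \<bullet> f"
    by transfer (simp add: inner_commute)
  show "(f + g) \<bullet> h = f \<bullet> h + g \<bullet> h"
    by transfer (simp add: L2_rel_def inner_add_left integrable_inner_square_integrable)
  show "(a *\<^sub>R f) \<bullet> g = a * (f \<bullet> g)"
    by transfer simp
  show "0 \<le> f \<bullet> f"
    by transfer simp
  show "f \<bullet> f = 0 \<longleftrightarrow> f = 0"
    by transfer (simp add: L2_rel_def integral_nonneg_eq_0_iff_AE
        integrable_inner_square_integrable square_integrable_zero)
  show "norm f = sqrt (f \<bullet> f)" by (rule norm_L2_def)
qed

end

lemma square_integrable_rep: "square_integrable (rep_L2 f)"
  using Quotient_rep_reflp[OF Quotient_L2, of f] by (simp add: L2_rel_def)

lemma L2_of_rep: "L2_of (rep_L2 f) = f"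
  by (rule Quotient_abs_rep[OF Quotient_L2])

lemma rep_L2_of: "square_integrable f \<Longrightarrow> AE x in lborel. rep_L2 (L2_of f) x = f x"
  using Quotient_rep_abs[OF Quotient_L2, of f] by (simp add: L2_rel_def)

lemma L2_of_add:
  "square_integrable f \<Longrightarrow> square_integrable g \<Longrightarrow> L2_of (\<lambda>x. f x + g x) = L2_of f + L2_of g"
  by (simp add: plus_L2.abs_eq L2_rel_def)

lemma L2_of_diff:
  "square_integrable f \<Longrightarrow> square_integrable g \<Longrightarrow> L2_of (\<lambda>x. f x - g x) = L2_of f - L2_of g"
  by (simp add: minus_L2.abs_eq L2_rel_def)

lemma L2_of_scaleR: "square_integrable f \<Longrightarrow> L2_of (\<lambda>x. c *\<^sub>R f x) = c *\<^sub>R L2_of f"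
  by (simp add: scaleR_L2.abs_eq L2_rel_def)

lemma L2_of_zero: "L2_of (\<lambda>x. 0) = 0"
  by (simp add: zero_L2_def)

lemma inner_L2_of:
  "square_integrable f \<Longrightarrow> square_integrable g \<Longrightarrow>
    L2_of f \<bullet> L2_of g = (LINT x|lborel. f x \<bullet> g x)"
  by (simp add: inner_L2.abs_eq L2_rel_def)

lemma norm_L2_of:
  "square_integrable f \<Longrightarrow> (norm (L2_of f))\<^sup>2 = (LINT x|lborel. (norm (f x))\<^sup>2)"
  by (simp add: power2_norm_eq_inner inner_L2_of)

lemma nn_integral_norm_L2_of:
  assumes "square_integrable f"
  shows "(\<integral>\<^sup>+x. ennreal ((norm (f x))\<^sup>2) \<partial>lborel) = ennreal ((norm (L2_of f))\<^sup>2)"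
  using assms by (simp add: norm_L2_of nn_integral_eq_integral square_integrable_integrable)


lemma tendsto_L2_of_dominated:
  fixes f :: "real \<Rightarrow> 'b::euclidean_space"
  assumes h: "integrable lborel h"
    and F: "\<And>n. F n \<in> borel_measurable borel" "\<And>n x. (norm (F n x))\<^sup>2 \<le> h x"
    and lim: "\<And>x. (\<lambda>n. F n x) \<longlonglongrightarrow> f x"
  shows "square_integrable f" "\<And>n. square_integrable (F n)" "(\<lambda>n. L2_of (F n)) \<longlonglongrightarrow> L2_of f"
proof -
  have fm: "f \<in> borel_measurable borel"
    by (rule borel_measurable_LIMSEQ_metric[OF F(1)]) (use lim in auto)
  have fb: "(norm (f x))\<^sup>2 \<le> h x" for x
    by (rule LIMSEQ_le_const2[OF tendsto_power[OF tendsto_norm[OF lim]]]) (use F(2) in auto)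
  show f: "square_integrable f"
    by (rule square_integrable_bound[OF h _ fb]) (use fm in simp)
  show Fs: "square_integrable (F n)" for n
    by (rule square_integrable_bound[OF h _ F(2)]) (use F in simp)
  have bd: "(norm (F n x - f x))\<^sup>2 \<le> 4 * h x" for n x
    using norm_add_squared_le[of "F n x" "- f x"] F(2)[of n x] fb[of x] by simp
  have "(\<lambda>n. LINT x|lborel. (norm (F n x - f x))\<^sup>2) \<longlonglongrightarrow> (LINT x|(lborel::real measure). 0)"
  proof (rule integral_dominated_convergence[where w="\<lambda>x. 4 * h x"])
    show "AE x in lborel. (\<lambda>n. (norm (F n x - f x))\<^sup>2) \<longlonglongrightarrow> 0"
    proof (rule AE_I2)
      fix x :: real
      have "(\<lambda>n. (norm (F n x - f x))\<^sup>2) \<longlonglongrightarrow> (norm (f x - f x))\<^sup>2"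
        by (intro tendsto_intros lim)
      then show "(\<lambda>n. (norm (F n x - f x))\<^sup>2) \<longlonglongrightarrow> 0" by simp
    qed
  qed (use h fm F bd in auto)
  then have "(\<lambda>n. (norm (L2_of (F n) - L2_of f))\<^sup>2) \<longlonglongrightarrow> 0"
    using f Fs by (simp add: L2_of_diff[symmetric] norm_L2_of square_integrable_diff)
  then have "(\<lambda>n. sqrt ((norm (L2_of (F n) - L2_of f))\<^sup>2)) \<longlonglongrightarrow> sqrt 0"
    by (rule tendsto_real_sqrt)
  then have "(\<lambda>n. norm (L2_of (F n) - L2_of f)) \<longlonglongrightarrow> 0"
    by simp
  then show "(\<lambda>n. L2_of (F n)) \<longlonglongrightarrow> L2_of f"
    using tendsto_norm_zero_iff[of "\<lambda>n. L2_of (F n) - L2_of f" sequentially] LIM_zero_iff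
    by metis
qed

subsection \<open>Completeness (Riesz--Fischer)\<close>

instance L2 :: (euclidean_space) complete_space
proof
  fix X :: "nat \<Rightarrow> 'a L2"
  assume X: "Cauchy X"
  define f where "f n = rep_L2 (X n)" for n
  have f: "square_integrable (f n)" for n
    by (simp add: f_def square_integrable_rep)
  have fm [measurable]: "f n \<in> borel_measurable borel" for n
    using f by (rule square_integrable_measurable)
  have Xf: "X n = L2_of (f n)" for n
    by (simp add: f_def L2_of_rep)
  define w :: "real \<Rightarrow> real" where "w = std_normal_density"
  have wm [measurable]: "w \<in> borel_measurable borel" by (simp add: w_def)
  have wpos: "w x > 0" for x by (simp add: w_def normal_density_pos)
  have wle: "w x \<le> 1" for x
  proof -
    have "1 \<le> sqrt (2 * pi)"
      using pi_gt3 by simp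
    moreover have "exp (- (x\<^sup>2 / 2)) \<le> 1" by simp
    ultimately have "exp (- (x\<^sup>2 / 2)) \<le> sqrt (2 * pi)" by linarith
    then show ?thesis
      unfolding w_def normal_density_def by (simp add: divide_le_eq)
  qed
  have w: "square_integrable w"
  proof (rule square_integrable_bound[where h=w])
    show "integrable lborel w" by (simp add: w_def)
    show "(norm (w x))\<^sup>2 \<le> w x" for x
      using wle[of x] wpos[of x] by (simp add: power2_eq_square mult_left_le)
  qed simp
  define s where "s n x = w x *\<^sub>R f n x" for n x
  have nD: "square_integrable (\<lambda>x. norm (f i x - f j x))" for i j
    using square_integrable_diff[OF f f, of i j] by (auto simp: square_integrable_def)
  have int: "integrable lborel (s n)" for n
  proof (rule Bochner_Integration.integrable_bound)
    have "square_integrable (\<lambda>x. norm (f n x))"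
      using f[of n] by (auto simp: square_integrable_def)
    from integrable_inner_square_integrable[OF w this]
    show "integrable lborel (\<lambda>x. w x * norm (f n x))" by simp
    show "s n \<in> borel_measurable lborel" unfolding s_def by measurable
  qed (simp add: s_def abs_mult)
  have nle: "(LINT x|lborel. norm (s i x - s j x)) \<le> norm (L2_of w) * norm (X i - X j)" for i j
  proof -
    have "(LINT x|lborel. norm (s i x - s j x)) = (LINT x|lborel. w x \<bullet> norm (f i x - f j x))"
      using wpos by (intro Bochner_Integration.integral_cong)
        (simp_all add: s_def scaleR_diff_right[symmetric] abs_of_pos)
    also have "\<dots> = L2_of w \<bullet> L2_of (\<lambda>x. norm (f i x - f j x))"
      by (simp add: inner_L2_of w nD)
    also have "\<dots> \<le> norm (L2_of w) * norm (L2_of (\<lambda>x. norm (f i x - f j x)))"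
      by (rule norm_cauchy_schwarz)
    also have "(norm (L2_of (\<lambda>x. norm (f i x - f j x))))\<^sup>2 = (norm (X i - X j))\<^sup>2"
      using norm_L2_of[OF nD, of i j] norm_L2_of[OF square_integrable_diff[OF f f], of i j]
      by (simp add: Xf L2_of_diff f)
    then have "norm (L2_of (\<lambda>x. norm (f i x - f j x))) = norm (X i - X j)"
      by simp
    finally show ?thesis .
  qed
  have small: "\<exists>N. \<forall>i\<ge>N. \<forall>j\<ge>N. (LINT x|lborel. norm (s i x - s j x)) < e" if "e > 0" for e
  proof -
    define e' where "e' = e / (norm (L2_of w) + 1)"
    have "e' > 0" using that by (simp add: e'_def add_nonneg_pos)
    then obtain N where N: "\<And>i j. i \<ge> N \<Longrightarrow> j \<ge> N \<Longrightarrow> dist (X i) (X j) < e'"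
      using X unfolding Cauchy_def by meson
    have "(LINT x|lborel. norm (s i x - s j x)) < e" if ij: "i \<ge> N" "j \<ge> N" for i j
    proof -
      have "norm (L2_of w) * norm (X i - X j) \<le> norm (L2_of w) * e'"
        using N[OF ij] by (intro mult_left_mono) (auto simp: dist_norm)
      also have "\<dots> < (norm (L2_of w) + 1) * e'"
        using \<open>e' > 0\<close> by (simp add: algebra_simps)
      also have "\<dots> = e"
      proof -
        have "norm (L2_of w) + 1 \<noteq> 0" using norm_ge_zero[of "L2_of w"] by linarith
        then show ?thesis unfolding e'_def by simp
      qed
      finally show ?thesis using nle[of i j] by linarith
    qed
    then show ?thesis by blast
  qed
  obtain r where r: "strict_mono r" "AE x in lborel. Cauchy (\<lambda>i. s (r i) x)"
    using cauchy_L1_AE_cauchy_subseq[OF int small] by blast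
  define h where "h x = lim (\<lambda>i. f (r i) x)" for x
  have hm [measurable]: "h \<in> borel_measurable borel"
    unfolding h_def by measurable
  have conv: "AE x in lborel. (\<lambda>i. f (r i) x) \<longlonglongrightarrow> h x"
    using r(2)
  proof eventually_elim
    case (elim x)
    then have "convergent (\<lambda>i. s (r i) x)"
      by (simp add: Cauchy_convergent_iff)
    then obtain l where "(\<lambda>i. s (r i) x) \<longlonglongrightarrow> l"
      by (auto simp: convergent_def)
    then have "(\<lambda>i. inverse (w x) *\<^sub>R s (r i) x) \<longlonglongrightarrow> inverse (w x) *\<^sub>R l"
      by (intro tendsto_intros)
    moreover have "inverse (w x) *\<^sub>R s (r i) x = f (r i) x" for i
      using wpos[of x] by (simp add: s_def)
    ultimately have "convergent (\<lambda>i. f (r i) x)"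
      by (auto simp: convergent_def)
    then show ?case
      by (simp add: h_def convergent_LIMSEQ_iff)
  qed
  have fatou: "\<exists>N. \<forall>n\<ge>N. (\<integral>\<^sup>+x. ennreal ((norm (h x - f n x))\<^sup>2) \<partial>lborel) \<le> ennreal (e\<^sup>2)"
    if "e > 0" for e :: real
  proof -
    obtain N where N: "\<And>i j. i \<ge> N \<Longrightarrow> j \<ge> N \<Longrightarrow> dist (X i) (X j) < e"
      using X \<open>e > 0\<close> unfolding Cauchy_def by meson
    have "(\<integral>\<^sup>+x. ennreal ((norm (h x - f n x))\<^sup>2) \<partial>lborel) \<le> ennreal (e\<^sup>2)" if n: "n \<ge> N" for n
    proof -
      have "(\<integral>\<^sup>+x. ennreal ((norm (h x - f n x))\<^sup>2) \<partial>lborel)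
          = (\<integral>\<^sup>+x. liminf (\<lambda>i. ennreal ((norm (f (r i) x - f n x))\<^sup>2)) \<partial>lborel)"
      proof (rule nn_integral_cong_AE, use conv in eventually_elim)
        case (elim x)
        then have "(\<lambda>i. ennreal ((norm (f (r i) x - f n x))\<^sup>2))
            \<longlonglongrightarrow> ennreal ((norm (h x - f n x))\<^sup>2)"
          by (intro tendsto_intros)
        then show ?case
          using lim_imp_Liminf[OF trivial_limit_sequentially] by metis
      qed
      also have "\<dots> \<le> liminf (\<lambda>i. \<integral>\<^sup>+x. ennreal ((norm (f (r i) x - f n x))\<^sup>2) \<partial>lborel)"
        by (rule nn_integral_liminf) measurable
      also have "\<dots> \<le> liminf (\<lambda>i. ennreal (e\<^sup>2))"
      proof (rule Liminf_mono)
        have "(\<integral>\<^sup>+x. ennreal ((norm (f (r i) x - f n x))\<^sup>2) \<partial>lborel) \<le> ennreal (e\<^sup>2)"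
          if "i \<ge> N" for i
        proof -
          have "r i \<ge> N" using seq_suble[OF r(1), of i] that by simp
          from N[OF this n] have "norm (X (r i) - X n) < e" by (simp add: dist_norm)
          then have "(norm (X (r i) - X n))\<^sup>2 \<le> e\<^sup>2"
            by (intro power_mono) auto
          then show ?thesis
            using nn_integral_norm_L2_of[OF square_integrable_diff[OF f f], of "r i" n]
            by (simp add: Xf L2_of_diff f ennreal_leI)
        qed
        then show "\<forall>\<^sub>F i in sequentially.
            (\<integral>\<^sup>+x. ennreal ((norm (f (r i) x - f n x))\<^sup>2) \<partial>lborel) \<le> ennreal (e\<^sup>2)"
          unfolding eventually_sequentially by blast
      qed
      also have "\<dots> = ennreal (e\<^sup>2)"
        by (intro Liminf_const) simp
      finally show ?thesis .
    qed
    then show ?thesis by blast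
  qed
  have hdiff: "square_integrable (\<lambda>x. h x - f n x)"
    if "(\<integral>\<^sup>+x. ennreal ((norm (h x - f n x))\<^sup>2) \<partial>lborel) \<le> ennreal e" for n e
    unfolding square_integrable_def
  proof
    show "integrable lborel (\<lambda>x. (norm (h x - f n x))\<^sup>2)"
    proof (rule integrableI_bounded)
      have "(\<integral>\<^sup>+x. ennreal (norm ((norm (h x - f n x))\<^sup>2)) \<partial>lborel) \<le> ennreal e"
        using that by simp
      also have "\<dots> < \<infinity>" by simp
      finally show "(\<integral>\<^sup>+x. ennreal (norm ((norm (h x - f n x))\<^sup>2)) \<partial>lborel) < \<infinity>" .
    qed measurable
  qed measurable
  have h: "square_integrable h"
  proof -
    obtain N where "\<forall>n\<ge>N. (\<integral>\<^sup>+x. ennreal ((norm (h x - f n x))\<^sup>2) \<partial>lborel) \<le> ennreal (1\<^sup>2)"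
      using fatou[of 1] by auto
    then have "square_integrable (\<lambda>x. h x - f N x)" using hdiff by blast
    from square_integrable_add[OF this f[of N]] show ?thesis by simp
  qed
  have "X \<longlonglongrightarrow> L2_of h"
  proof (rule metric_LIMSEQ_I)
    fix e :: real assume "e > 0"
    then obtain N where N: "\<And>n. n \<ge> N \<Longrightarrow>
        (\<integral>\<^sup>+x. ennreal ((norm (h x - f n x))\<^sup>2) \<partial>lborel) \<le> ennreal ((e / 2)\<^sup>2)"
      using fatou[of "e / 2"] by auto
    have "dist (X n) (L2_of h) < e" if "n \<ge> N" for n
    proof -
      have "ennreal ((norm (L2_of h - X n))\<^sup>2) \<le> ennreal ((e / 2)\<^sup>2)"
        using N[OF that] nn_integral_norm_L2_of[OF square_integrable_diff[OF h f], of n]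
        by (simp add: Xf L2_of_diff h f)
      then have "(norm (L2_of h - X n))\<^sup>2 \<le> (e / 2)\<^sup>2" by simp
      then have "norm (L2_of h - X n) \<le> e / 2"
        by (rule power2_le_imp_le) (use \<open>e > 0\<close> in simp)
      then show ?thesis using \<open>e > 0\<close> by (simp add: dist_norm norm_minus_commute)
    qed
    then show "\<exists>N. \<forall>n\<ge>N. dist (X n) (L2_of h) < e" by blast
  qed
  then show "convergent X" by (auto simp: convergent_def)
qed

instance L2 :: (euclidean_space) banach ..

subsection \<open>Separability\<close>


lemma square_integrable_indicator:
  fixes c :: "'b::euclidean_space"
  assumes A: "A \<in> sets borel" "emeasure lborel A < \<infinity>"
  shows "square_integrable (\<lambda>x. indicator A x *\<^sub>R c)"
proof (rule square_integrable_bound[where h="\<lambda>x. indicator A x * (norm c)\<^sup>2"])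
  show "integrable lborel (\<lambda>x. indicator A x * (norm c)\<^sup>2)"
    using A by simp
qed (use A in \<open>auto simp: indicator_def\<close>)

lemma closure_span_subspace:
  fixes E :: "'b::real_normed_vector set"
  shows "subspace (closure (span E))"
proof (rule subspaceI)
  show "0 \<in> closure (span E)"
    using closure_subset span_zero by blast
next
  fix x y assume "x \<in> closure (span E)" "y \<in> closure (span E)"
  then obtain f g where "\<And>n. f n \<in> span E" "f \<longlonglongrightarrow> x" "\<And>n. g n \<in> span E" "g \<longlonglongrightarrow> y"
    unfolding closure_sequential by blast
  then show "x + y \<in> closure (span E)"
    unfolding closure_sequential
    by (intro exI[of _ "\<lambda>n. f n + g n"]) (auto intro: span_add tendsto_add)
next
  fix c :: real and x assume "x \<in> closure (span E)"
  then obtain f where "\<And>n. f n \<in> span E" "f \<longlonglongrightarrow> x"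
    unfolding closure_sequential by blast
  then show "c *\<^sub>R x \<in> closure (span E)"
    unfolding closure_sequential
    by (intro exI[of _ "\<lambda>n. c *\<^sub>R f n"]) (auto intro: span_scale tendsto_scaleR)
qed

lemma countable_dense_span:
  fixes E :: "'b::real_normed_vector set"
  assumes "countable E"
  shows "\<exists>D. countable D \<and> span E \<subseteq> closure D"
proof -
  define D where "D = (\<lambda>xs. \<Sum>(q, e)\<leftarrow>xs. (of_rat q :: real) *\<^sub>R e) ` lists (UNIV \<times> E)"
  have "countable D"
    unfolding D_def using assms by (intro countable_image countable_lists) auto
  moreover have "x \<in> closure D" if "x \<in> span E" for x
    using that
  proof (induction rule: span_induct_alt)
    case base
    have "0 \<in> D" unfolding D_def by (rule image_eqI[of _ _ "[]"]) auto
    then show ?case using closure_subset by blast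
  next
    case (step c x y)
    show ?case
      unfolding closure_approachable
    proof (intro allI impI)
      fix \<epsilon> :: real assume "\<epsilon> > 0"
      then obtain d where d: "d \<in> D" "dist d y < \<epsilon> / 2"
        using step(2) unfolding closure_approachable by (meson half_gt_zero)
      define \<delta> where "\<delta> = \<epsilon> / (2 * (norm x + 1))"
      have "\<delta> > 0" using \<open>\<epsilon> > 0\<close> by (simp add: \<delta>_def add_nonneg_pos)
      then obtain q where q: "c < of_rat q" "of_rat q < c + \<delta>"
        using of_rat_dense[of c "c + \<delta>"] by auto
      obtain xs where xs: "xs \<in> lists (UNIV \<times> E)" "d = (\<Sum>(q, e)\<leftarrow>xs. (of_rat q :: real) *\<^sub>R e)"
        using d(1) unfolding D_def by blast
      have "of_rat q *\<^sub>R x + d \<in> D"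
        unfolding D_def using xs step(1) by (intro image_eqI[of _ _ "(q, x) # xs"]) auto
      moreover have "dist (of_rat q *\<^sub>R x + d) (c *\<^sub>R x + y) < \<epsilon>"
      proof -
        have "dist (of_rat q *\<^sub>R x + d) (c *\<^sub>R x + y) = norm ((of_rat q - c) *\<^sub>R x + (d - y))"
          by (simp add: dist_norm algebra_simps)
        also have "\<dots> \<le> \<bar>of_rat q - c\<bar> * norm x + norm (d - y)"
          by (rule order_trans[OF norm_triangle_ineq]) simp
        also have "\<bar>of_rat q - c\<bar> * norm x \<le> \<delta> * (norm x + 1)"
          using q \<open>\<delta> > 0\<close> by (intro mult_mono) auto
        also have "\<delta> * (norm x + 1) = \<epsilon> / 2"
        proof -
          have "norm x + 1 \<noteq> 0" using norm_ge_zero[of x] by linarith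
          then show ?thesis unfolding \<delta>_def by (simp add: field_simps)
        qed
        finally show ?thesis using d(2) by (simp add: dist_norm)
      qed
      ultimately show "\<exists>z\<in>D. dist z (c *\<^sub>R x + y) < \<epsilon>" by blast
    qed
  qed
  ultimately show ?thesis by blast
qed

lemma L2_of_sum:
  assumes "finite I" "\<And>i. i \<in> I \<Longrightarrow> square_integrable (f i)"
  shows "square_integrable (\<lambda>x. \<Sum>i\<in>I. f i x) \<and> L2_of (\<lambda>x. \<Sum>i\<in>I. f i x) = (\<Sum>i\<in>I. L2_of (f i))"
  using assms
  by (induction rule: finite_induct)
    (auto simp: square_integrable_zero L2_of_zero square_integrable_add L2_of_add)

lemma L2_separable:
  "\<exists>D :: 'b::euclidean_space L2 set. countable D \<and> closure D = UNIV"
proof -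
  define E :: "'b L2 set" where
    "E = (\<lambda>(p, q, e). L2_of (\<lambda>x. indicator {of_rat p..of_rat q} x *\<^sub>R e)) `
           ((UNIV :: rat set) \<times> (UNIV :: rat set) \<times> Basis)"
  have "countable E"
    unfolding E_def
    by (intro countable_image countable_SIGMA) (auto intro: countable_finite)
  define C where "C = closure (span E)"
  have sub: "subspace C" unfolding C_def by (rule closure_span_subspace)
  have lim: "l \<in> C" if "\<And>n. X n \<in> C" "X \<longlonglongrightarrow> l" for X l
    using closed_sequentially[of C X l] that by (simp add: C_def)
  have ind: "L2_of (\<lambda>x. indicator {a..b} x *\<^sub>R e) \<in> C" if e: "e \<in> Basis" for a b :: real and e :: 'b
  proof (cases "a \<le> b")
    case False
    then show ?thesis using sub by (simp add: L2_of_zero subspace_0)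
  next
    case True
    have "\<exists>p. a - inverse (real (Suc n)) < of_rat p \<and> of_rat p < a" for n
      by (rule of_rat_dense) simp
    then obtain p where p: "\<And>n. a - inverse (real (Suc n)) < of_rat (p n)" "\<And>n. of_rat (p n) < a"
      by metis
    have "\<exists>q. b < of_rat q \<and> of_rat q < b + inverse (real (Suc n))" for n
      by (rule of_rat_dense) simp
    then obtain q where q: "\<And>n. b < of_rat (q n)" "\<And>n. of_rat (q n) < b + inverse (real (Suc n))"
      by metis
    have pl: "(\<lambda>n. of_rat (p n)) \<longlonglongrightarrow> a"
    proof (rule tendsto_sandwich[OF _ _ _ tendsto_const])
      show "(\<lambda>n. a - inverse (real (Suc n))) \<longlonglongrightarrow> a"
        using tendsto_diff[OF tendsto_const LIMSEQ_inverse_real_of_nat, of a] by simp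
    qed (use p in \<open>auto intro!: always_eventually less_imp_le\<close>)
    have ql: "(\<lambda>n. of_rat (q n)) \<longlonglongrightarrow> b"
    proof (rule tendsto_sandwich[OF _ _ tendsto_const])
      show "(\<lambda>n. b + inverse (real (Suc n))) \<longlonglongrightarrow> b"
        using tendsto_add[OF tendsto_const LIMSEQ_inverse_real_of_nat, of b] by simp
    qed (use q in \<open>auto intro!: always_eventually less_imp_le\<close>)
    let ?F = "\<lambda>n (x :: real). indicator {of_rat (p n)..of_rat (q n)} x *\<^sub>R e"
    have "(\<lambda>n. L2_of (?F n)) \<longlonglongrightarrow> L2_of (\<lambda>x. indicator {a..b} x *\<^sub>R e)"
    proof (rule tendsto_L2_of_dominated(3)[where h="\<lambda>x. indicator {a - 1..b + 1} x * (norm e)\<^sup>2"])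
      show "integrable lborel (\<lambda>x. indicator {a - 1..b + 1} x * (norm e)\<^sup>2)"
        by (intro integrable_mult_left integrable_real_indicator) (auto simp: emeasure_lborel_Icc_eq)
      have "inverse (real (Suc n)) \<le> 1" for n by (simp add: inverse_le_1_iff)
      then have "a - 1 < of_rat (p n)" "of_rat (q n) < b + 1" for n
        using p(1)[of n] q(2)[of n] by (smt (verit))+
      then have "{of_rat (p n)..of_rat (q n)} \<subseteq> {a - 1..b + 1}" for n
        by (smt (verit) atLeastAtMost_iff subsetI)
      then have "indicator {of_rat (p n)..of_rat (q n)} x \<le> (indicator {a - 1..b + 1} x :: real)" for n x
        by (intro indicator_leI) (meson subsetD)
      moreover have "(norm (?F n x))\<^sup>2 = indicator {of_rat (p n)..of_rat (q n)} (x :: real) * (norm e)\<^sup>2" for n and x :: real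
        by (simp add: indicator_def)
      ultimately show "(norm (?F n x))\<^sup>2 \<le> indicator {a - 1..b + 1} x * (norm e)\<^sup>2" for n x
        by (metis mult_right_mono zero_le_power2)
      show "(\<lambda>n. ?F n x) \<longlonglongrightarrow> indicator {a..b} x *\<^sub>R e" for x
      proof -
        have "\<forall>\<^sub>F n in sequentially. indicator {of_rat (p n)..of_rat (q n)} x = (indicator {a..b} x :: real)"
        proof -
          consider "x < a" | "x > b" | "a \<le> x" "x \<le> b" by linarith
          then show ?thesis
          proof cases
            case 1
            then show ?thesis
              by (intro eventually_mono[OF order_tendstoD(1)[OF pl 1]]) (simp add: indicator_def)
          next
            case 2
            then show ?thesis
              by (intro eventually_mono[OF order_tendstoD(2)[OF ql 2]]) (simp add: indicator_def)
          next
            case 3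
            have "of_rat (p n) \<le> x" "x \<le> of_rat (q n)" for n
              using 3 p(2)[of n] q(1)[of n] by linarith+
            then show ?thesis
              using 3 by (intro always_eventually) (simp add: indicator_def)
          qed
        qed
        then have "(\<lambda>n. indicator {of_rat (p n)..of_rat (q n)} x :: real) \<longlonglongrightarrow> indicator {a..b} x"
          by (rule tendsto_eventually)
        then show ?thesis by (intro tendsto_scaleR tendsto_const)
      qed
    qed measurable
    moreover have "L2_of (?F n) \<in> C" for n
    proof -
      have "L2_of (?F n) \<in> E"
        unfolding E_def using e by (intro image_eqI[of _ _ "(p n, q n, e)"]) auto
      then show ?thesis unfolding C_def using span_base closure_subset by blast
    qed
    ultimately show ?thesis by (rule lim[rotated])
  qed
  have bnd: "L2_of (\<lambda>x. indicator (A \<inter> {- real n..real n}) x *\<^sub>R e) \<in> C"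
    if "A \<in> sets borel" and e: "e \<in> Basis" for A :: "real set" and n and e :: 'b
    using that(1)
  proof (induction rule: borel_set_induct)
    case empty
    then show ?case using sub by (simp add: L2_of_zero subspace_0)
  next
    case (interval a b)
    have "{a..b} \<inter> {- real n..real n} = {max a (- real n)..min b (real n)}" by auto
    then show ?case using ind[OF e] by metis
  next
    case (compl A)
    have fin: "emeasure lborel (A \<inter> {- real n..real n}) < \<infinity>"
      by (rule le_less_trans[OF emeasure_mono[of _ "{- real n..real n}"]]) (auto simp: emeasure_lborel_Icc_eq)
    have "L2_of (\<lambda>x. indicator (- A \<inter> {- real n..real n}) x *\<^sub>R e)
        = L2_of (\<lambda>x. indicator {- real n..real n} x *\<^sub>R e - indicator (A \<inter> {- real n..real n}) x *\<^sub>R e)"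
      by (rule arg_cong[where f=L2_of]) (auto simp: indicator_def)
    also have "\<dots> = L2_of (\<lambda>x. indicator {- real n..real n} x *\<^sub>R e)
        - L2_of (\<lambda>x. indicator (A \<inter> {- real n..real n}) x *\<^sub>R e)"
      using compl fin by (intro L2_of_diff square_integrable_indicator) auto
    also have "\<dots> \<in> C"
      using ind[OF e] compl by (intro subspace_diff[OF sub]) auto
    finally show ?case .
  next
    case (union f)
    have fin: "emeasure lborel (f i \<inter> {- real n..real n}) < \<infinity>" for i
      by (rule le_less_trans[OF emeasure_mono[of _ "{- real n..real n}"]]) (use union in \<open>auto simp: emeasure_lborel_Icc_eq\<close>)
    let ?F = "\<lambda>k x. indicator ((\<Union>i<k. f i) \<inter> {- real n..real n}) x *\<^sub>R e"
    have "(\<lambda>k. L2_of (?F k)) \<longlonglongrightarrow> L2_of (\<lambda>x. indicator ((\<Union>i. f i) \<inter> {- real n..real n}) x *\<^sub>R e)"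
    proof (rule tendsto_L2_of_dominated(3)[where h="\<lambda>x. indicator {- real n..real n} x * (norm e)\<^sup>2"])
      show "integrable lborel (\<lambda>x. indicator {- real n..real n} x * (norm e)\<^sup>2)"
        by (intro integrable_mult_left integrable_real_indicator) (auto simp: emeasure_lborel_Icc_eq)
      show "?F k \<in> borel_measurable borel" for k
        using union by measurable
      show "(\<lambda>k. ?F k x) \<longlonglongrightarrow> indicator ((\<Union>i. f i) \<inter> {- real n..real n}) x *\<^sub>R e" for x
      proof (rule tendsto_scaleR[OF _ tendsto_const])
        have "(\<lambda>k. indicator (\<Union>i<k. f i) x * indicator {- real n..real n} x :: real)
            \<longlonglongrightarrow> indicator (\<Union>i. f i) x * indicator {- real n..real n} x"
          by (intro tendsto_mult tendsto_const LIMSEQ_indicator_UN)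
        then show "(\<lambda>k. indicator ((\<Union>i<k. f i) \<inter> {- real n..real n}) x :: real)
            \<longlonglongrightarrow> indicator ((\<Union>i. f i) \<inter> {- real n..real n}) x"
          by (simp add: indicator_inter_arith)
      qed
    qed (auto simp: indicator_def)
    moreover have "L2_of (?F k) \<in> C" for k
    proof -
      have "?F k = (\<lambda>x. \<Sum>i<k. indicator (f i \<inter> {- real n..real n}) x *\<^sub>R e)"
      proof
        fix x
        have "(indicator (\<Union>i<k. f i) x :: real) = (\<Sum>i<k. indicator (f i) x)"
          by (rule indicator_UN_disjoint)
            (use union(1) in \<open>auto intro: disjoint_family_on_mono\<close>)
        then show "?F k x = (\<Sum>i<k. indicator (f i \<inter> {- real n..real n}) x *\<^sub>R e)"
          by (simp add: indicator_inter_arith scaleR_sum_left[symmetric] sum_distrib_right[symmetric])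
      qed
      moreover have "L2_of (\<lambda>x. \<Sum>i<k. indicator (f i \<inter> {- real n..real n}) x *\<^sub>R e)
          = (\<Sum>i<k. L2_of (\<lambda>x. indicator (f i \<inter> {- real n..real n}) x *\<^sub>R e))"
        using union fin by (intro L2_of_sum[THEN conjunct2] square_integrable_indicator) auto
      ultimately show ?thesis
        using union by (simp add: subspace_sum[OF sub])
    qed
    ultimately show ?case by (rule lim[rotated])
  qed
  have fin: "L2_of (\<lambda>x. indicator A x *\<^sub>R c) \<in> C"
    if A: "A \<in> sets borel" "emeasure lborel A < \<infinity>" for A and c :: 'b
  proof -
    have e: "L2_of (\<lambda>x. indicator A x *\<^sub>R e) \<in> C" if e: "e \<in> Basis" for e :: 'b
    proof (rule lim[OF bnd[OF A(1) e]])
      show "(\<lambda>n. L2_of (\<lambda>x. indicator (A \<inter> {- real n..real n}) x *\<^sub>R e)) \<longlonglongrightarrow>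
          L2_of (\<lambda>x. indicator A x *\<^sub>R e)"
      proof (rule tendsto_L2_of_dominated(3)[where h="\<lambda>x. indicator A x * (norm e)\<^sup>2"])
        show "integrable lborel (\<lambda>x. indicator A x * (norm e)\<^sup>2)"
          using A by (intro integrable_mult_left integrable_real_indicator) (auto simp: emeasure_lborel_Icc_eq)
        show "(\<lambda>n. indicator (A \<inter> {- real n..real n}) x *\<^sub>R e) \<longlonglongrightarrow> indicator A x *\<^sub>R e" for x
        proof (rule tendsto_eventually)
          obtain k :: nat where "\<bar>x\<bar> \<le> real k" using real_arch_simple by blast
          then have "indicator (A \<inter> {- real n..real n}) x *\<^sub>R e = indicator A x *\<^sub>R e" if "n \<ge> k" for n
            using that by (auto simp: indicator_def)
          then show "\<forall>\<^sub>F n in sequentially.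
              indicator (A \<inter> {- real n..real n}) x *\<^sub>R e = indicator A x *\<^sub>R e"
            unfolding eventually_sequentially by blast
        qed
      qed (use A in \<open>auto simp: indicator_def\<close>)
    qed
    have si: "square_integrable (\<lambda>x. indicator A x *\<^sub>R e)" for e :: 'b
      by (rule square_integrable_indicator[OF A])
    have "(\<lambda>x. indicator A x *\<^sub>R c) = (\<lambda>x. \<Sum>e\<in>Basis. (c \<bullet> e) *\<^sub>R indicator A x *\<^sub>R e)"
    proof
      fix x :: real
      have "indicator A x *\<^sub>R c = indicator A x *\<^sub>R (\<Sum>e\<in>Basis. (c \<bullet> e) *\<^sub>R e)"
        by (simp add: euclidean_representation)
      also have "\<dots> = (\<Sum>e\<in>Basis. (c \<bullet> e) *\<^sub>R indicator A x *\<^sub>R e)"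
        unfolding scaleR_sum_right by (simp add: mult.commute)
      finally show "indicator A x *\<^sub>R c = (\<Sum>e\<in>Basis. (c \<bullet> e) *\<^sub>R indicator A x *\<^sub>R e)" .
    qed
    then have "L2_of (\<lambda>x. indicator A x *\<^sub>R c)
        = L2_of (\<lambda>x. \<Sum>e\<in>Basis. (c \<bullet> e) *\<^sub>R indicator A x *\<^sub>R e)" by (rule arg_cong)
    also have "\<dots> = (\<Sum>e\<in>Basis. L2_of (\<lambda>x. (c \<bullet> e) *\<^sub>R indicator A x *\<^sub>R e))"
      using si by (intro L2_of_sum[THEN conjunct2] square_integrable_scaleR) auto
    also have "\<dots> = (\<Sum>e\<in>Basis. (c \<bullet> e) *\<^sub>R L2_of (\<lambda>x. indicator A x *\<^sub>R e))"
      using si by (intro sum.cong refl L2_of_scaleR)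
    also have "\<dots> \<in> C"
      using e by (intro subspace_sum[OF sub] subspace_scale[OF sub])
    finally show ?thesis .
  qed
  have all: "L2_of f \<in> C" if f: "square_integrable f" for f :: "real \<Rightarrow> 'b"
  proof -
    have "f \<in> borel_measurable lborel" using f by (simp add: square_integrable_def)
    from borel_measurable_implies_sequence_metric[OF this, of 0]
    obtain F where F: "\<And>i. simple_function lborel (F i)" "\<And>x. (\<lambda>i. F i x) \<longlonglongrightarrow> f x"
      "\<And>i x. norm (F i x) \<le> 2 * norm (f x)" by auto
    have bd: "(norm (F i x))\<^sup>2 \<le> 4 * (norm (f x))\<^sup>2" for i x
      using power_mono[OF F(3) norm_ge_zero, of i x 2] by (simp add: power_mult_distrib)
    have h: "integrable lborel (\<lambda>x. 4 * (norm (f x))\<^sup>2)"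
      using f by (simp add: square_integrable_def)
    have Fm: "F i \<in> borel_measurable borel" for i
      using borel_measurable_simple_function[OF F(1)[of i]] by simp
    note T = tendsto_L2_of_dominated[of "\<lambda>x. 4 * (norm (f x))\<^sup>2" F f, OF h Fm bd F(2)]
    have "L2_of (F i) \<in> C" for i
    proof -
      let ?R = "range (F i) - {0}"
      have finR: "finite (range (F i))"
        using F(1)[of i] by (simp add: simple_function_def)
      have meas: "F i -` {y} \<in> sets borel" for y
        using measurable_sets[OF Fm[of i], of "{y}"] by simp
      have lt: "emeasure lborel (F i -` {y}) < \<infinity>" if "y \<noteq> 0" for y
      proof -
        have "ennreal ((norm y)\<^sup>2) * emeasure lborel (F i -` {y})
            = (\<integral>\<^sup>+x. ennreal ((norm y)\<^sup>2) * indicator (F i -` {y}) x \<partial>lborel)"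
          using meas by (simp add: nn_integral_cmult_indicator)
        also have "\<dots> \<le> (\<integral>\<^sup>+x. ennreal ((norm (F i x))\<^sup>2) \<partial>lborel)"
          by (intro nn_integral_mono) (auto simp: indicator_def)
        also have "\<dots> < \<infinity>"
          using nn_integral_norm_L2_of[OF T(2), of i] by simp
        finally show ?thesis
          using that by (auto simp: ennreal_mult_less_top less_top[symmetric])
      qed
      have "F i = (\<lambda>x. \<Sum>y\<in>?R. indicator (F i -` {y}) x *\<^sub>R y)"
      proof
        fix x
        have "(\<Sum>y\<in>?R. indicator (F i -` {y}) x *\<^sub>R y) = (\<Sum>y\<in>range (F i). indicator (F i -` {y}) x *\<^sub>R y)"
          using finR by (intro sum.mono_neutral_left) auto
        also have "\<dots> = F i x"
          using simple_function_indicator_representation_banach[OF F(1)[of i], of x, symmetric]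
          by (simp only: space_lborel space_borel Int_UNIV_right UNIV_I simp_thms)
        finally show "F i x = (\<Sum>y\<in>?R. indicator (F i -` {y}) x *\<^sub>R y)" by simp
      qed
      then have "L2_of (F i) = L2_of (\<lambda>x. \<Sum>y\<in>?R. indicator (F i -` {y}) x *\<^sub>R y)"
        by (rule arg_cong)
      also have "\<dots> = (\<Sum>y\<in>?R. L2_of (\<lambda>x. indicator (F i -` {y}) x *\<^sub>R y))"
        using finR meas lt
        by (intro L2_of_sum[THEN conjunct2] square_integrable_indicator) auto
      also have "\<dots> \<in> C"
        using meas lt by (intro subspace_sum[OF sub] fin) auto
      finally show ?thesis .
    qed
    then show ?thesis using T(3) by (rule lim)
  qed
  have "C = UNIV"
    using all[OF square_integrable_rep] by (auto simp: L2_of_rep)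
  moreover obtain D where "countable D" "span E \<subseteq> closure D"
    using countable_dense_span[OF \<open>countable E\<close>] by blast
  moreover have "C \<subseteq> closure D"
    unfolding C_def using \<open>span E \<subseteq> closure D\<close> by (intro closure_minimal) auto
  ultimately show ?thesis by blast
qed

instance L2 :: (euclidean_space) second_countable_topology
proof
  obtain D :: "'a L2 set" where D: "countable D" "closure D = UNIV"
    using L2_separable by blast
  define B where "B = (\<lambda>(d, n). ball d (inverse (real (Suc n)))) ` (D \<times> (UNIV :: nat set))"
  have "topological_basis B"
  proof (rule topological_basisI)
    show "open b" if "b \<in> B" for b
      using that by (auto simp: B_def)
  next
    fix U :: "'a L2 set" and x assume "open U" "x \<in> U"
    then obtain e where e: "e > 0" "ball x e \<subseteq> U" by (rule openE)
    obtain n where n: "inverse (real (Suc n)) < e / 2"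
      using reals_Archimedean[of "e / 2"] e(1) by auto
    obtain d where d: "d \<in> D" "dist d x < inverse (real (Suc n))"
      using D(2) closure_approachable[of x D] by (metis UNIV_I inverse_positive_iff_positive of_nat_0_less_iff zero_less_Suc)
    have "ball d (inverse (real (Suc n))) \<subseteq> ball x e"
    proof
      fix z assume "z \<in> ball d (inverse (real (Suc n)))"
      then show "z \<in> ball x e"
        using d(2) n dist_triangle[of x z d] by (simp add: dist_commute)
    qed
    then show "\<exists>b\<in>B. x \<in> b \<and> b \<subseteq> U"
      using d e(2) by (intro bexI[of _ "ball d (inverse (real (Suc n)))"]) (auto simp: B_def)
  qed
  moreover have "countable B"
    unfolding B_def using D(1) by (intro countable_image) auto
  ultimately show "\<exists>B :: 'a L2 set set. countable B \<and> open = generate_topology B"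
    using topological_basis_imp_subbasis by blast
qed

definition supported_L2 :: "real set \<Rightarrow> 'b::euclidean_space L2 set" where
  "supported_L2 S = {f. AE x in lborel. x \<notin> S \<longrightarrow> rep_L2 f x = 0}"


section \<open>Brownian motion, progressive measurability and the Ito integral\<close>

text \<open>Augmentation by the null sets of the (complete) space of the filtration generated by
  the process. The time set is the half-line of nonnegative reals; values of processes at
  negative times play no role.\<close>

definition augmented_filtration ::
    "'a measure \<Rightarrow> (real \<Rightarrow> 'a \<Rightarrow> real) \<Rightarrow> real \<Rightarrow> 'a measure" where
  "augmented_filtration M W t = sigma (space M)
     ({W s -` A \<inter> space M | s A. s \<in> {0..t} \<and> A \<in> sets borel} \<union> null_sets M)"

definition brownian_motion ::
    "'a measure \<Rightarrow> (real \<Rightarrow> 'a measure) \<Rightarrow> (real \<Rightarrow> 'a \<Rightarrow> real) \<Rightarrow> bool" where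
  "brownian_motion M F W \<longleftrightarrow>
     (\<forall>t\<ge>0. subalgebra M (F t) \<and> W t \<in> borel_measurable (F t)) \<and>
     (AE \<omega> in M. W 0 \<omega> = 0) \<and>
     (AE \<omega> in M. continuous_on {0..} (\<lambda>t. W t \<omega>)) \<and>
     (\<forall>s\<ge>0. \<forall>t>s.
        distributed M lborel (\<lambda>\<omega>. W t \<omega> - W s \<omega>) (normal_density 0 (sqrt (t - s))) \<and>
        prob_space.indep_set M (sets (F s))
          (sets (vimage_algebra (space M) (\<lambda>\<omega>. W t \<omega> - W s \<omega>) borel)))"

definition progressive ::
    "(real \<Rightarrow> 'a measure) \<Rightarrow> real \<Rightarrow> real \<Rightarrow> (real \<Rightarrow> 'a \<Rightarrow> 'h::topological_space) \<Rightarrow> bool"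
  where
  "progressive F t T X \<longleftrightarrow>
     (\<forall>s\<in>{t..T}. (\<lambda>(\<rho>, \<omega>). X \<rho> \<omega>)
        \<in> borel_measurable (restrict_space borel {t..s} \<Otimes>\<^sub>M F s))"

text \<open>The data \<open>(n, p, c)\<close> stand for the elementary process on \<open>[t, s]\<close> that equals the bounded
  \<open>F (p i)\<close>-measurable variable \<open>c i\<close> on \<open>(p i, p (Suc i)]\<close>, where \<open>p\<close> is a partition of
  \<open>[t, s]\<close>.\<close>

definition elementary ::
    "(real \<Rightarrow> 'a measure) \<Rightarrow> real \<Rightarrow> real \<Rightarrow> nat \<Rightarrow> (nat \<Rightarrow> real) \<Rightarrow>
       (nat \<Rightarrow> 'a \<Rightarrow> 'h::real_normed_vector) \<Rightarrow> bool" where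
  "elementary F t s n p c \<longleftrightarrow>
     p 0 = t \<and> p n = s \<and> (\<forall>i<n. p i \<le> p (Suc i)) \<and>
     (\<forall>i<n. c i \<in> borel_measurable (F (p i)) \<and>
        (\<exists>K. \<forall>\<omega>\<in>space (F (p i)). norm (c i \<omega>) \<le> K))"

definition elementary_process ::
    "nat \<Rightarrow> (nat \<Rightarrow> real) \<Rightarrow> (nat \<Rightarrow> 'a \<Rightarrow> 'h::real_normed_vector) \<Rightarrow> real \<Rightarrow> 'a \<Rightarrow> 'h" where
  "elementary_process n p c \<rho> \<omega> = (\<Sum>i<n. indicator {p i<..p (Suc i)} \<rho> *\<^sub>R c i \<omega>)"

definition elementary_integral ::
    "(real \<Rightarrow> 'a \<Rightarrow> real) \<Rightarrow> nat \<Rightarrow> (nat \<Rightarrow> real) \<Rightarrow>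
       (nat \<Rightarrow> 'a \<Rightarrow> 'h::real_normed_vector) \<Rightarrow> 'a \<Rightarrow> 'h" where
  "elementary_integral W n p c \<omega> = (\<Sum>i<n. (W (p (Suc i)) \<omega> - W (p i) \<omega>) *\<^sub>R c i \<omega>)"

text \<open>\<open>I\<close> is (a version of) the Ito integral of the progressively measurable process \<open>\<Phi>\<close> over
  \<open>[t, s]\<close>: the mean square limit of the integrals of elementary processes converging to \<open>\<Phi>\<close> in
  mean square. An operator-valued integrand with values in the linear maps from the reals to
  \<open>'h\<close> is identified with its value at 1.\<close>

definition has_ito_integral ::
    "'a measure \<Rightarrow> (real \<Rightarrow> 'a measure) \<Rightarrow> (real \<Rightarrow> 'a \<Rightarrow> real) \<Rightarrow> real \<Rightarrow> real \<Rightarrow>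
       (real \<Rightarrow> 'a \<Rightarrow> 'h::{banach, second_countable_topology}) \<Rightarrow> ('a \<Rightarrow> 'h) \<Rightarrow> bool" where
  "has_ito_integral M F W t s \<Phi> I \<longleftrightarrow>
     progressive F t s \<Phi> \<and> I \<in> borel_measurable M \<and>
     (\<exists>n p c.
        (\<forall>k. elementary F t s (n k) (p k) (c k)) \<and>
        (\<lambda>k. \<integral>\<^sup>+(\<rho>, \<omega>). ennreal ((norm (elementary_process (n k) (p k) (c k) \<rho> \<omega> - \<Phi> \<rho> \<omega>))\<^sup>2)
           \<partial>(restrict_space lborel {t..s} \<Otimes>\<^sub>M M)) \<longlonglongrightarrow> 0 \<and>
        (\<lambda>k. \<integral>\<^sup>+\<omega>. ennreal ((norm (elementary_integral W (n k) (p k) (c k) \<omega> - I \<omega>))\<^sup>2) \<partial>M)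
           \<longlonglongrightarrow> 0)"


section \<open>The delay problem\<close>

text \<open>The fields are, in this order, \<open>T\<close>, \<open>d\<close>, \<open>r\<close>, \<open>\<sigma>\<close>, \<open>a\<^sub>0\<close>, \<open>a\<^sub>1\<close>, \<open>b\<^sub>0\<close>, \<open>b\<^sub>1\<close>, and the
  coefficients of the objective. The function \<open>b\<^sub>1\<close> lives on \<open>[-d, 0]\<close> and is extended by 0.\<close>

record lq_data =
  horizon :: real
  delay :: real
  rate :: real
  vol :: real
  drift_a0 :: real
  drift_a1 :: real
  ctrl_b0 :: real
  ctrl_b1 :: "real L2"
  alpha0 :: real
  alpha1 :: real
  beta0 :: real
  beta1 :: real
  lambda0 :: real
  lambda1 :: real
  gamma0 :: real
  gamma1 :: real

definition alpha_vec :: "lq_data \<Rightarrow> real^2" where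
  "alpha_vec P = vector [alpha0 P, - alpha1 P]"

definition beta_vec :: "lq_data \<Rightarrow> real^2" where
  "beta_vec P = vector [beta0 P, beta1 P]"

definition lambda_vec :: "lq_data \<Rightarrow> real^2" where
  "lambda_vec P = vector [lambda0 P, - lambda1 P]"

text \<open>The Hilbert space of the problem consists of the elements of this type whose second
  component is supported in \<open>[-d, 0]\<close>. Its inner product is the one of the product type.\<close>

type_synonym hilb = "(real^2) \<times> (real^2) L2"

definition H_space :: "lq_data \<Rightarrow> hilb set" where
  "H_space P = UNIV \<times> supported_L2 {- delay P..0}"

text \<open>The multiplication in \<open>real^'n^'n\<close> is componentwise, so the library function \<open>exp\<close> is not
  available for matrices.\<close>

definition mat_exp :: "real^'n^'n \<Rightarrow> real^'n^'n" where
  "mat_exp X = (\<Sum>k. (1 / fact k) *\<^sub>R (((**) X ^^ k) (mat 1)))"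

definition A0_mat :: "lq_data \<Rightarrow> real^2^2" where
  "A0_mat P = vector [vector [drift_a0 P, drift_a1 P], vector [0, drift_a0 P + drift_a1 P]]"

text \<open>The semigroups \<open>e\<^bsup>tA\<^esup>\<close> and \<open>e\<^bsup>tA*\<^esup>\<close> for \<open>t \<ge> 0\<close>, on \<open>H_space P\<close>.\<close>

definition semigroup_A :: "lq_data \<Rightarrow> real \<Rightarrow> hilb \<Rightarrow> hilb" where
  "semigroup_A P t y =
     (mat_exp (t *\<^sub>R A0_mat P) *v fst y
        + (LINT s:{- delay P..0}|lborel.
             indicator {- t..0} s *\<^sub>R (mat_exp ((t + s) *\<^sub>R A0_mat P) *v rep_L2 (snd y) s)),
      L2_of (\<lambda>\<xi>. indicator {- delay P + t..0} \<xi> *\<^sub>R rep_L2 (snd y) (\<xi> - t)))"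

definition semigroup_A_adj :: "lq_data \<Rightarrow> real \<Rightarrow> hilb \<Rightarrow> hilb" where
  "semigroup_A_adj P t y =
     (mat_exp (t *\<^sub>R transpose (A0_mat P)) *v fst y,
      L2_of (\<lambda>\<xi>. indicator ({- delay P..0} \<inter> {- t..0}) \<xi> *\<^sub>R
                 (mat_exp ((\<xi> + t) *\<^sub>R transpose (A0_mat P)) *v fst y)
               + indicator {- delay P..- t} \<xi> *\<^sub>R rep_L2 (snd y) (\<xi> + t)))"

definition op_G :: "lq_data \<Rightarrow> real \<Rightarrow> hilb" where
  "op_G P x = (vector [vol P * x, 0], 0)"

definition op_B :: "lq_data \<Rightarrow> real^2 \<Rightarrow> hilb" where
  "op_B P q = (ctrl_b0 P *\<^sub>R q, L2_of (\<lambda>\<xi>. rep_L2 (ctrl_b1 P) \<xi> *\<^sub>R q))"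

definition op_B_adj :: "lq_data \<Rightarrow> hilb \<Rightarrow> real^2" where
  "op_B_adj P y = ctrl_b0 P *\<^sub>R fst y
     + (LINT \<xi>:{- delay P..0}|lborel. rep_L2 (ctrl_b1 P) \<xi> *\<^sub>R rep_L2 (snd y) \<xi>)"


subsection \<open>Controls, state equation and objective\<close>

text \<open>A control is represented by a pair \<open>(u, z)\<close> of real processes on \<open>[0, T]\<close>.\<close>

type_synonym 'a control = "(real \<Rightarrow> 'a \<Rightarrow> real) \<times> (real \<Rightarrow> 'a \<Rightarrow> real)"

definition ctrl_vec :: "'a control \<Rightarrow> real \<Rightarrow> 'a \<Rightarrow> real^2" where
  "ctrl_vec uz s \<omega> = vector [fst uz s \<omega>, snd uz s \<omega>]"

definition controls ::
    "lq_data \<Rightarrow> 'a measure \<Rightarrow> (real \<Rightarrow> 'a \<Rightarrow> real) \<Rightarrow> (real \<Rightarrow> 'a \<Rightarrow> real) set" where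
  "controls P M W = {u. progressive (augmented_filtration M W) 0 (horizon P) u \<and>
     integrable (restrict_space lborel {0..horizon P} \<Otimes>\<^sub>M M) (\<lambda>(s, \<omega>). (u s \<omega>)\<^sup>2)}"

text \<open>The constraint \<open>u = z\<close> is equality in \<open>L\<^sup>2\<close>, that is, almost everywhere.\<close>

definition admissible ::
    "lq_data \<Rightarrow> 'a measure \<Rightarrow> (real \<Rightarrow> 'a \<Rightarrow> real) \<Rightarrow> 'a control set" where
  "admissible P M W = {(u, z). u \<in> controls P M W \<and> z \<in> controls P M W \<and>
     (AE (s, \<omega>) in restrict_space lborel {0..horizon P} \<Otimes>\<^sub>M M. u s \<omega> = z s \<omega>)}"

definition mild_solution ::
    "lq_data \<Rightarrow> 'a measure \<Rightarrow> (real \<Rightarrow> 'a \<Rightarrow> real) \<Rightarrow> real \<Rightarrow> hilb \<Rightarrow> 'a control \<Rightarrow>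
       (real \<Rightarrow> 'a \<Rightarrow> hilb) \<Rightarrow> bool" where
  "mild_solution P M W t y uz Y \<longleftrightarrow>
     progressive (augmented_filtration M W) t (horizon P) Y \<and>
     (\<forall>s\<in>{t..horizon P}. \<exists>I.
        has_ito_integral M (augmented_filtration M W) W t s
          (\<lambda>\<rho> \<omega>. semigroup_A P (s - \<rho>) (op_G P 1)) I \<and>
        (AE \<omega> in M. Y s \<omega> = semigroup_A P (s - t) y
           + (LINT \<rho>:{t..s}|lborel. semigroup_A P (s - \<rho>) (op_B P (ctrl_vec uz \<rho> \<omega>)))
           + I \<omega>))"

text \<open>Mild solutions are unique up to modification; this is one of them.\<close>

definition state ::
    "lq_data \<Rightarrow> 'a measure \<Rightarrow> (real \<Rightarrow> 'a \<Rightarrow> real) \<Rightarrow> real \<Rightarrow> hilb \<Rightarrow> 'a control \<Rightarrow>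
       (real \<Rightarrow> 'a \<Rightarrow> hilb)" where
  "state P M W t y uz = (SOME Y. mild_solution P M W t y uz Y)"

definition gain ::
    "lq_data \<Rightarrow> 'a measure \<Rightarrow> real \<Rightarrow> 'a control \<Rightarrow> (real \<Rightarrow> 'a \<Rightarrow> hilb) \<Rightarrow> real" where
  "gain P M t uz Y = (LINT \<omega>|M.
     (LINT s:{t..horizon P}|lborel. exp (- rate P * (s - t)) *
        (alpha_vec P \<bullet> fst (Y s \<omega>) - beta_vec P \<bullet> ctrl_vec uz s \<omega>
          - gamma0 P * (fst uz s \<omega>)\<^sup>2 - gamma1 P * (snd uz s \<omega>)\<^sup>2))
     + exp (- rate P * (horizon P - t)) * (lambda_vec P \<bullet> fst (Y (horizon P) \<omega>)))"

definition objective ::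
    "lq_data \<Rightarrow> 'a measure \<Rightarrow> (real \<Rightarrow> 'a \<Rightarrow> real) \<Rightarrow> real \<Rightarrow> hilb \<Rightarrow> 'a control \<Rightarrow> real" where
  "objective P M W t y uz = gain P M t uz (state P M W t y uz)"

text \<open>The supremum is taken in the extended reals, so that finiteness is not built in.\<close>

definition value_fun ::
    "lq_data \<Rightarrow> 'a measure \<Rightarrow> (real \<Rightarrow> 'a \<Rightarrow> real) \<Rightarrow> real \<Rightarrow> hilb \<Rightarrow> ereal" where
  "value_fun P M W t y = (SUP uz\<in>admissible P M W. ereal (objective P M W t y uz))"

definition optimal_pair ::
    "lq_data \<Rightarrow> 'a measure \<Rightarrow> (real \<Rightarrow> 'a \<Rightarrow> real) \<Rightarrow> real \<Rightarrow> hilb \<Rightarrow> 'a control \<Rightarrow>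
       (real \<Rightarrow> 'a \<Rightarrow> hilb) \<Rightarrow> bool" where
  "optimal_pair P M W t y uz Y \<longleftrightarrow>
     uz \<in> admissible P M W \<and> mild_solution P M W t y uz Y \<and>
     (\<forall>uz'\<in>admissible P M W. objective P M W t y uz' \<le> gain P M t uz Y)"


subsection \<open>The candidate value function and control\<close>

definition a_fun :: "lq_data \<Rightarrow> real \<Rightarrow> hilb" where
  "a_fun P t =
     exp (- rate P * (horizon P - t)) *\<^sub>R semigroup_A_adj P (horizon P - t) (lambda_vec P, 0)
     + (LINT s:{t..horizon P}|lborel.
          exp (- rate P * (s - t)) *\<^sub>R semigroup_A_adj P (s - t) (alpha_vec P, 0))"

definition b_fun :: "lq_data \<Rightarrow> real \<Rightarrow> real" where
  "b_fun P t = (LINT s:{t..horizon P}|lborel. exp (- rate P * (s - t)) *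
     (((op_B_adj P (a_fun P s) - beta_vec P) \<bullet> vector [1, 1])\<^sup>2 / (4 * (gamma0 P + gamma1 P))))"

definition v_fun :: "lq_data \<Rightarrow> real \<Rightarrow> hilb \<Rightarrow> real" where
  "v_fun P t y = a_fun P t \<bullet> y + b_fun P t"

definition u_star :: "lq_data \<Rightarrow> real^2 \<Rightarrow> real" where
  "u_star P q = ((q - beta_vec P) \<bullet> vector [1, 1]) / (2 * (gamma0 P + gamma1 P))"

definition control_star :: "lq_data \<Rightarrow> 'a control" where
  "control_star P =
     ((\<lambda>s \<omega>. u_star P (op_B_adj P (a_fun P s))), (\<lambda>s \<omega>. u_star P (op_B_adj P (a_fun P s))))"

end

theory Submission
  imports Defs
begin

text \<open>The objective is linear in the state and the state equation is linear with additive noise, so the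
  gain of every pair of controls can be computed.

  Test the mild equation at time \<open>s\<close> against \<open>(w, 0)\<close> and take expectations. The Ito integral has mean
  zero, and by the duality of the two semigroups (\<open>semigroup_A_duality\<close>) the mean of \<open>\<langle>w, Y\<^sub>0(s)\<rangle>\<close> is
  \<open>\<langle>e\<^bsup>(s-t)A*\<^esup>(w, 0), y\<rangle>\<close> plus the integral over \<open>\<rho> \<in> [t, s]\<close> of \<open>\<langle>B* e\<^bsup>(s-\<rho>)A*\<^esup>(w, 0), E u(\<rho>)\<rangle>\<close>, where \<open>u\<close>
  is the pair of controls (\<open>state_mean\<close>). Insert this with \<open>w = \<alpha>\<close> into the discounted time integral and
  with \<open>w = \<lambda>\<close> into the terminal reward, and exchange the two time integrals over the triangle
  \<open>t \<le> \<rho> \<le> s \<le> T\<close>. The terms with \<open>y\<close> add up to \<open>\<langle>a(t), y\<rangle>\<close>, and the factor of \<open>E u(\<rho>)\<close> becomes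
  \<open>e\<^bsup>-r(\<rho>-t)\<^esup> B* a(\<rho>)\<close>. Hence the gain is \<open>\<langle>a(t), y\<rangle>\<close> plus the expected discounted integral of
  \<open>\<langle>B* a(\<rho>) - \<beta>, u(\<rho>)\<rangle>\<close> minus the quadratic costs (\<open>gain_eq\<close>). If both controls agree, completing the
  square bounds the integrand by the integrand of \<open>b(t)\<close>, with equality exactly at the candidate control
  (\<open>running_gain_complete_square\<close>); this is the inequality \<open>J \<le> v\<close> and the optimality at once.

  The analytic work lies in the objects themselves. The stated objective refers to some mild solution,
  so mild solutions have to exist for all controls, and the moments must be derived for an arbitrary one.
  For existence, the noise direction is an eigenvector of the drift matrix (\<open>semigroup_A_op_G\<close>), so the
  stochastic convolution is a scalar integral with a smooth kernel. Integration by parts gives a version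
  that is progressive in time, and elementary integrals converge to it in mean square with an explicit
  rate (\<open>has_ito_integral_C1\<close>). For the moments, the isometry for elementary integrals passes to the
  limit (\<open>ito_integral_moments\<close>). Measurability in time of Hilbert-space-valued functions is reduced to
  Fubini by \<open>measurable_L2_of\<close>.\<close>

section \<open>The exponential of the drift matrix\<close>

text \<open>The vectors \<open>(1, 0)\<close> and \<open>(1, 1)\<close> are eigenvectors of the matrix for the eigenvalues \<open>a\<close>
  and \<open>a + b\<close>, which gives its powers, and then its exponential, in closed form.\<close>

lemma matrix_power_upper_triangular:
  fixes a b :: real
  defines "X \<equiv> vector [vector [a, b], vector [0, a + b]] :: real^2^2"
  shows "((**) X ^^ k) (mat 1) = vector [vector [a ^ k, (a + b) ^ k - a ^ k], vector [0, (a + b) ^ k]]"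
proof (induction k)
  case 0
  show ?case by (simp add: vec_eq_iff forall_2 mat_def)
next
  case (Suc k)
  then show ?case
    by (simp add: vec_eq_iff forall_2 matrix_matrix_mult_def[of X] sum_2)
      (simp add: X_def algebra_simps)
qed

lemma transpose_matrix_power:
  fixes X :: "real^'n^'n"
  shows "((**) (transpose X) ^^ k) (mat 1) = transpose (((**) X ^^ k) (mat 1))"
proof (induction k)
  case (Suc k)
  have comm: "X ** ((**) X ^^ k) (mat 1) = ((**) X ^^ k) (mat 1) ** X" for k
    by (induction k) (simp_all add: matrix_mul_assoc)
  have "((**) (transpose X) ^^ Suc k) (mat 1) = transpose X ** transpose (((**) X ^^ k) (mat 1))"
    using Suc by simp
  also have "\<dots> = transpose (X ** ((**) X ^^ k) (mat 1))"
    by (simp only: matrix_transpose_mul comm)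
  finally show ?case by simp
qed simp

lemma sums_vec:
  fixes f :: "nat \<Rightarrow> 'b::real_normed_vector^'n"
  assumes "\<And>i. (\<lambda>k. f k $ i) sums (l $ i)"
  shows "f sums l"
  using assms unfolding sums_def by (intro vec_tendstoI) (simp add: sum_component)

lemma mat_exp_upper_triangular_sums:
  fixes a b :: real
  defines "X \<equiv> vector [vector [a, b], vector [0, a + b]] :: real^2^2"
  shows "(\<lambda>k. (1 / fact k) *\<^sub>R (((**) X ^^ k) (mat 1)))
    sums vector [vector [exp a, exp (a + b) - exp a], vector [0, exp (a + b)]]"
proof -
  have e: "(\<lambda>k. x ^ k / fact k) sums exp x" for x :: real
    using exp_converges[of x] by (simp add: divide_inverse mult.commute)
  have "\<forall>i j. (\<lambda>k. ((1 / fact k) *\<^sub>R (((**) X ^^ k) (mat 1))) $ i $ j)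
      sums (vector [vector [exp a, exp (a + b) - exp a], vector [0, exp (a + b)]] :: real^2^2) $ i $ j"
    unfolding X_def matrix_power_upper_triangular forall_2
    using e[of a] e[of "a + b"] sums_diff[OF e[of "a + b"] e[of a]]
    by (simp add: diff_divide_distrib)
  then show ?thesis by (intro sums_vec) auto
qed

lemma mat_exp_A0:
  "mat_exp (\<tau> *\<^sub>R A0_mat P) =
     vector [vector [exp (\<tau> * drift_a0 P), exp (\<tau> * (drift_a0 P + drift_a1 P)) - exp (\<tau> * drift_a0 P)],
             vector [0, exp (\<tau> * (drift_a0 P + drift_a1 P))]]"
proof -
  have "\<tau> *\<^sub>R A0_mat P = vector [vector [\<tau> * drift_a0 P, \<tau> * drift_a1 P],
      vector [0, \<tau> * drift_a0 P + \<tau> * drift_a1 P]]"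
    by (simp add: A0_mat_def vec_eq_iff forall_2 algebra_simps)
  then show ?thesis
    unfolding mat_exp_def using sums_unique[OF mat_exp_upper_triangular_sums[of "\<tau> * drift_a0 P" "\<tau> * drift_a1 P"]]
    by (simp add: algebra_simps)
qed

text \<open>The closed form provides the convergence of the exponential series; transposition is linear and
  continuous and therefore passes through the sum.\<close>

lemma mat_exp_transpose_A0:
  "mat_exp (\<tau> *\<^sub>R transpose (A0_mat P)) = transpose (mat_exp (\<tau> *\<^sub>R A0_mat P))"
proof -
  define X where "X = \<tau> *\<^sub>R A0_mat P"
  have X: "X = vector [vector [\<tau> * drift_a0 P, \<tau> * drift_a1 P],
      vector [0, \<tau> * drift_a0 P + \<tau> * drift_a1 P]]"
    by (simp add: X_def A0_mat_def vec_eq_iff forall_2 algebra_simps)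
  have X': "\<tau> *\<^sub>R transpose (A0_mat P) = transpose X"
    by (simp add: X_def transpose_def vec_eq_iff)
  have "(\<lambda>k. (1 / fact k) *\<^sub>R (((**) X ^^ k) (mat 1))) sums mat_exp X"
    unfolding mat_exp_def X
    by (rule summable_sums[OF sums_summable[OF mat_exp_upper_triangular_sums]])
  then have "(\<lambda>k. transpose ((1 / fact k) *\<^sub>R (((**) X ^^ k) (mat 1)))) sums transpose (mat_exp X)"
    by (intro bounded_linear.sums[of transpose] linear_conv_bounded_linear[THEN iffD1])
      (auto intro!: linearI simp: transpose_def vec_eq_iff)
  moreover have "transpose ((1 / fact k) *\<^sub>R (((**) X ^^ k) (mat 1)))
      = (1 / fact k) *\<^sub>R (((**) (transpose X) ^^ k) (mat 1))" for k
    unfolding transpose_matrix_power by (simp add: transpose_def vec_eq_iff)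
  ultimately have "(\<lambda>k. (1 / fact k) *\<^sub>R (((**) (transpose X) ^^ k) (mat 1)))
      sums transpose (mat_exp X)" by simp
  then show ?thesis
    unfolding X' mat_exp_def[of "transpose X"] X_def[symmetric] by (rule sums_unique[symmetric])
qed

lemma inner_mat_exp_A0:
  "w \<bullet> (mat_exp (\<tau> *\<^sub>R A0_mat P) *v x) = (mat_exp (\<tau> *\<^sub>R transpose (A0_mat P)) *v w) \<bullet> x"
proof -
  have "w \<bullet> (X *v x) = (transpose X *v w) \<bullet> x" for X :: "real^2^2"
    by (simp add: dot_lmul_matrix[symmetric])
  then show ?thesis by (simp only: mat_exp_transpose_A0)
qed

lemma continuous_on_mat_exp_transpose_A0:
  "continuous_on UNIV (\<lambda>\<tau>. mat_exp (\<tau> *\<^sub>R transpose (A0_mat P)) *v w)"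
proof -
  have "mat_exp (\<tau> *\<^sub>R transpose (A0_mat P)) *v w
      = vector [exp (\<tau> * drift_a0 P) * w $ 1,
          (exp (\<tau> * (drift_a0 P + drift_a1 P)) - exp (\<tau> * drift_a0 P)) * w $ 1
            + exp (\<tau> * (drift_a0 P + drift_a1 P)) * w $ 2]" for \<tau>
    unfolding mat_exp_transpose_A0 mat_exp_A0
    by (simp add: vec_eq_iff forall_2 transpose_def matrix_vector_mult_def sum_2)
  then have "mat_exp (\<tau> *\<^sub>R transpose (A0_mat P)) *v w
      = (\<chi> i. if i = 1 then exp (\<tau> * drift_a0 P) * w $ 1 else
          (exp (\<tau> * (drift_a0 P + drift_a1 P)) - exp (\<tau> * drift_a0 P)) * w $ 1
            + exp (\<tau> * (drift_a0 P + drift_a1 P)) * w $ 2)" for \<tau>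
    by (simp add: vec_eq_iff forall_2)
  moreover have "continuous_on UNIV (\<lambda>\<tau>. \<chi> i::2. if i = 1 then exp (\<tau> * drift_a0 P) * w $ 1 else
          (exp (\<tau> * (drift_a0 P + drift_a1 P)) - exp (\<tau> * drift_a0 P)) * w $ 1
            + exp (\<tau> * (drift_a0 P + drift_a1 P)) * w $ 2)"
  proof (intro continuous_on_vec_lambda, goal_cases)
    case (1 i)
    show ?case by (cases "i = 1") (auto intro!: continuous_intros)
  qed
  ultimately show ?thesis by simp
qed

lemma measurable_mat_exp_transpose_A0 [measurable]:
  "(\<lambda>\<tau>. mat_exp (\<tau> *\<^sub>R transpose (A0_mat P)) *v w) \<in> borel_measurable borel"
  by (rule borel_measurable_continuous_onI[OF continuous_on_mat_exp_transpose_A0])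

lemma bounded_mat_exp_transpose_A0:
  obtains K where "K \<ge> 0" "\<And>\<tau>. \<tau> \<in> {0..T} \<Longrightarrow> norm (mat_exp (\<tau> *\<^sub>R transpose (A0_mat P)) *v w) \<le> K"
proof -
  have "compact ((\<lambda>\<tau>. mat_exp (\<tau> *\<^sub>R transpose (A0_mat P)) *v w) ` {0..T})"
    by (intro compact_continuous_image continuous_on_subset[OF continuous_on_mat_exp_transpose_A0]) auto
  then have "bounded ((\<lambda>\<tau>. mat_exp (\<tau> *\<^sub>R transpose (A0_mat P)) *v w) ` {0..T})"
    by (rule compact_imp_bounded)
  then obtain K where "K > 0" "\<forall>x\<in>(\<lambda>\<tau>. mat_exp (\<tau> *\<^sub>R transpose (A0_mat P)) *v w) ` {0..T}. norm x \<le> K"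
    unfolding bounded_pos by blast
  then show ?thesis by (intro that[of K]) auto
qed

section \<open>Square integrable classes depending on a parameter\<close>

text \<open>In a second countable metric space every open set is a countable union of balls, and the
  preimage of a ball only involves the distance to its centre.\<close>

lemma borel_measurable_if_measurable_dist:
  fixes f :: "'c \<Rightarrow> 'h::{metric_space, second_countable_topology}"
  assumes "\<And>g. (\<lambda>x. dist g (f x)) \<in> borel_measurable N"
  shows "f \<in> borel_measurable N"
proof (rule borel_measurableI)
  fix U :: "'h set" assume "open U"
  define B where "B = {(x, e). ball x e \<subseteq> U}"
  have "U = \<Union>((\<lambda>(x, e). ball x e) ` B)"
    using \<open>open U\<close> by (fastforce simp: B_def open_contains_ball)
  moreover obtain B' where B': "B' \<subseteq> (\<lambda>(x, e). ball x e) ` B" "countable B'"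
      "\<Union>B' = \<Union>((\<lambda>(x, e). ball x e) ` B)"
    using Lindelof[of "(\<lambda>(x, e). ball x e) ` B"] by (auto simp: split_beta)
  ultimately have "U = \<Union>B'" by (simp only:)
  then have U: "f -` U \<inter> space N = (\<Union>b\<in>B'. f -` b \<inter> space N)" by auto
  have "f -` b \<inter> space N \<in> sets N" if "b \<in> B'" for b
  proof -
    have "b \<in> (\<lambda>(x, e). ball x e) ` B" using that B'(1) by blast
    then obtain g e where b: "b = ball g e" by auto
    have "f -` b \<inter> space N = {x \<in> space N. dist g (f x) < e}" by (auto simp: b)
    also have "\<dots> \<in> sets N" using assms[of g] by measurable
    finally show ?thesis .
  qed
  then show "f -` U \<inter> space N \<in> sets N"
    unfolding U using B'(2) by (intro sets.countable_UN') auto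
qed

text \<open>The distance of \<open>L2_of (\<phi> x)\<close> to a fixed class is the root of an integral over \<open>\<xi>\<close>, hence
  measurable in \<open>x\<close> by Fubini. The measurability in time of the orbits of the delay semigroups, which
  translate their function component, comes from here.\<close>

lemma measurable_L2_of:
  fixes \<phi> :: "'c \<Rightarrow> real \<Rightarrow> 'b::euclidean_space"
  assumes m: "(\<lambda>(x, \<xi>). \<phi> x \<xi>) \<in> borel_measurable (N \<Otimes>\<^sub>M borel)"
    and sq: "\<And>x. x \<in> space N \<Longrightarrow> square_integrable (\<phi> x)"
  shows "(\<lambda>x. L2_of (\<phi> x)) \<in> borel_measurable N"
proof (rule borel_measurable_if_measurable_dist)
  fix g :: "'b L2"
  have [measurable]: "rep_L2 g \<in> borel_measurable borel"
    by (rule square_integrable_measurable[OF square_integrable_rep])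
  have [measurable]: "(\<lambda>(x, \<xi>). \<phi> x \<xi>) \<in> borel_measurable (N \<Otimes>\<^sub>M lborel)" 
    using m by (simp cong: measurable_cong_sets)
  have "dist g (L2_of (\<phi> x)) = sqrt (LINT \<xi>|lborel. (norm (rep_L2 g \<xi> - \<phi> x \<xi>))\<^sup>2)"
    if "x \<in> space N" for x
  proof -
    have "dist g (L2_of (\<phi> x)) = norm (L2_of (rep_L2 g) - L2_of (\<phi> x))"
      by (simp add: dist_norm L2_of_rep)
    also have "\<dots> = norm (L2_of (\<lambda>\<xi>. rep_L2 g \<xi> - \<phi> x \<xi>))"
      by (simp add: L2_of_diff square_integrable_rep sq that)
    finally show ?thesis
      using norm_L2_of[OF square_integrable_diff[OF square_integrable_rep sq[OF that]], of g]
      by (simp add: real_sqrt_unique)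
  qed
  moreover have "(\<lambda>x. sqrt (LINT \<xi>|lborel. (norm (rep_L2 g \<xi> - \<phi> x \<xi>))\<^sup>2)) \<in> borel_measurable N"
    by measurable
  ultimately show "(\<lambda>x. dist g (L2_of (\<phi> x))) \<in> borel_measurable N"
    by (simp cong: measurable_cong)
qed

lemma L2_of_cong_AE:
  assumes "square_integrable f" "square_integrable g" "AE x in lborel. f x = g x"
  shows "L2_of f = L2_of g"
  using assms Quotient_rel_abs[OF Quotient_L2, of f g] by (simp add: L2_rel_def)

lemma square_integrable_indicator_scaleR:
  assumes "square_integrable f" and [measurable]: "A \<in> sets borel"
  shows "square_integrable (\<lambda>x. indicator A x *\<^sub>R f x)"
proof (rule square_integrable_bound[where h="\<lambda>x. (norm (f x))\<^sup>2"])
  have [measurable]: "f \<in> borel_measurable borel" using assms(1) by (rule square_integrable_measurable)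
  show "(\<lambda>x. indicator A x *\<^sub>R f x) \<in> borel_measurable lborel" by measurable
qed (use assms in \<open>auto simp: square_integrable_def indicator_def\<close>)

lemma square_integrable_translate:
  assumes "square_integrable f"
  shows "square_integrable (\<lambda>x. f (x - \<tau>))"
  using assms lborel_integrable_real_affine[of "\<lambda>x. (norm (f x))\<^sup>2" 1 "- \<tau>"]
  by (auto simp: square_integrable_def algebra_simps)

lemma AE_lborel_translate:
  fixes \<tau> :: real
  assumes "AE x in lborel. Q x"
  shows "AE x in lborel. Q (x - \<tau>)"
proof -
  obtain N where N: "{x. \<not> Q x} \<subseteq> N" "N \<in> sets borel" "emeasure lborel N = 0"
    using assms by (auto elim!: AE_E)
  have "AE x in lborel. x \<notin> N" using N by (intro AE_not_in) auto
  then have "AE x in lborel. (- \<tau>) + 1 * x \<notin> N"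
    using N(2) by (subst AE_borel_affine) (auto simp: pred_def)
  then show ?thesis by eventually_elim (use N(1) in auto)
qed

lemma norm_L2_of_mono:
  assumes "square_integrable f" "square_integrable g" "\<And>x. norm (f x) \<le> norm (g x)"
  shows "norm (L2_of f) \<le> norm (L2_of g)"
proof (rule power2_le_imp_le)
  show "(norm (L2_of f))\<^sup>2 \<le> (norm (L2_of g))\<^sup>2"
    unfolding norm_L2_of[OF assms(1)] norm_L2_of[OF assms(2)]
    using assms by (intro integral_mono square_integrable_integrable power_mono) auto
qed simp

lemma norm_L2_of_translate:
  assumes "square_integrable f"
  shows "norm (L2_of (\<lambda>x. f (x - \<tau>))) = norm (L2_of f)"
proof (rule power2_eq_imp_eq)
  show "(norm (L2_of (\<lambda>x. f (x - \<tau>))))\<^sup>2 = (norm (L2_of f))\<^sup>2"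
    unfolding norm_L2_of[OF assms] norm_L2_of[OF square_integrable_translate[OF assms]]
    using lborel_integral_real_affine[of 1 "\<lambda>x. (norm (f x))\<^sup>2" "- \<tau>"] by simp
qed auto

section \<open>The delay semigroup and its adjoint\<close>

definition exp_A0_adj :: "lq_data \<Rightarrow> real \<Rightarrow> real^2 \<Rightarrow> real^2" where
  "exp_A0_adj P \<tau> w = mat_exp (\<tau> *\<^sub>R transpose (A0_mat P)) *v w"

lemma measurable_exp_A0_adj [measurable]: "(\<lambda>\<tau>. exp_A0_adj P \<tau> w) \<in> borel_measurable borel"
  unfolding exp_A0_adj_def by measurable

text \<open>The function component of \<open>e\<^bsup>\<tau>A*\<^esup>(w, 0)\<close>, before the passage to classes.\<close>

definition adj_segment :: "lq_data \<Rightarrow> real \<Rightarrow> real^2 \<Rightarrow> real \<Rightarrow> real^2" where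
  "adj_segment P \<tau> w \<xi> = indicator ({- delay P..0} \<inter> {- \<tau>..0}) \<xi> *\<^sub>R exp_A0_adj P (\<xi> + \<tau>) w"

lemma exp_A0_adj_bounded_on_Icc:
  obtains K where "K \<ge> 0" "\<And>\<tau>. \<tau> \<in> {0..T} \<Longrightarrow> norm (exp_A0_adj P \<tau> w) \<le> K"
  using bounded_mat_exp_transpose_A0[of T P w] unfolding exp_A0_adj_def by blast

lemma integrable_indicator_Icc_const:
  "integrable lborel (\<lambda>\<xi>::real. indicator {a..b} \<xi> * (c::real))"
  by (intro integrable_mult_left integrable_real_indicator) (auto simp: emeasure_lborel_Icc_eq)

lemma adj_segment_norm_le:
  assumes "\<And>\<tau>. \<tau> \<in> {0..T} \<Longrightarrow> norm (exp_A0_adj P \<tau> w) \<le> K" "\<tau> \<le> T" 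
  shows "norm (adj_segment P \<tau> w \<xi>) \<le> norm (indicator {- delay P..0} \<xi> *\<^sub>R K)"
proof (cases "\<xi> \<in> {- delay P..0} \<inter> {- \<tau>..0}")
  case True
  then have "norm (exp_A0_adj P (\<xi> + \<tau>) w) \<le> K" using assms by (intro assms(1)) auto
  with True show ?thesis by (auto simp: adj_segment_def)
qed (auto simp: adj_segment_def)

lemma square_integrable_adj_segment: "square_integrable (adj_segment P \<tau> w)"
proof -
  obtain K where K: "K \<ge> 0" "\<And>s. s \<in> {0..\<tau>} \<Longrightarrow> norm (exp_A0_adj P s w) \<le> K"
    using exp_A0_adj_bounded_on_Icc[where T=\<tau>] by blast
  show ?thesis
  proof (rule square_integrable_bound)
    show "integrable lborel (\<lambda>\<xi>. indicator {- delay P..0} \<xi> * K\<^sup>2)"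
      by (rule integrable_indicator_Icc_const)
    show "adj_segment P \<tau> w \<in> borel_measurable lborel"
      unfolding adj_segment_def by measurable
    show "(norm (adj_segment P \<tau> w \<xi>))\<^sup>2 \<le> indicator {- delay P..0} \<xi> * K\<^sup>2" for \<xi>
    proof -
      have "norm (adj_segment P \<tau> w \<xi>) \<le> norm (indicator {- delay P..0} \<xi> *\<^sub>R K)"
        by (rule adj_segment_norm_le[OF K(2) order_refl])
      from power_mono[OF this norm_ge_zero, of 2] show ?thesis
        by (cases "\<xi> \<in> {- delay P..0}") (simp_all add: power_mult_distrib)
    qed
  qed
qed

lemma semigroup_A_adj_fst:
  "semigroup_A_adj P \<tau> (w, 0) = (exp_A0_adj P \<tau> w, L2_of (adj_segment P \<tau> w))"
proof -
  \<comment> \<open>The chosen representative of the class 0 vanishes only almost everywhere.\<close>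
  have z: "AE \<xi> in lborel. rep_L2 0 (\<xi> - (- \<tau>)) = (0 :: real^2)"
    using AE_lborel_translate[OF rep_L2_of[OF square_integrable_zero], of "-\<tau>"] by (simp add: L2_of_zero)
  have sq: "square_integrable (rep_L2 0 :: real \<Rightarrow> real^2)" by (rule square_integrable_rep)
  have "L2_of (\<lambda>\<xi>. adj_segment P \<tau> w \<xi> + indicator {- delay P..- \<tau>} \<xi> *\<^sub>R rep_L2 0 (\<xi> - (- \<tau>)))
      = L2_of (adj_segment P \<tau> w)"
    using z
    by (intro L2_of_cong_AE square_integrable_add square_integrable_indicator_scaleR
        square_integrable_adj_segment square_integrable_translate[OF sq]) auto
  then show ?thesis by (simp add: semigroup_A_adj_def adj_segment_def exp_A0_adj_def)
qed

lemma measurable_semigroup_A_adj [measurable]: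
  "(\<lambda>\<tau>. semigroup_A_adj P \<tau> (w, 0)) \<in> borel_measurable borel"
proof -
  have "(\<lambda>(\<tau>, \<xi>). adj_segment P \<tau> w \<xi>) \<in> borel_measurable (borel \<Otimes>\<^sub>M borel)"
  proof -
    have [measurable]: "Measurable.pred (borel \<Otimes>\<^sub>M borel) (\<lambda>(\<tau>::real, \<xi>::real). \<xi> \<in> {- delay P..0} \<inter> {- \<tau>..0})"
      by simp
    have "(\<lambda>(\<tau>, \<xi>). if \<xi> \<in> {- delay P..0} \<inter> {- \<tau>..0} then exp_A0_adj P (\<xi> + \<tau>) w else 0)
        \<in> borel_measurable (borel \<Otimes>\<^sub>M borel)"
      unfolding split_beta' by measurable
    then show ?thesis
      by (rule measurable_cong[THEN iffD1, rotated]) (auto simp: adj_segment_def)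
  qed
  then show ?thesis
    unfolding semigroup_A_adj_fst
    by (intro borel_measurable_Pair measurable_exp_A0_adj measurable_L2_of square_integrable_adj_segment)
qed

lemma semigroup_A_adj_bounded:
  obtains K where "K \<ge> 0" "\<And>\<tau>. \<tau> \<in> {0..T} \<Longrightarrow> norm (semigroup_A_adj P \<tau> (w, 0)) \<le> K"
proof -
  obtain K where K: "K \<ge> 0" "\<And>s. s \<in> {0..T} \<Longrightarrow> norm (exp_A0_adj P s w) \<le> K"
    using exp_A0_adj_bounded_on_Icc[where T=T] by blast
  have sq: "square_integrable (\<lambda>\<xi>. indicator {- delay P..0} \<xi> *\<^sub>R K)"
    by (rule square_integrable_indicator) (auto simp: emeasure_lborel_Icc_eq)
  define K' where "K' = norm (L2_of (\<lambda>\<xi>. indicator {- delay P..0} \<xi> *\<^sub>R K))"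
  show ?thesis
  proof (rule that[of "K + K'"])
    show "K + K' \<ge> 0" using K by (simp add: K'_def)
    fix \<tau> assume \<tau>: "\<tau> \<in> {0..T}"
    have "norm (semigroup_A_adj P \<tau> (w, 0)) \<le> norm (exp_A0_adj P \<tau> w) + norm (L2_of (adj_segment P \<tau> w))"
      unfolding semigroup_A_adj_fst by (rule norm_Pair_le)
    also have "norm (L2_of (adj_segment P \<tau> w)) \<le> K'"
    proof (rule power2_le_imp_le)
      show "(norm (L2_of (adj_segment P \<tau> w)))\<^sup>2 \<le> K'\<^sup>2"
        unfolding K'_def norm_L2_of[OF sq] norm_L2_of[OF square_integrable_adj_segment]
        using adj_segment_norm_le[OF K(2), of \<tau>] \<tau>
        by (intro integral_mono square_integrable_integrable power_mono sq square_integrable_adj_segment) auto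
    qed (simp add: K'_def)
    finally show "norm (semigroup_A_adj P \<tau> (w, 0)) \<le> K + K'" using K(2)[OF \<tau>] by simp
  qed
qed

lemma semigroup_A_segment_integrable:
  fixes y :: "(real^2) L2"
  shows "integrable lborel (\<lambda>s. indicator {- delay P..0} s *\<^sub>R
    (indicator {- \<tau>..0} s *\<^sub>R (mat_exp ((\<tau> + s) *\<^sub>R A0_mat P) *v rep_L2 y s)))"
    (is "integrable lborel ?f")
proof -
  have "integrable lborel (\<lambda>s. \<Sum>e\<in>Basis. (adj_segment P \<tau> e s \<bullet> rep_L2 y s) *\<^sub>R e)"
    by (intro Bochner_Integration.integrable_sum integrable_scaleR_left
        integrable_inner_square_integrable square_integrable_adj_segment square_integrable_rep)
  moreover have "?f s = (\<Sum>e\<in>Basis. (adj_segment P \<tau> e s \<bullet> rep_L2 y s) *\<^sub>R e)" for s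
  proof -
    have "adj_segment P \<tau> e s \<bullet> rep_L2 y s = ?f s \<bullet> e" for e
      by (simp add: adj_segment_def exp_A0_adj_def inner_mat_exp_A0[symmetric] inner_commute[of _ e]
          indicator_def add.commute)
    then show ?thesis by (simp only: euclidean_representation)
  qed
  ultimately show ?thesis by simp
qed

text \<open>Testing the first component against \<open>w\<close> moves the matrix exponential under the integral over to
  \<open>w\<close>. Linearity, measurability and bounds of the first component of \<open>semigroup_A\<close> are all read off
  from the adjoint through this identity.\<close>

lemma semigroup_A_duality:
  "w \<bullet> fst (semigroup_A P \<tau> y) = semigroup_A_adj P \<tau> (w, 0) \<bullet> y"
proof -
  let ?f = "\<lambda>s. indicator {- delay P..0} s *\<^sub>R
    (indicator {- \<tau>..0} s *\<^sub>R (mat_exp ((\<tau> + s) *\<^sub>R A0_mat P) *v rep_L2 (snd y) s))"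
  have "w \<bullet> (LINT s:{- delay P..0}|lborel.
        indicator {- \<tau>..0} s *\<^sub>R (mat_exp ((\<tau> + s) *\<^sub>R A0_mat P) *v rep_L2 (snd y) s))
      = (LINT s|lborel. w \<bullet> ?f s)"
    unfolding set_lebesgue_integral_def by (rule integral_inner_right[symmetric]) (rule semigroup_A_segment_integrable)
  also have "\<dots> = (LINT s|lborel. adj_segment P \<tau> w s \<bullet> rep_L2 (snd y) s)"
    by (intro Bochner_Integration.integral_cong refl)
      (simp add: adj_segment_def exp_A0_adj_def inner_mat_exp_A0[symmetric] add.commute indicator_def)
  also have "\<dots> = L2_of (adj_segment P \<tau> w) \<bullet> snd y"
    by (subst (2) L2_of_rep[symmetric]) (simp add: inner_L2_of square_integrable_adj_segment square_integrable_rep)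
  finally show ?thesis
    by (simp add: semigroup_A_def semigroup_A_adj_fst inner_prod_def inner_add_right inner_mat_exp_A0 exp_A0_adj_def)
qed

lemma fst_semigroup_A:
  "fst (semigroup_A P \<tau> y) = (\<Sum>e\<in>Basis. (semigroup_A_adj P \<tau> (e, 0) \<bullet> y) *\<^sub>R e)"
  by (simp add: semigroup_A_duality[symmetric] inner_commute[of _ "fst _"] euclidean_representation)

text \<open>Translations preserve null sets, so any representative of the class may be shifted.\<close>

lemma snd_semigroup_A_L2_of:
  assumes f: "square_integrable f"
  shows "snd (semigroup_A P \<tau> (x, L2_of f)) = L2_of (\<lambda>\<xi>. indicator {- delay P + \<tau>..0} \<xi> *\<^sub>R f (\<xi> - \<tau>))"
  unfolding semigroup_A_def snd_conv
  using AE_lborel_translate[OF rep_L2_of[OF f], of \<tau>]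
  by (intro L2_of_cong_AE square_integrable_indicator_scaleR square_integrable_translate f square_integrable_rep) auto

lemma linear_semigroup_A: "linear (semigroup_A P \<tau>)"
proof (rule linearI)
  note sq = square_integrable_indicator_scaleR[OF square_integrable_translate[OF square_integrable_rep]]
  fix y y' :: hilb and c :: real
  have "snd (semigroup_A P \<tau> (y + y')) =
      snd (semigroup_A P \<tau> (fst y + fst y', L2_of (\<lambda>\<xi>. rep_L2 (snd y) \<xi> + rep_L2 (snd y') \<xi>)))"
    by (simp add: L2_of_add square_integrable_rep L2_of_rep plus_prod_def)
  also have "\<dots> = L2_of (\<lambda>\<xi>. indicator {- delay P + \<tau>..0} \<xi> *\<^sub>R rep_L2 (snd y) (\<xi> - \<tau>)
      + indicator {- delay P + \<tau>..0} \<xi> *\<^sub>R rep_L2 (snd y') (\<xi> - \<tau>))"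
    by (subst snd_semigroup_A_L2_of)
      (simp_all add: square_integrable_add square_integrable_rep scaleR_add_right)
  also have "\<dots> = snd (semigroup_A P \<tau> y) + snd (semigroup_A P \<tau> y')"
    by (subst L2_of_add) (simp_all add: sq semigroup_A_def)
  finally show "semigroup_A P \<tau> (y + y') = semigroup_A P \<tau> y + semigroup_A P \<tau> y'"
    by (simp add: prod_eq_iff fst_semigroup_A inner_add_right scaleR_add_left sum.distrib)
  have "snd (semigroup_A P \<tau> (c *\<^sub>R y)) =
      snd (semigroup_A P \<tau> (c *\<^sub>R fst y, L2_of (\<lambda>\<xi>. c *\<^sub>R rep_L2 (snd y) \<xi>)))"
    by (simp add: L2_of_scaleR square_integrable_rep L2_of_rep scaleR_prod_def)
  also have "\<dots> = L2_of (\<lambda>\<xi>. c *\<^sub>R (indicator {- delay P + \<tau>..0} \<xi> *\<^sub>R rep_L2 (snd y) (\<xi> - \<tau>)))"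
    by (simp add: snd_semigroup_A_L2_of square_integrable_scaleR square_integrable_rep mult.commute)
  also have "\<dots> = c *\<^sub>R snd (semigroup_A P \<tau> y)"
    by (subst L2_of_scaleR) (simp_all add: sq semigroup_A_def)
  finally show "semigroup_A P \<tau> (c *\<^sub>R y) = c *\<^sub>R semigroup_A P \<tau> y"
    by (simp add: prod_eq_iff fst_semigroup_A scaleR_sum_right)
qed

lemma measurable_semigroup_A [measurable]:
  "(\<lambda>\<tau>. semigroup_A P \<tau> y) \<in> borel_measurable borel"
proof -
  have 1: "(\<lambda>\<tau>. fst (semigroup_A P \<tau> y)) \<in> borel_measurable borel"
    unfolding fst_semigroup_A by measurable
  have [measurable]: "rep_L2 (snd y) \<in> borel_measurable borel"
    by (rule square_integrable_measurable[OF square_integrable_rep])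
  have "(\<lambda>(\<tau>, \<xi>). if - delay P + \<tau> \<le> \<xi> \<and> \<xi> \<le> 0 then rep_L2 (snd y) (\<xi> - \<tau>) else 0)
      \<in> borel_measurable (borel \<Otimes>\<^sub>M borel)"
    unfolding split_beta' by measurable
  then have "(\<lambda>(\<tau>, \<xi>). indicator {- delay P + \<tau>..0} \<xi> *\<^sub>R rep_L2 (snd y) (\<xi> - \<tau>))
      \<in> borel_measurable (borel \<Otimes>\<^sub>M borel)"
    by (rule measurable_cong[THEN iffD1, rotated]) auto
  then have 2: "(\<lambda>\<tau>. snd (semigroup_A P \<tau> y)) \<in> borel_measurable borel"
    unfolding semigroup_A_def snd_conv
    by (intro measurable_L2_of square_integrable_indicator_scaleR[OF square_integrable_translate[OF square_integrable_rep]]) auto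
  show ?thesis using borel_measurable_Pair[OF 1 2] by simp
qed

lemma semigroup_A_bounded:
  obtains K where "K \<ge> 0" "\<And>\<tau> y. \<tau> \<in> {0..T} \<Longrightarrow> norm (semigroup_A P \<tau> y) \<le> K * norm y"
proof -
  have "\<exists>K. \<forall>e. K e \<ge> 0 \<and> (\<forall>\<tau>\<in>{0..T}. norm (semigroup_A_adj P \<tau> (e, 0)) \<le> K e)"
    by (intro choice allI) (metis semigroup_A_adj_bounded[where T=T])
  then obtain K where K: "\<And>e. K e \<ge> 0" "\<And>e \<tau>. \<tau> \<in> {0..T} \<Longrightarrow> norm (semigroup_A_adj P \<tau> (e, 0)) \<le> K e"
    by blast
  show ?thesis
  proof (rule that[of "(\<Sum>e\<in>(Basis :: (real^2) set). K e) + 1"])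
    show "(\<Sum>e\<in>(Basis :: (real^2) set). K e) + 1 \<ge> 0" using K by (simp add: sum_nonneg add_nonneg_pos)
    fix \<tau> y assume \<tau>: "\<tau> \<in> {0..T}"
    have "norm (fst (semigroup_A P \<tau> y)) \<le> (\<Sum>e\<in>(Basis :: (real^2) set). K e * norm y)"
      unfolding fst_semigroup_A
    proof (rule sum_norm_le)
      fix e :: "real^2" assume "e \<in> Basis"
      then have "norm ((semigroup_A_adj P \<tau> (e, 0) \<bullet> y) *\<^sub>R e) = \<bar>semigroup_A_adj P \<tau> (e, 0) \<bullet> y\<bar>" by simp
      also have "\<dots> \<le> norm (semigroup_A_adj P \<tau> (e, 0)) * norm y" by (rule Cauchy_Schwarz_ineq2)
      also have "\<dots> \<le> K e * norm y" using K \<tau> by (intro mult_right_mono) auto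
      finally show "norm ((semigroup_A_adj P \<tau> (e, 0) \<bullet> y) *\<^sub>R e) \<le> K e * norm y" .
    qed
    moreover have "norm (snd (semigroup_A P \<tau> y)) \<le> norm y"
    proof -
      have "norm (snd (semigroup_A P \<tau> y)) \<le> norm (L2_of (\<lambda>\<xi>. rep_L2 (snd y) (\<xi> - \<tau>)))"
        unfolding semigroup_A_def snd_conv
        by (intro norm_L2_of_mono square_integrable_indicator_scaleR square_integrable_translate square_integrable_rep)
          (auto simp: indicator_def)
      also have "\<dots> = norm (snd y)" by (simp add: norm_L2_of_translate square_integrable_rep L2_of_rep)
      also have "\<dots> \<le> norm y" by (simp add: norm_prod_def)
      finally show ?thesis .
    qed
    ultimately show "norm (semigroup_A P \<tau> y) \<le> ((\<Sum>e\<in>(Basis :: (real^2) set). K e) + 1) * norm y"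
      using norm_Pair_le[of "fst (semigroup_A P \<tau> y)" "snd (semigroup_A P \<tau> y)"]
      by (simp add: sum_distrib_right[symmetric] algebra_simps)
  qed
qed

text \<open>The first unit vector is an eigenvector of the drift matrix, so the noise stays on a line: the
  stochastic convolution in the Hilbert space is a fixed vector times a scalar Ito integral with an
  exponential kernel.\<close>

lemma semigroup_A_op_G:
  "semigroup_A P \<tau> (op_G P 1) = exp (\<tau> * drift_a0 P) *\<^sub>R op_G P 1"
proof -
  have "snd (semigroup_A P \<tau> (vector [vol P, 0], L2_of (\<lambda>x. 0))) = L2_of (\<lambda>x. 0)"
    by (simp add: snd_semigroup_A_L2_of square_integrable_zero)
  moreover have "fst (semigroup_A P \<tau> (vector [vol P, 0], 0)) = exp (\<tau> * drift_a0 P) *\<^sub>R vector [vol P, 0]"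
  proof (rule vector_eq_rdot[THEN iffD1], rule allI)
    fix w :: "real^2"
    have "fst (semigroup_A P \<tau> (vector [vol P, 0], 0)) \<bullet> w = exp_A0_adj P \<tau> w \<bullet> vector [vol P, 0]"
      by (subst inner_commute) (simp add: semigroup_A_duality semigroup_A_adj_fst inner_prod_def)
    also have "\<dots> = w \<bullet> (mat_exp (\<tau> *\<^sub>R A0_mat P) *v vector [vol P, 0])"
      by (simp add: exp_A0_adj_def inner_mat_exp_A0)
    also have "mat_exp (\<tau> *\<^sub>R A0_mat P) *v vector [vol P, 0] = exp (\<tau> * drift_a0 P) *\<^sub>R vector [vol P, 0]"
      unfolding mat_exp_A0 by (simp add: vec_eq_iff forall_2 matrix_vector_mult_def sum_2)
    finally show "fst (semigroup_A P \<tau> (vector [vol P, 0], 0)) \<bullet> w = (exp (\<tau> * drift_a0 P) *\<^sub>R vector [vol P, 0]) \<bullet> w"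
      by (simp add: inner_commute)
  qed
  ultimately show ?thesis
    by (simp add: op_G_def prod_eq_iff L2_of_zero)
qed

section \<open>Increments of Brownian motion\<close>

lemma filtration_space [simp]: "space (augmented_filtration M W t) = space M"
  by (simp add: augmented_filtration_def space_measure_of_conv)

lemma sets_filtration_mono:
  assumes "s \<le> t"
  shows "sets (augmented_filtration M W s) \<subseteq> sets (augmented_filtration M W t)"
proof -
  have "{W s -` A \<inter> space M | s A. s \<in> {0..t} \<and> A \<in> sets borel} \<union> null_sets M \<subseteq> Pow (space M)" for t
    by (auto dest: null_setsD2 sets.sets_into_space)
  then show ?thesis
    unfolding augmented_filtration_def using assms
    by (simp only: sets_measure_of) (intro sigma_sets_mono'; fastforce)
qed

lemma null_sets_filtration:
  "N \<in> null_sets M \<Longrightarrow> N \<in> sets (augmented_filtration M W t)"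
  unfolding augmented_filtration_def
  by (subst sets_measure_of) (auto dest: null_setsD2 sets.sets_into_space)

lemma measurable_filtration_mono:
  assumes "f \<in> measurable (augmented_filtration M W s) N" "s \<le> t"
  shows "f \<in> measurable (augmented_filtration M W t) N"
  using measurable_mono[OF order_refl refl sets_filtration_mono[OF assms(2)]] assms(1) by auto

locale brownian = prob_space M for M :: "'a measure" +
  fixes W :: "real \<Rightarrow> 'a \<Rightarrow> real"
  assumes bm: "brownian_motion M (augmented_filtration M W) W"
begin

abbreviation F where "F \<equiv> augmented_filtration M W"

lemma sets_F_subset: "0 \<le> t \<Longrightarrow> sets (F t) \<subseteq> sets M"
  using bm by (auto simp: brownian_motion_def subalgebra_def)

lemma measurable_F_M: "0 \<le> t \<Longrightarrow> f \<in> measurable (F t) N \<Longrightarrow> f \<in> measurable M N"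
  using measurable_mono[OF order_refl refl sets_F_subset] by auto

lemma W_adapted: "0 \<le> t \<Longrightarrow> W t \<in> borel_measurable (F t)"
  using bm by (auto simp: brownian_motion_def)

lemma W_measurable: "0 \<le> t \<Longrightarrow> W t \<in> borel_measurable M"
  using W_adapted measurable_F_M by blast

lemma increment_distributed:
  "0 \<le> s \<Longrightarrow> s < t \<Longrightarrow> distributed M lborel (\<lambda>\<omega>. W t \<omega> - W s \<omega>) (normal_density 0 (sqrt (t - s)))"
  using bm by (auto simp: brownian_motion_def)

lemma increment_indep:
  assumes "0 \<le> s" "s < t" "X \<in> borel_measurable (F s)"
  shows "indep_var borel X borel (\<lambda>\<omega>. W t \<omega> - W s \<omega>)"
proof -
  have I: "indep_set (sets (F s)) (sets (vimage_algebra (space M) (\<lambda>\<omega>. W t \<omega> - W s \<omega>) borel))"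
    using bm assms by (auto simp: brownian_motion_def)
  have X: "sigma_sets (space M) {X -` A \<inter> space M | A. A \<in> sets borel} \<subseteq> sets (F s)"
    using sets.sigma_sets_subset[of "{X -` A \<inter> space M | A. A \<in> sets borel}" "F s"]
      measurable_sets[OF assms(3)] by auto
  have Y: "sigma_sets (space M) {(\<lambda>\<omega>. W t \<omega> - W s \<omega>) -` A \<inter> space M | A. A \<in> sets borel}
      = sets (vimage_algebra (space M) (\<lambda>\<omega>. W t \<omega> - W s \<omega>) borel)"
    by (simp add: sets_vimage_algebra)
  have "indep_set (sigma_sets (space M) {X -` A \<inter> space M | A. A \<in> sets borel})
      (sigma_sets (space M) {(\<lambda>\<omega>. W t \<omega> - W s \<omega>) -` A \<inter> space M | A. A \<in> sets borel})"
    unfolding indep_set_def Y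
    by (rule indep_sets_mono_sets[OF I[unfolded indep_set_def]]) (use X in \<open>auto split: bool.split\<close>)
  moreover have "X \<in> borel_measurable M" "(\<lambda>\<omega>. W t \<omega> - W s \<omega>) \<in> borel_measurable M"
    using measurable_F_M[OF assms(1,3)] W_measurable[of s] W_measurable[of t] assms by auto
  ultimately show ?thesis unfolding indep_var_eq by blast
qed

lemma increment_moments:
  assumes "0 \<le> s" "s \<le> t"
  shows "integrable M (\<lambda>\<omega>. W t \<omega> - W s \<omega>)" "expectation (\<lambda>\<omega>. W t \<omega> - W s \<omega>) = 0"
    "integrable M (\<lambda>\<omega>. (W t \<omega> - W s \<omega>)\<^sup>2)" "expectation (\<lambda>\<omega>. (W t \<omega> - W s \<omega>)\<^sup>2) = t - s"
proof -
  have "integrable M (\<lambda>\<omega>. W t \<omega> - W s \<omega>) \<and> expectation (\<lambda>\<omega>. W t \<omega> - W s \<omega>) = 0 \<and>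
    integrable M (\<lambda>\<omega>. (W t \<omega> - W s \<omega>)\<^sup>2) \<and> expectation (\<lambda>\<omega>. (W t \<omega> - W s \<omega>)\<^sup>2) = t - s"
  proof (cases "s = t")
    case False
    then have st: "s < t" "sqrt (t - s) > 0" using assms by auto
    note D = increment_distributed[OF assms(1) st(1)]
    have 1: "integrable M (\<lambda>\<omega>. W t \<omega> - W s \<omega>)"
      using integrable_normal_moment_nz_1[OF st(2)] 
      by (subst distributed_integrable[OF D, of "\<lambda>x. x", symmetric]) auto
    have 2: "integrable M (\<lambda>\<omega>. (W t \<omega> - W s \<omega>)\<^sup>2)"
      using integrable_normal_moment[OF st(2), of 0 2]
      by (subst distributed_integrable[OF D, of "\<lambda>x. x\<^sup>2", symmetric]) auto
    have 3: "expectation (\<lambda>\<omega>. W t \<omega> - W s \<omega>) = 0"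
      by (rule normal_distributed_expectation[OF st(2) D])
    have "variance (\<lambda>\<omega>. W t \<omega> - W s \<omega>) = (sqrt (t - s))\<^sup>2"
      by (rule normal_distributed_variance[OF st(2) D])
    then have "expectation (\<lambda>\<omega>. (W t \<omega> - W s \<omega>)\<^sup>2) = t - s"
      using 3 assms by simp
    with 1 2 3 show ?thesis by blast
  qed simp
  then show "integrable M (\<lambda>\<omega>. W t \<omega> - W s \<omega>)" "expectation (\<lambda>\<omega>. W t \<omega> - W s \<omega>) = 0"
    "integrable M (\<lambda>\<omega>. (W t \<omega> - W s \<omega>)\<^sup>2)" "expectation (\<lambda>\<omega>. (W t \<omega> - W s \<omega>)\<^sup>2) = t - s"
    by auto
qed

lemma increment_mult:
  assumes "0 \<le> s" "s \<le> t" "X \<in> borel_measurable (F s)" "integrable M X"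
  shows "integrable M (\<lambda>\<omega>. X \<omega> * (W t \<omega> - W s \<omega>))" "expectation (\<lambda>\<omega>. X \<omega> * (W t \<omega> - W s \<omega>)) = 0"
    "integrable M (\<lambda>\<omega>. X \<omega> * (W t \<omega> - W s \<omega>)\<^sup>2)"
    "expectation (\<lambda>\<omega>. X \<omega> * (W t \<omega> - W s \<omega>)\<^sup>2) = expectation X * (t - s)"
proof -
  have "integrable M (\<lambda>\<omega>. X \<omega> * (W t \<omega> - W s \<omega>)) \<and> expectation (\<lambda>\<omega>. X \<omega> * (W t \<omega> - W s \<omega>)) = 0 \<and>
    integrable M (\<lambda>\<omega>. X \<omega> * (W t \<omega> - W s \<omega>)\<^sup>2) \<and>
    expectation (\<lambda>\<omega>. X \<omega> * (W t \<omega> - W s \<omega>)\<^sup>2) = expectation X * (t - s)"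
  proof (cases "s = t")
    case False
    then have st: "s < t" using assms by auto
    note I = increment_indep[OF assms(1) st assms(3)]
    have I2: "indep_var borel X borel (\<lambda>\<omega>. (W t \<omega> - W s \<omega>)\<^sup>2)"
      using indep_var_compose[OF I, of "\<lambda>x. x" borel "\<lambda>x. x\<^sup>2" borel] by (simp add: comp_def)
    note m = increment_moments[OF assms(1,2)]
    show ?thesis
      using indep_var_integrable[OF I assms(4) m(1)] indep_var_lebesgue_integral[OF I assms(4) m(1)]
        indep_var_integrable[OF I2 assms(4) m(3)] indep_var_lebesgue_integral[OF I2 assms(4) m(3)] m
      by simp
  qed simp
  then show "integrable M (\<lambda>\<omega>. X \<omega> * (W t \<omega> - W s \<omega>))" "expectation (\<lambda>\<omega>. X \<omega> * (W t \<omega> - W s \<omega>)) = 0"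
    "integrable M (\<lambda>\<omega>. X \<omega> * (W t \<omega> - W s \<omega>)\<^sup>2)"
    "expectation (\<lambda>\<omega>. X \<omega> * (W t \<omega> - W s \<omega>)\<^sup>2) = expectation X * (t - s)" by auto
qed

section \<open>First and second moments of Ito integrals\<close>

lemma elementary_partition_mono:
  assumes "elementary F t s n p c" "i \<le> j" "j \<le> n"
  shows "p i \<le> p j"
  using assms(2,3)
proof (induction j rule: dec_induct)
  case (step k)
  then have "p k \<le> p (Suc k)" using assms(1) by (auto simp: elementary_def)
  with step show ?case by simp
qed simp

lemma elementary_partition_bounds:
  assumes "elementary F t s n p c" "i \<le> n"
  shows "t \<le> p i" "p i \<le> s"
  using elementary_partition_mono[OF assms(1), of 0 i] elementary_partition_mono[OF assms(1), of i n] assms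
  by (auto simp: elementary_def)

lemma elementary_coefficient_measurable:
  assumes "elementary F t s n p c" "0 \<le> t" "i < n"
  shows "c i \<in> borel_measurable M"
  using assms elementary_partition_bounds[OF assms(1), of i]
  by (intro measurable_F_M[of "p i"]) (auto simp: elementary_def)

lemma elementary_coefficient_bounded:
  assumes "elementary F t s n p c" "i < n"
  obtains K where "\<And>\<omega>. \<omega> \<in> space M \<Longrightarrow> norm (c i \<omega>) \<le> K"
proof -
  have "\<exists>K. \<forall>\<omega>\<in>space M. norm (c i \<omega>) \<le> K"
    using assms by (auto simp: elementary_def)
  then show thesis using that by blast
qed

lemma elementary_butlast:
  "elementary F t s (Suc n) p c \<Longrightarrow> elementary F t (p n) n p c"
  by (auto simp: elementary_def)

lemma elementary_coefficient_square_integrable: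
  fixes c :: "nat \<Rightarrow> 'a \<Rightarrow> real"
  assumes "elementary F t s n p c" "0 \<le> t" "i < n"
  shows "integrable M (\<lambda>\<omega>. (c i \<omega>)\<^sup>2)"
proof -
  obtain K where K: "\<And>\<omega>. \<omega> \<in> space M \<Longrightarrow> norm (c i \<omega>) \<le> K"
    using elementary_coefficient_bounded[OF assms(1,3)] by blast
  have "norm ((c i \<omega>)\<^sup>2) \<le> K\<^sup>2" if "\<omega> \<in> space M" for \<omega>
    using power_mono[OF K[OF that] norm_ge_zero, of 2] by simp
  then show ?thesis
    by (intro integrable_const_bound[where B="K\<^sup>2"] AE_I2)
      (use elementary_coefficient_measurable[OF assms] in measurable)
qed

text \<open>By induction on the number of steps: the last increment is independent of everything that precedes
  it, so the cross term of the square has mean zero and the squares add up.\<close>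

lemma elementary_integral_moments:
  fixes c :: "nat \<Rightarrow> 'a \<Rightarrow> real"
  assumes "elementary F t s n p c" "0 \<le> t"
  shows "elementary_integral W n p c \<in> borel_measurable (F s) \<and>
    integrable M (elementary_integral W n p c) \<and>
    expectation (elementary_integral W n p c) = 0 \<and>
    integrable M (\<lambda>\<omega>. (elementary_integral W n p c \<omega>)\<^sup>2) \<and>
    expectation (\<lambda>\<omega>. (elementary_integral W n p c \<omega>)\<^sup>2) = (\<Sum>i<n. (p (Suc i) - p i) * expectation (\<lambda>\<omega>. (c i \<omega>)\<^sup>2))"
  using assms(1)
proof (induction n arbitrary: s)
  case 0
  have "elementary_integral W 0 p c = (\<lambda>\<omega>. 0)" by (simp add: elementary_integral_def fun_eq_iff)
  then show ?case by simp
next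
  case (Suc n)
  let ?S = "elementary_integral W n p c" and ?D = "\<lambda>\<omega>. W (p (Suc n)) \<omega> - W (p n) \<omega>"
  note IH = Suc.IH[OF elementary_butlast[OF Suc.prems]]
  have p: "0 \<le> p n" "p n \<le> p (Suc n)" "p (Suc n) = s"
    using elementary_partition_bounds[OF Suc.prems, of n] assms(2) Suc.prems
    by (auto simp: elementary_def)
  have c: "c n \<in> borel_measurable (F (p n))" using Suc.prems by (auto simp: elementary_def)
  have cM [measurable]: "c n \<in> borel_measurable M" by (rule measurable_F_M[OF p(1) c])
  obtain K where K: "\<And>\<omega>. \<omega> \<in> space M \<Longrightarrow> \<bar>c n \<omega>\<bar> \<le> K"
    using elementary_coefficient_bounded[OF Suc.prems, of n] by (metis lessI real_norm_def)
  have c2: "integrable M (\<lambda>\<omega>. (c n \<omega>)\<^sup>2)"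
    by (rule elementary_coefficient_square_integrable[OF Suc.prems assms(2)]) simp
  have c1: "integrable M (c n)"
    using K by (intro integrable_const_bound[where B=K] AE_I2) auto
  have Sc: "integrable M (\<lambda>\<omega>. ?S \<omega> * c n \<omega>)"
  proof (rule Bochner_Integration.integrable_bound)
    show "integrable M (\<lambda>\<omega>. K * ?S \<omega>)" using IH by simp
    show "AE \<omega> in M. norm (?S \<omega> * c n \<omega>) \<le> norm (K * ?S \<omega>)"
    proof (rule AE_I2)
      fix \<omega> assume "\<omega> \<in> space M"
      then have "\<bar>?S \<omega>\<bar> * \<bar>c n \<omega>\<bar> \<le> \<bar>?S \<omega>\<bar> * \<bar>K\<bar>" using K[of \<omega>] by (intro mult_left_mono) auto
      then show "norm (?S \<omega> * c n \<omega>) \<le> norm (K * ?S \<omega>)" by (simp add: abs_mult mult.commute)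
    qed
  qed (use IH in auto)
  note a = increment_mult[OF p(1,2) c c1]
  note b = increment_mult[OF p(1,2) borel_measurable_times[OF conjunct1[OF IH] c] Sc]
  note d = increment_mult[OF p(1,2) borel_measurable_power[OF c, of 2] c2]
  have eq: "elementary_integral W (Suc n) p c \<omega> = ?S \<omega> + c n \<omega> * ?D \<omega>" for \<omega>
    by (simp add: elementary_integral_def)
  have eq2: "(?S \<omega> + c n \<omega> * ?D \<omega>)\<^sup>2
      = (?S \<omega>)\<^sup>2 + 2 * (?S \<omega> * c n \<omega> * ?D \<omega>) + (c n \<omega>)\<^sup>2 * (?D \<omega>)\<^sup>2" for \<omega>
    by (simp add: power2_eq_square algebra_simps)
  have m: "elementary_integral W (Suc n) p c \<in> borel_measurable (F s)"
  proof -
    have [measurable]: "?S \<in> borel_measurable (F s)" "c n \<in> borel_measurable (F s)"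
        "W (p n) \<in> borel_measurable (F s)" "W (p (Suc n)) \<in> borel_measurable (F s)"
      using measurable_filtration_mono[OF conjunct1[OF IH], of s] measurable_filtration_mono[OF c, of s]
        measurable_filtration_mono[OF W_adapted[OF p(1)], of s] W_adapted[of s] p by auto
    show ?thesis unfolding eq[abs_def] by measurable
  qed
  show ?case
    using m IH a(1,2) b(1,2) d(3,4) unfolding eq[abs_def] eq2 by (simp add: mult.commute[of "p (Suc n) - p n"])
qed

lemma elementary_process_past_end:
  assumes "elementary F t s n p c" "s < \<rho>"
  shows "elementary_process n p c \<rho> \<omega> = 0"
  unfolding elementary_process_def
proof (rule sum.neutral, rule ballI)
  fix i assume "i \<in> {..<n}"
  then have "p (Suc i) \<le> s" using elementary_partition_bounds(2)[OF assms(1), of "Suc i"] by auto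
  with assms(2) show "indicator {p i<..p (Suc i)} \<rho> *\<^sub>R c i \<omega> = 0" by auto
qed

lemma elementary_process_power2:
  fixes c :: "nat \<Rightarrow> 'a \<Rightarrow> real"
  assumes "elementary F t s n p c"
  shows "(elementary_process n p c \<rho> \<omega>)\<^sup>2 = (\<Sum>i<n. indicator {p i<..p (Suc i)} \<rho> * (c i \<omega>)\<^sup>2)"
  using assms
proof (induction n arbitrary: s)
  case 0
  then show ?case by (simp add: elementary_process_def)
next
  case (Suc n)
  have cross: "elementary_process n p c \<rho> \<omega> * indicator {p n<..p (Suc n)} \<rho> = 0"
    using elementary_process_past_end[OF elementary_butlast[OF Suc.prems], of \<rho> \<omega>]
    by (cases "\<rho> > p n") auto
  have "elementary_process (Suc n) p c \<rho> \<omega>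
      = elementary_process n p c \<rho> \<omega> + indicator {p n<..p (Suc n)} \<rho> * c n \<omega>"
    by (simp add: elementary_process_def)
  then have "(elementary_process (Suc n) p c \<rho> \<omega>)\<^sup>2
      = (elementary_process n p c \<rho> \<omega>)\<^sup>2
        + 2 * (elementary_process n p c \<rho> \<omega> * indicator {p n<..p (Suc n)} \<rho>) * c n \<omega>
        + indicator {p n<..p (Suc n)} \<rho> * (c n \<omega>)\<^sup>2"
    by (simp add: power2_sum power_mult_distrib power2_eq_square[of "indicator _ _"] indicator_simps indicator_inter_arith[symmetric])
  then show ?case
    using Suc.IH[OF elementary_butlast[OF Suc.prems]] unfolding cross by simp
qed

lemma elementary_process_measurable:
  fixes c :: "nat \<Rightarrow> 'a \<Rightarrow> 'h::{banach, second_countable_topology}"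
  assumes "elementary F t s n p c" "0 \<le> t"
  shows "(\<lambda>(\<rho>, \<omega>). elementary_process n p c \<rho> \<omega>) \<in> borel_measurable (restrict_space lborel S \<Otimes>\<^sub>M M)"
proof -
  have "(\<lambda>x. indicator {p i<..p (Suc i)} (fst x) *\<^sub>R c i (snd x))
      \<in> borel_measurable (restrict_space lborel S \<Otimes>\<^sub>M M)" if "i < n" for i
  proof -
    have [measurable]: "c i \<in> borel_measurable M"
      by (rule elementary_coefficient_measurable[OF assms that])
    have "(\<lambda>\<rho>. indicator {p i<..p (Suc i)} \<rho> :: real) \<in> borel_measurable (restrict_space lborel S)"
      by (rule measurable_restrict_space1) simp
    note [measurable] = measurable_compose[OF measurable_fst this, of M]
    show ?thesis by measurable
  qed
  then show ?thesis
    unfolding elementary_process_def split_beta' by (intro borel_measurable_sum) auto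
qed

lemma elementary_isometry:
  fixes c :: "nat \<Rightarrow> 'a \<Rightarrow> real"
  assumes "elementary F t s n p c" "0 \<le> t"
  shows "(\<integral>\<^sup>+\<omega>. ennreal ((elementary_integral W n p c \<omega>)\<^sup>2) \<partial>M)
    = (\<integral>\<^sup>+(\<rho>, \<omega>). ennreal ((elementary_process n p c \<rho> \<omega>)\<^sup>2) \<partial>(restrict_space lborel {t..s} \<Otimes>\<^sub>M M))"
proof -
  note m = elementary_integral_moments[OF assms]
  note q = elementary_coefficient_square_integrable[OF assms]
  let ?L = "restrict_space lborel {t..s}"
  have cm: "c i \<in> borel_measurable M" if "i < n" for i
    by (rule elementary_coefficient_measurable[OF assms that])
  have im: "(\<lambda>\<rho>. ennreal (indicator {p i<..p (Suc i)} \<rho>)) \<in> borel_measurable ?L" for i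
    by (rule measurable_restrict_space1) simp
  have "(\<integral>\<^sup>+(\<rho>, \<omega>). ennreal ((elementary_process n p c \<rho> \<omega>)\<^sup>2) \<partial>(?L \<Otimes>\<^sub>M M))
     = (\<integral>\<^sup>+x. (\<Sum>i<n. ennreal (indicator {p i<..p (Suc i)} (fst x)) * ennreal ((c i (snd x))\<^sup>2)) \<partial>(?L \<Otimes>\<^sub>M M))"
    unfolding split_beta' elementary_process_power2[OF assms(1)]
    by (subst sum_ennreal[symmetric]) (simp_all add: ennreal_mult)
  also have "\<dots> = (\<Sum>i<n. \<integral>\<^sup>+x. ennreal (indicator {p i<..p (Suc i)} (fst x)) * ennreal ((c i (snd x))\<^sup>2) \<partial>(?L \<Otimes>\<^sub>M M))"
  proof (rule nn_integral_sum)
    fix i assume "i \<in> {..<n}"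
    then have [measurable]: "c i \<in> borel_measurable M" using cm by auto
    note [measurable] = measurable_compose[OF measurable_fst im[of i], of M]
    show "(\<lambda>x. ennreal (indicator {p i<..p (Suc i)} (fst x)) * ennreal ((c i (snd x))\<^sup>2))
        \<in> borel_measurable (?L \<Otimes>\<^sub>M M)" by measurable
  qed
  also have "\<dots> = (\<Sum>i<n. ennreal ((p (Suc i) - p i) * expectation (\<lambda>\<omega>. (c i \<omega>)\<^sup>2)))"
  proof (rule sum.cong[OF refl])
    fix i assume i: "i \<in> {..<n}"
    have [measurable]: "c i \<in> borel_measurable M" using cm i by auto
    note [measurable] = measurable_compose[OF measurable_fst im[of i], of M] im[of i]
    have pi: "t \<le> p i" "p i \<le> p (Suc i)" "p (Suc i) \<le> s"
      using elementary_partition_bounds[OF assms(1)] elementary_partition_mono[OF assms(1)] i by auto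
    have "(\<integral>\<^sup>+x. ennreal (indicator {p i<..p (Suc i)} (fst x)) * ennreal ((c i (snd x))\<^sup>2) \<partial>(?L \<Otimes>\<^sub>M M))
      = (\<integral>\<^sup>+\<rho>. \<integral>\<^sup>+\<omega>. ennreal (indicator {p i<..p (Suc i)} \<rho>) * ennreal ((c i \<omega>)\<^sup>2) \<partial>M \<partial>?L)"
      by (subst nn_integral_fst[symmetric]) simp_all
    also have "\<dots> = (\<integral>\<^sup>+\<rho>. ennreal (indicator {p i<..p (Suc i)} \<rho>) \<partial>?L) * (\<integral>\<^sup>+\<omega>. ennreal ((c i \<omega>)\<^sup>2) \<partial>M)"
      by (simp add: nn_integral_cmult nn_integral_multc[OF im])
    also have "(\<integral>\<^sup>+\<omega>. ennreal ((c i \<omega>)\<^sup>2) \<partial>M) = ennreal (expectation (\<lambda>\<omega>. (c i \<omega>)\<^sup>2))"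
      by (rule nn_integral_eq_integral) (use q i in auto)
    also have "(\<integral>\<^sup>+\<rho>. ennreal (indicator {p i<..p (Suc i)} \<rho>) \<partial>?L)
        = (\<integral>\<^sup>+\<rho>. indicator {p i<..p (Suc i)} \<rho> \<partial>lborel)"
      unfolding nn_integral_restrict_space[of "{t..s}" lborel, simplified]
      using pi by (intro nn_integral_cong) (auto simp: indicator_def)
    also have "\<dots> = ennreal (p (Suc i) - p i)" using pi by simp
    finally show "(\<integral>\<^sup>+x. ennreal (indicator {p i<..p (Suc i)} (fst x)) * ennreal ((c i (snd x))\<^sup>2) \<partial>(?L \<Otimes>\<^sub>M M))
        = ennreal ((p (Suc i) - p i) * expectation (\<lambda>\<omega>. (c i \<omega>)\<^sup>2))"
      using pi by (simp add: ennreal_mult)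
  qed
  also have "\<dots> = ennreal (\<Sum>i<n. (p (Suc i) - p i) * expectation (\<lambda>\<omega>. (c i \<omega>)\<^sup>2))"
    using elementary_partition_mono[OF assms(1)] by (intro sum_ennreal) auto
  also have "\<dots> = (\<integral>\<^sup>+\<omega>. ennreal ((elementary_integral W n p c \<omega>)\<^sup>2) \<partial>M)"
    using m by (subst nn_integral_eq_integral) auto
  finally show ?thesis by simp
qed

lemma progressive_measurable_product:
  assumes "progressive F t s X" "0 \<le> t" "t \<le> s"
  shows "(\<lambda>(\<rho>, \<omega>). X \<rho> \<omega>) \<in> borel_measurable (restrict_space lborel {t..s} \<Otimes>\<^sub>M M)"
proof -
  have 1: "(\<lambda>\<omega>. \<omega>) \<in> measurable M (F s)"
    using assms by (intro measurable_F_M[of s]) auto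
  have 2: "fst \<in> measurable (restrict_space lborel {t..s} \<Otimes>\<^sub>M M) (restrict_space borel {t..s})"
    using measurable_fst measurable_cong_sets[OF refl sets_restrict_space_cong[OF sets_lborel]] by blast
  have 3: "(\<lambda>x. (fst x, snd x)) \<in> measurable (restrict_space lborel {t..s} \<Otimes>\<^sub>M M) (restrict_space borel {t..s} \<Otimes>\<^sub>M F s)"
    by (rule measurable_Pair[OF 2 measurable_compose[OF measurable_snd 1]])
  have "(\<lambda>(\<rho>, \<omega>). X \<rho> \<omega>) \<in> borel_measurable (restrict_space borel {t..s} \<Otimes>\<^sub>M F s)"
    by (rule bspec[OF assms(1)[unfolded progressive_def]]) (use assms(3) in simp)
  from measurable_compose[OF 3 this] show ?thesis by (simp only: prod.collapse)
qed

lemma power2_le_two_add: "(x + y)\<^sup>2 \<le> 2 * x\<^sup>2 + 2 * y\<^sup>2" for x y :: real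
  using norm_add_squared_le[of x y] by simp

text \<open>The approximating elementary integrals have mean zero, and their second moments are controlled by
  the isometry; both properties pass to the mean square limit. Splitting a square by
  \<open>(x + y)\<^sup>2 \<le> 2 x\<^sup>2 + 2 y\<^sup>2\<close> once for the integral and once for the integrand costs the factor 4. The
  bound makes the noise integrable jointly in time and chance, so that its mean can be taken under a
  time integral.\<close>

lemma ito_integral_moments:
  fixes I :: "'a \<Rightarrow> 'h::{banach, second_countable_topology}" and l :: "'h \<Rightarrow> real"
  assumes I: "has_ito_integral M F W t s \<Phi> I" and ts: "0 \<le> t" "t \<le> s" and l: "bounded_linear l" and A0: "0 \<le> A"
    and A: "(\<integral>\<^sup>+(\<rho>, \<omega>). ennreal ((l (\<Phi> \<rho> \<omega>))\<^sup>2) \<partial>(restrict_space lborel {t..s} \<Otimes>\<^sub>M M)) \<le> ennreal A"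
  shows "integrable M (\<lambda>\<omega>. l (I \<omega>))" "expectation (\<lambda>\<omega>. l (I \<omega>)) = 0"
    "(\<integral>\<^sup>+\<omega>. ennreal ((l (I \<omega>))\<^sup>2) \<partial>M) \<le> ennreal (4 * A)"
proof -
  let ?Q = "restrict_space lborel {t..s} \<Otimes>\<^sub>M M"
  obtain n p c where e0: "\<forall>k. elementary F t s (n k) (p k) (c k)"
    and y: "(\<lambda>k. \<integral>\<^sup>+(\<rho>, \<omega>). ennreal ((norm (elementary_process (n k) (p k) (c k) \<rho> \<omega> - \<Phi> \<rho> \<omega>))\<^sup>2) \<partial>?Q) \<longlonglongrightarrow> 0"
    and x: "(\<lambda>k. \<integral>\<^sup>+\<omega>. ennreal ((norm (elementary_integral W (n k) (p k) (c k) \<omega> - I \<omega>))\<^sup>2) \<partial>M) \<longlonglongrightarrow> 0"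
    using I unfolding has_ito_integral_def by (elim conjE exE) (rule that; assumption)
  note e = e0[rule_format]
  have Im [measurable]: "I \<in> borel_measurable M" and Pm [measurable]: "(\<lambda>(\<rho>, \<omega>). \<Phi> \<rho> \<omega>) \<in> borel_measurable ?Q"
    using I progressive_measurable_product[OF _ ts, of \<Phi>] unfolding has_ito_integral_def by blast+
  interpret l: bounded_linear l by fact
  note [measurable] = borel_measurable_continuous_onI[OF linear_continuous_on[OF l]]
  obtain B where B: "\<And>v. \<bar>l v\<bar> \<le> norm v * B" "B > 0" using l.pos_bounded by auto
  have lB: "(l v)\<^sup>2 \<le> B\<^sup>2 * (norm v)\<^sup>2" for v
    using power_mono[OF B(1)[of v], of 2] by (simp add: power_mult_distrib mult.commute)
  define c' where "c' k i \<omega> = l (c k i \<omega>)" for k i \<omega>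
  have e': "elementary F t s (n k) (p k) (c' k)" for k
    unfolding elementary_def
  proof (intro conjI allI impI)
    fix i assume i: "i < n k"
    then have [measurable]: "c k i \<in> borel_measurable (F (p k i))" using e[of k] by (auto simp: elementary_def)
    show "c' k i \<in> borel_measurable (F (p k i))" unfolding c'_def by measurable
    obtain K where K: "\<And>\<omega>. \<omega> \<in> space M \<Longrightarrow> norm (c k i \<omega>) \<le> K"
      using elementary_coefficient_bounded[OF e i] by blast
    have "norm (c' k i \<omega>) \<le> K * B" if "\<omega> \<in> space M" for \<omega>
      using order_trans[OF B(1) mult_right_mono[OF K[OF that], of B]] B(2) by (simp add: c'_def)
    then show "\<exists>K. \<forall>\<omega>\<in>space (F (p k i)). norm (c' k i \<omega>) \<le> K" by auto
  qed (use e[of k] in \<open>auto simp: elementary_def\<close>)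
  define X where "X k = elementary_integral W (n k) (p k) (c' k)" for k
  define Y where "Y k = elementary_process (n k) (p k) (c' k)" for k
  have X: "X k \<omega> = l (elementary_integral W (n k) (p k) (c k) \<omega>)" for k \<omega>
    by (simp add: X_def c'_def elementary_integral_def l.sum l.scaleR)
  have Y: "Y k \<rho> \<omega> = l (elementary_process (n k) (p k) (c k) \<rho> \<omega>)" for k \<rho> \<omega>
    by (simp add: Y_def c'_def elementary_process_def l.sum l.scaleR)
  note mX = elementary_integral_moments[OF e' ts(1), folded X_def]
  have Xm [measurable]: "X k \<in> borel_measurable M" for k
    using mX[of k] ts by (intro measurable_F_M[of s]) auto
  have Ym [measurable]: "(\<lambda>(\<rho>, \<omega>). Y k \<rho> \<omega>) \<in> borel_measurable ?Q" for k
    unfolding Y_def by (rule elementary_process_measurable[OF e' ts(1)])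
  have cm: "elementary_integral W (n k) (p k) (c k) \<in> borel_measurable M" for k
  proof -
    have "(\<lambda>\<omega>. (W (p k (Suc i)) \<omega> - W (p k i) \<omega>) *\<^sub>R c k i \<omega>) \<in> borel_measurable M" if "i < n k" for i
    proof -
      have "0 \<le> p k i" "0 \<le> p k (Suc i)"
        using that ts elementary_partition_bounds(1)[OF e[of k], of i] elementary_partition_bounds(1)[OF e[of k], of "Suc i"]
        by auto
      note [measurable] = this[THEN W_measurable] elementary_coefficient_measurable[OF e ts(1) that]
      show ?thesis by measurable
    qed
    then show ?thesis unfolding elementary_integral_def[abs_def] by (intro borel_measurable_sum) auto
  qed
  define d where "d k = (\<integral>\<^sup>+\<omega>. ennreal ((X k \<omega> - l (I \<omega>))\<^sup>2) \<partial>M)" for k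
  define g where "g k = (\<integral>\<^sup>+(\<rho>, \<omega>). ennreal ((Y k \<rho> \<omega> - l (\<Phi> \<rho> \<omega>))\<^sup>2) \<partial>?Q)" for k
  have d0: "d \<longlonglongrightarrow> 0"
  proof (rule tendsto_sandwich[OF _ _ tendsto_const])
    show "(\<lambda>k. ennreal (B\<^sup>2) * (\<integral>\<^sup>+\<omega>. ennreal ((norm (elementary_integral W (n k) (p k) (c k) \<omega> - I \<omega>))\<^sup>2) \<partial>M)) \<longlonglongrightarrow> 0"
      using ennreal_tendsto_cmult[OF _ x, of "ennreal (B\<^sup>2)"] by simp
    have "d k \<le> ennreal (B\<^sup>2) * (\<integral>\<^sup>+\<omega>. ennreal ((norm (elementary_integral W (n k) (p k) (c k) \<omega> - I \<omega>))\<^sup>2) \<partial>M)" for k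
    proof -
      note [measurable] = cm[of k]
      have "d k \<le> (\<integral>\<^sup>+\<omega>. ennreal (B\<^sup>2) * ennreal ((norm (elementary_integral W (n k) (p k) (c k) \<omega> - I \<omega>))\<^sup>2) \<partial>M)"
        unfolding d_def X l.diff[symmetric] by (intro nn_integral_mono) (simp add: lB ennreal_mult[symmetric] ennreal_leI)
      also have "\<dots> = ennreal (B\<^sup>2) * (\<integral>\<^sup>+\<omega>. ennreal ((norm (elementary_integral W (n k) (p k) (c k) \<omega> - I \<omega>))\<^sup>2) \<partial>M)"
        by (rule nn_integral_cmult) measurable
      finally show ?thesis .
    qed
    then show "\<forall>\<^sub>F k in sequentially. d k \<le> ennreal (B\<^sup>2) * (\<integral>\<^sup>+\<omega>. ennreal ((norm (elementary_integral W (n k) (p k) (c k) \<omega> - I \<omega>))\<^sup>2) \<partial>M)"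
      by simp
  qed simp
  have g0: "g \<longlonglongrightarrow> 0"
  proof (rule tendsto_sandwich[OF _ _ tendsto_const])
    show "(\<lambda>k. ennreal (B\<^sup>2) * (\<integral>\<^sup>+(\<rho>, \<omega>). ennreal ((norm (elementary_process (n k) (p k) (c k) \<rho> \<omega> - \<Phi> \<rho> \<omega>))\<^sup>2) \<partial>?Q)) \<longlonglongrightarrow> 0"
      using ennreal_tendsto_cmult[OF _ y, of "ennreal (B\<^sup>2)"] by simp
    have "g k \<le> ennreal (B\<^sup>2) * (\<integral>\<^sup>+(\<rho>, \<omega>). ennreal ((norm (elementary_process (n k) (p k) (c k) \<rho> \<omega> - \<Phi> \<rho> \<omega>))\<^sup>2) \<partial>?Q)" for k
    proof -
      note [measurable] = elementary_process_measurable[OF e[of k] ts(1), of "{t..s}"]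
      have "g k \<le> (\<integral>\<^sup>+x. ennreal (B\<^sup>2) * ennreal ((norm (elementary_process (n k) (p k) (c k) (fst x) (snd x) - \<Phi> (fst x) (snd x)))\<^sup>2) \<partial>?Q)"
        unfolding g_def Y l.diff[symmetric] split_beta'
        by (intro nn_integral_mono) (simp add: lB ennreal_mult[symmetric] ennreal_leI)
      also have "\<dots> = ennreal (B\<^sup>2) * (\<integral>\<^sup>+(\<rho>, \<omega>). ennreal ((norm (elementary_process (n k) (p k) (c k) \<rho> \<omega> - \<Phi> \<rho> \<omega>))\<^sup>2) \<partial>?Q)"
        unfolding split_beta' by (rule nn_integral_cmult) measurable
      finally show ?thesis .
    qed
    then show "\<forall>\<^sub>F k in sequentially. g k \<le> ennreal (B\<^sup>2) * (\<integral>\<^sup>+(\<rho>, \<omega>). ennreal ((norm (elementary_process (n k) (p k) (c k) \<rho> \<omega> - \<Phi> \<rho> \<omega>))\<^sup>2) \<partial>?Q)"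
      by simp
  qed simp
  have 1: "(\<integral>\<^sup>+\<omega>. ennreal ((l (I \<omega>))\<^sup>2) \<partial>M) \<le> 2 * (\<integral>\<^sup>+\<omega>. ennreal ((X k \<omega>)\<^sup>2) \<partial>M) + 2 * d k" for k
  proof -
    have "(l (I \<omega>))\<^sup>2 \<le> 2 * (X k \<omega>)\<^sup>2 + 2 * (X k \<omega> - l (I \<omega>))\<^sup>2" for \<omega>
      using power2_le_two_add[of "X k \<omega>" "l (I \<omega>) - X k \<omega>"] by (simp add: power2_commute)
    then have "(\<integral>\<^sup>+\<omega>. ennreal ((l (I \<omega>))\<^sup>2) \<partial>M)
        \<le> (\<integral>\<^sup>+\<omega>. 2 * ennreal ((X k \<omega>)\<^sup>2) + 2 * ennreal ((X k \<omega> - l (I \<omega>))\<^sup>2) \<partial>M)"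
      by (intro nn_integral_mono) (simp add: ennreal_plus[symmetric] ennreal_mult[symmetric] ennreal_numeral[symmetric] ennreal_leI del: ennreal_plus ennreal_numeral)
    also have "\<dots> = 2 * (\<integral>\<^sup>+\<omega>. ennreal ((X k \<omega>)\<^sup>2) \<partial>M) + 2 * d k"
      unfolding d_def by (subst nn_integral_add) (simp_all add: nn_integral_cmult)
    finally show ?thesis .
  qed
  have 2: "(\<integral>\<^sup>+\<omega>. ennreal ((X k \<omega>)\<^sup>2) \<partial>M) \<le> 2 * ennreal A + 2 * g k" for k
  proof -
    have "(Y k \<rho> \<omega>)\<^sup>2 \<le> 2 * (l (\<Phi> \<rho> \<omega>))\<^sup>2 + 2 * (Y k \<rho> \<omega> - l (\<Phi> \<rho> \<omega>))\<^sup>2" for \<rho> \<omega>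
      using power2_le_two_add[of "l (\<Phi> \<rho> \<omega>)" "Y k \<rho> \<omega> - l (\<Phi> \<rho> \<omega>)"] by simp
    then have "(\<integral>\<^sup>+(\<rho>, \<omega>). ennreal ((Y k \<rho> \<omega>)\<^sup>2) \<partial>?Q)
        \<le> (\<integral>\<^sup>+x. 2 * ennreal ((l (\<Phi> (fst x) (snd x)))\<^sup>2) + 2 * ennreal ((Y k (fst x) (snd x) - l (\<Phi> (fst x) (snd x)))\<^sup>2) \<partial>?Q)"
      unfolding split_beta'
      by (intro nn_integral_mono) (simp add: ennreal_plus[symmetric] ennreal_mult[symmetric] ennreal_numeral[symmetric] ennreal_leI del: ennreal_plus ennreal_numeral)
    also have "\<dots> = 2 * (\<integral>\<^sup>+(\<rho>, \<omega>). ennreal ((l (\<Phi> \<rho> \<omega>))\<^sup>2) \<partial>?Q) + 2 * g k"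
      unfolding g_def split_beta' by (subst nn_integral_add) (simp_all add: nn_integral_cmult)
    also have "\<dots> \<le> 2 * ennreal A + 2 * g k" using A by (intro add_right_mono mult_left_mono) auto
    finally show ?thesis unfolding X_def elementary_isometry[OF e' ts(1)] Y_def .
  qed
  have 3: "(\<integral>\<^sup>+\<omega>. ennreal ((l (I \<omega>))\<^sup>2) \<partial>M) \<le> 2 * (2 * ennreal A + 2 * g k) + 2 * d k" for k
    by (rule order_trans[OF 1[of k]]) (intro add_right_mono mult_left_mono 2, simp)
  have "(\<lambda>k. 2 * (2 * ennreal A + 2 * g k) + 2 * d k) \<longlonglongrightarrow> 2 * (2 * ennreal A + 2 * 0) + 2 * 0"
    by (intro tendsto_add ennreal_tendsto_cmult tendsto_const g0 d0) simp_all
  then have "(\<integral>\<^sup>+\<omega>. ennreal ((l (I \<omega>))\<^sup>2) \<partial>M) \<le> 2 * (2 * ennreal A + 2 * 0) + 2 * 0"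
    by (rule LIMSEQ_le_const) (use 3 in auto)
  also have "\<dots> = ennreal (4 * A)"
    using A0 by (simp add: ennreal_mult flip: mult.assoc)
  finally show bound: "(\<integral>\<^sup>+\<omega>. ennreal ((l (I \<omega>))\<^sup>2) \<partial>M) \<le> ennreal (4 * A)" .
  have lI2: "integrable M (\<lambda>\<omega>. (l (I \<omega>))\<^sup>2)"
  proof (rule integrableI_bounded)
    show "(\<integral>\<^sup>+\<omega>. ennreal (norm ((l (I \<omega>))\<^sup>2)) \<partial>M) < \<infinity>"
      using le_less_trans[OF bound] by simp
  qed measurable
  then show lI: "integrable M (\<lambda>\<omega>. l (I \<omega>))"
    by (rule square_integrable_imp_integrable[rotated]) measurable
  have "ennreal ((expectation (\<lambda>\<omega>. l (I \<omega>)))\<^sup>2) \<le> d k" for k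
  proof -
    let ?Z = "\<lambda>\<omega>. X k \<omega> - l (I \<omega>)"
    have XI: "integrable M (\<lambda>\<omega>. (?Z \<omega>)\<^sup>2)"
    proof (rule Bochner_Integration.integrable_bound)
      show "integrable M (\<lambda>\<omega>. 2 * (X k \<omega>)\<^sup>2 + 2 * (l (I \<omega>))\<^sup>2)" using mX[of k] lI2 by simp
      have "(?Z \<omega>)\<^sup>2 \<le> 2 * (X k \<omega>)\<^sup>2 + 2 * (l (I \<omega>))\<^sup>2" for \<omega>
        using power2_le_two_add[of "X k \<omega>" "- l (I \<omega>)"] by simp
      then show "AE \<omega> in M. norm ((?Z \<omega>)\<^sup>2) \<le> norm (2 * (X k \<omega>)\<^sup>2 + 2 * (l (I \<omega>))\<^sup>2)" by simp
    qed measurable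
    have Z: "integrable M ?Z" using mX[of k] lI by simp
    have "(expectation (\<lambda>\<omega>. l (I \<omega>)))\<^sup>2 = (expectation ?Z)\<^sup>2" using mX[of k] lI by simp
    also have "\<dots> \<le> expectation (\<lambda>\<omega>. (?Z \<omega>)\<^sup>2)"
      using variance_eq[OF Z XI] variance_positive[of ?Z] by simp
    finally show ?thesis
      unfolding d_def using nn_integral_eq_integral[OF XI] by (simp add: ennreal_leI)
  qed
  then have "ennreal ((expectation (\<lambda>\<omega>. l (I \<omega>)))\<^sup>2) \<le> 0"
    by (intro LIMSEQ_le_const[OF d0]) auto
  then show "expectation (\<lambda>\<omega>. l (I \<omega>)) = 0" by (simp add: ennreal_eq_0_iff)
qed

end

section \<open>Time integrals over compact intervals\<close>

lemma sigma_finite_lborel_Icc: "sigma_finite_measure (restrict_space lborel {a..b::real})"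
  by (rule sigma_finite_measure_restrict_space) (simp_all add: lborel.sigma_finite_measure_axioms)

lemma LINT_Icc_eq_integral:
  fixes h :: "real \<Rightarrow> real"
  assumes "continuous_on {a..b} h"
  shows "(LINT \<rho>:{a..b}|lborel. h \<rho>) = integral {a..b} h"
  by (rule set_borel_integral_eq_integral(2)[OF borel_integrable_atLeastAtMost'[OF assms]])

lemma integral_power2_le:
  fixes h :: "real \<Rightarrow> real"
  assumes "a \<le> b" "continuous_on {a..b} h"
  shows "ennreal ((integral {a..b} h)\<^sup>2)
    \<le> ennreal (b - a) * (\<integral>\<^sup>+\<rho>. ennreal ((h \<rho>)\<^sup>2) \<partial>restrict_space lborel {a..b})"
proof -
  let ?L = "restrict_space lborel {a..b}"
  have int: "integrable ?L h"
    using borel_integrable_atLeastAtMost'[OF assms(2)]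
    by (simp add: integrable_restrict_space set_integrable_def)
  then have [measurable]: "h \<in> borel_measurable ?L" by simp
  have "integral {a..b} h = integral\<^sup>L ?L h"
    using LINT_Icc_eq_integral[OF assms(2)] by (simp add: integral_restrict_space set_lebesgue_integral_def)
  then have "ennreal ((integral {a..b} h)\<^sup>2) = (ennreal \<bar>integral\<^sup>L ?L h\<bar>)\<^sup>2"
    by (simp add: ennreal_power)
  also have "\<dots> \<le> (\<integral>\<^sup>+\<rho>. 1 * ennreal \<bar>h \<rho>\<bar> \<partial>?L)\<^sup>2"
    using integral_norm_bound_ennreal[OF int] by (intro power_mono) auto
  also have "\<dots> \<le> (\<integral>\<^sup>+\<rho>. 1\<^sup>2 \<partial>?L) * (\<integral>\<^sup>+\<rho>. (ennreal \<bar>h \<rho>\<bar>)\<^sup>2 \<partial>?L)"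
    by (rule Cauchy_Schwarz_nn_integral) measurable
  also have "(\<integral>\<^sup>+\<rho>. 1\<^sup>2 \<partial>?L) = ennreal (b - a)"
    using assms(1) by (simp add: emeasure_restrict_space space_restrict_space)
  finally show ?thesis by (simp add: ennreal_power)
qed

context brownian begin

section \<open>Progressive measurability and continuous paths\<close>

text \<open>Off this null set the paths are continuous. Setting the paths to 0 on it makes all of them
  continuous and preserves adaptedness, because the filtration contains the null sets.\<close>

definition bad_paths :: "'a set" where
  "bad_paths = (SOME N. N \<in> null_sets M \<and> (\<forall>\<omega>\<in>space M - N. continuous_on {0..} (\<lambda>t. W t \<omega>)))"

lemma bad_paths: "bad_paths \<in> null_sets M" "\<omega> \<in> space M - bad_paths \<Longrightarrow> continuous_on {0..} (\<lambda>t. W t \<omega>)"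
proof -
  have "AE \<omega> in M. continuous_on {0..} (\<lambda>t. W t \<omega>)"
    using bm by (simp add: brownian_motion_def)
  from AE_E[OF this] obtain N where "{\<omega> \<in> space M. \<not> continuous_on {0..} (\<lambda>t. W t \<omega>)} \<subseteq> N"
      "emeasure M N = 0" "N \<in> sets M" by blast
  then have "\<exists>N. N \<in> null_sets M \<and> (\<forall>\<omega>\<in>space M - N. continuous_on {0..} (\<lambda>t. W t \<omega>))"
    by (intro exI[of _ N]) auto
  from someI_ex[OF this, folded bad_paths_def]
  show "bad_paths \<in> null_sets M" "\<omega> \<in> space M - bad_paths \<Longrightarrow> continuous_on {0..} (\<lambda>t. W t \<omega>)"
    by auto
qed

definition cont_W :: "real \<Rightarrow> 'a \<Rightarrow> real" where
  "cont_W t \<omega> = (if \<omega> \<in> bad_paths then 0 else W t \<omega>)"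

lemma cont_W_adapted: "0 \<le> t \<Longrightarrow> cont_W t \<in> borel_measurable (F t)"
proof -
  assume t: "0 \<le> t"
  have [measurable]: "bad_paths \<in> sets (F t)"
    by (rule null_sets_filtration[OF bad_paths(1)])
  note [measurable] = W_adapted[OF t]
  show ?thesis unfolding cont_W_def[abs_def] by measurable
qed

lemma cont_W_measurable: "0 \<le> t \<Longrightarrow> cont_W t \<in> borel_measurable M"
  using cont_W_adapted measurable_F_M by blast

lemma continuous_on_cont_W: "\<omega> \<in> space M \<Longrightarrow> continuous_on {0..} (\<lambda>t. cont_W t \<omega>)"
  using bad_paths(2)[of \<omega>] by (cases "\<omega> \<in> bad_paths") (auto simp: cont_W_def)

lemma AE_cont_W_eq: "AE \<omega> in M. \<forall>t. cont_W t \<omega> = W t \<omega>"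
  using AE_not_in[OF bad_paths(1)] by eventually_elim (simp add: cont_W_def)

text \<open>On \<open>[t, s]\<close> the process is the pointwise limit of the processes that are frozen at grid points.
  These use countably many times, none beyond \<open>s\<close>, and so are jointly measurable.\<close>

lemma progressive_continuous_adapted:
  fixes X :: "real \<Rightarrow> 'a \<Rightarrow> real"
  assumes X: "\<And>t. 0 \<le> t \<Longrightarrow> X t \<in> borel_measurable (F t)"
    and cont: "\<And>\<omega>. \<omega> \<in> space M \<Longrightarrow> continuous_on {0..} (\<lambda>t. X t \<omega>)" and t: "0 \<le> t"
  shows "progressive F t T X"
  unfolding progressive_def
proof
  fix s assume s: "s \<in> {t..T}"
  let ?R = "restrict_space borel {t..s} \<Otimes>\<^sub>M F s"
  define q where "q n \<rho> = real_of_int \<lfloor>real (Suc n) * \<rho>\<rfloor> / real (Suc n)" for n \<rho>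
  have "(\<lambda>x. X (fst x) (snd x)) \<in> borel_measurable ?R"
  proof (rule borel_measurable_LIMSEQ_real)
    fix n
    have [measurable]: "fst \<in> borel_measurable ?R"
      by (rule measurable_compose[OF measurable_fst measurable_restrict_space1]) simp
    \<comment> \<open>The clamp to \<open>[0, s]\<close> is inactive on the space, but makes every single grid point admissible.\<close>
    have "(\<lambda>x. X (max 0 (min s (real_of_int \<lfloor>real (Suc n) * fst x\<rfloor> / real (Suc n)))) (snd x)) \<in> borel_measurable ?R"
    proof (rule measurable_compose_countable[where g="\<lambda>x. \<lfloor>real (Suc n) * fst x\<rfloor>" and
          f="\<lambda>i x. X (max 0 (min s (real_of_int i / real (Suc n)))) (snd x)"])
      fix i :: int
      have "X (max 0 (min s (real_of_int i / real (Suc n)))) \<in> borel_measurable (F s)"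
        using s t by (intro measurable_filtration_mono[OF X]) auto
      then show "(\<lambda>x. X (max 0 (min s (real_of_int i / real (Suc n)))) (snd x)) \<in> borel_measurable ?R"
        by (rule measurable_compose[OF measurable_snd])
    qed measurable
    then show "(\<lambda>x. X (max 0 (min s (q n (fst x)))) (snd x)) \<in> borel_measurable ?R"
      by (simp add: q_def)
  next
    fix x assume "x \<in> space ?R"
    then have x: "fst x \<in> {t..s}" "snd x \<in> space M"
      by (auto simp: space_pair_measure space_restrict_space)
    have q: "q n (fst x) \<le> fst x" "fst x - inverse (real (Suc n)) \<le> q n (fst x)" for n
    proof -
      have "real_of_int \<lfloor>real (Suc n) * fst x\<rfloor> \<le> real (Suc n) * fst x"
        "real (Suc n) * fst x - 1 \<le> real_of_int \<lfloor>real (Suc n) * fst x\<rfloor>" by linarith+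
      note this[THEN divide_right_mono, of "real (Suc n)"]
      then show "q n (fst x) \<le> fst x" "fst x - inverse (real (Suc n)) \<le> q n (fst x)"
        unfolding q_def by (simp_all add: diff_divide_distrib inverse_eq_divide del: of_nat_Suc)
    qed
    have "(\<lambda>n. q n (fst x)) \<longlonglongrightarrow> fst x"
    proof (rule tendsto_sandwich[OF _ _ _ tendsto_const])
      show "(\<lambda>n. fst x - inverse (real (Suc n))) \<longlonglongrightarrow> fst x"
        using tendsto_diff[OF tendsto_const LIMSEQ_inverse_real_of_nat, of "fst x"] by simp
    qed (use q in auto)
    then have "(\<lambda>n. max 0 (min s (q n (fst x)))) \<longlonglongrightarrow> max 0 (min s (fst x))"
      by (intro tendsto_intros)
    then have "(\<lambda>n. max 0 (min s (q n (fst x)))) \<longlonglongrightarrow> fst x" using x t by simp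
    then show "(\<lambda>n. X (max 0 (min s (q n (fst x)))) (snd x)) \<longlonglongrightarrow> X (fst x) (snd x)"
      using x t by (intro continuous_on_tendsto_compose[OF cont[of "snd x"]]) auto
  qed
  then show "(\<lambda>(\<rho>, \<omega>). X \<rho> \<omega>) \<in> borel_measurable ?R" by (simp add: split_beta)
qed

lemma progressive_cont_W: "0 \<le> t \<Longrightarrow> progressive F t T cont_W"
  by (rule progressive_continuous_adapted[OF cont_W_adapted continuous_on_cont_W])

lemma progressiveD:
  "progressive F t T X \<Longrightarrow> s \<in> {t..T} \<Longrightarrow>
    (\<lambda>(\<rho>, \<omega>). X \<rho> \<omega>) \<in> borel_measurable (restrict_space borel {t..s} \<Otimes>\<^sub>M F s)"
  unfolding progressive_def by blast

lemma progressive_section: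
  assumes "progressive F t T X" "s \<in> {t..T}"
  shows "X s \<in> borel_measurable (F s)"
proof -
  have "(\<lambda>\<omega>. (s, \<omega>)) \<in> measurable (F s) (restrict_space borel {t..s} \<Otimes>\<^sub>M F s)"
    using assms(2) by (intro measurable_Pair1') (simp add: space_restrict_space)
  from measurable_compose[OF this progressiveD[OF assms]] show ?thesis by simp
qed

text \<open>Clamping the time to \<open>[t, s]\<close> keeps the values on this interval and replaces the restricted time
  space by the whole real line, where products and parametrised integrals are convenient.\<close>

lemma progressive_clamp:
  assumes "progressive F t T X" "s \<in> {t..T}"
  shows "(\<lambda>(\<rho>, \<omega>). X (max t (min s \<rho>)) \<omega>) \<in> borel_measurable (borel \<Otimes>\<^sub>M F s)"
proof -
  have "(\<lambda>\<rho>. max t (min s \<rho>)) \<in> measurable borel (restrict_space borel {t..s})"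
    using assms(2) by (intro measurable_restrict_space2) auto
  then have "(\<lambda>x. (max t (min s (fst x)), snd x)) \<in> measurable (borel \<Otimes>\<^sub>M F s) (restrict_space borel {t..s} \<Otimes>\<^sub>M F s)"
    by (intro measurable_Pair measurable_compose[OF measurable_fst] measurable_snd)
  from measurable_compose[OF this progressiveD[OF assms]] show ?thesis by (simp add: split_beta)
qed

lemma progressive_compose:
  fixes X :: "real \<Rightarrow> 'a \<Rightarrow> 'c::topological_space" and K :: "real \<Rightarrow> 'c \<Rightarrow> 'd::topological_space"
  assumes X: "progressive F t T X" and K: "(\<lambda>(\<rho>, x). K \<rho> x) \<in> borel_measurable (borel \<Otimes>\<^sub>M borel)"
  shows "progressive F t T (\<lambda>\<rho> \<omega>. K \<rho> (X \<rho> \<omega>))"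
  unfolding progressive_def
proof
  fix s assume "s \<in> {t..T}"
  note m = progressiveD[OF X this]
  have "fst \<in> borel_measurable (restrict_space borel {t..s} \<Otimes>\<^sub>M F s)"
    by (rule measurable_compose[OF measurable_fst measurable_restrict_space1]) simp
  from measurable_compose[OF measurable_Pair[OF this m] K]
  show "(\<lambda>(\<rho>, \<omega>). K \<rho> (X \<rho> \<omega>)) \<in> borel_measurable (restrict_space borel {t..s} \<Otimes>\<^sub>M F s)"
    by (simp add: split_beta)
qed

lemma progressive_subinterval:
  assumes X: "progressive F t0 T X" and t: "t0 \<le> t"
  shows "progressive F t T X"
  unfolding progressive_def
proof
  fix s assume "s \<in> {t..T}"
  then have "s \<in> {t0..T}" using t by simp
  note m = progressiveD[OF X this]
  have "(\<lambda>\<rho>. \<rho>) \<in> measurable (restrict_space borel {t..s}) (restrict_space borel {t0..s})"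
    using t by (intro measurable_restrict_space2 measurable_restrict_space1) (auto simp: space_restrict_space)
  then have "(\<lambda>x. (fst x, snd x)) \<in> measurable (restrict_space borel {t..s} \<Otimes>\<^sub>M F s) (restrict_space borel {t0..s} \<Otimes>\<^sub>M F s)"
    by (intro measurable_Pair measurable_compose[OF measurable_fst] measurable_snd)
  from measurable_compose[OF this m]
  show "(\<lambda>(\<rho>, \<omega>). X \<rho> \<omega>) \<in> borel_measurable (restrict_space borel {t..s} \<Otimes>\<^sub>M F s)"
    by simp
qed

lemma progressive_deterministic:
  fixes k :: "real \<Rightarrow> 'd::topological_space"
  assumes "k \<in> borel_measurable borel"
  shows "progressive F t T (\<lambda>\<rho> \<omega>. k \<rho>)"
  unfolding progressive_def split_beta'
  by (intro ballI measurable_compose[OF measurable_fst] measurable_restrict_space1 assms)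

lemma progressive_const:
  assumes X: "X \<in> borel_measurable (F t)"
  shows "progressive F t T (\<lambda>\<rho>. X)"
  unfolding progressive_def split_beta'
  by (intro ballI measurable_compose[OF measurable_snd] measurable_filtration_mono[OF X]) simp

lemma progressive_add:
  fixes X Y :: "real \<Rightarrow> 'a \<Rightarrow> 'h::{second_countable_topology, topological_monoid_add}"
  assumes "progressive F t T X" "progressive F t T Y"
  shows "progressive F t T (\<lambda>\<rho> \<omega>. X \<rho> \<omega> + Y \<rho> \<omega>)"
  using assms unfolding progressive_def split_beta' by (intro ballI borel_measurable_add) blast+

text \<open>Only values of \<open>X\<close> up to the time \<open>s\<close> enter the integral, which is therefore a parametrised
  integral with respect to the information at time \<open>s\<close>. The kernel may depend on both times; this
  covers the control term of the mild equation as well as the pathwise form of the noise.\<close>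

lemma progressive_convolution:
  fixes X :: "real \<Rightarrow> 'a \<Rightarrow> 'c::topological_space"
    and K :: "real \<Rightarrow> real \<Rightarrow> 'c \<Rightarrow> 'h::{banach, second_countable_topology}"
  assumes X: "progressive F t T X"
    and K: "(\<lambda>((s, \<rho>), x). K s \<rho> x) \<in> borel_measurable ((borel \<Otimes>\<^sub>M borel) \<Otimes>\<^sub>M borel)"
  shows "progressive F t T (\<lambda>s \<omega>. LINT \<rho>:{t..s}|lborel. K s \<rho> (X \<rho> \<omega>))"
  unfolding progressive_def
proof
  fix s' assume s': "s' \<in> {t..T}"
  let ?R = "restrict_space borel {t..s'} \<Otimes>\<^sub>M F s'"
  note m = progressive_clamp[OF X s']
  have f1 [measurable]: "fst \<in> borel_measurable ?R"
    by (rule measurable_compose[OF measurable_fst measurable_restrict_space1]) simp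
  have s1 [measurable]: "snd \<in> borel_measurable (?R \<Otimes>\<^sub>M lborel)"
    using measurable_snd[of ?R lborel] by (simp cong: measurable_cong_sets)
  have a: "(\<lambda>y. (snd y, snd (fst y))) \<in> measurable (?R \<Otimes>\<^sub>M lborel) (borel \<Otimes>\<^sub>M F s')"
    by (intro measurable_Pair s1 measurable_compose[OF measurable_fst measurable_snd])
  have b: "(\<lambda>y. X (max t (min s' (snd y))) (snd (fst y))) \<in> borel_measurable (?R \<Otimes>\<^sub>M lborel)"
    using measurable_compose[OF a m] by (simp add: split_beta)
  have c: "(\<lambda>y. fst (fst y)) \<in> borel_measurable (?R \<Otimes>\<^sub>M lborel)"
    by (rule measurable_compose[OF measurable_fst f1])
  have d: "(\<lambda>y. K (fst (fst y)) (snd y) (X (max t (min s' (snd y))) (snd (fst y))))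
      \<in> borel_measurable (?R \<Otimes>\<^sub>M lborel)"
    using measurable_compose[OF measurable_Pair[OF measurable_Pair[OF c s1] b] K] by simp
  have e: "Measurable.pred (?R \<Otimes>\<^sub>M lborel) (\<lambda>y. t \<le> snd y \<and> snd y \<le> fst (fst y))"
    using c s1 by measurable
  have "(\<lambda>y. if t \<le> snd y \<and> snd y \<le> fst (fst y)
       then K (fst (fst y)) (snd y) (X (max t (min s' (snd y))) (snd (fst y))) else 0)
      \<in> borel_measurable (?R \<Otimes>\<^sub>M lborel)"
    by (rule measurable_If[OF d _ e[unfolded pred_def]]) simp
  then have "(\<lambda>x. LINT \<rho>|lborel. (if t \<le> \<rho> \<and> \<rho> \<le> fst x
       then K (fst x) \<rho> (X (max t (min s' \<rho>)) (snd x)) else 0)) \<in> borel_measurable ?R"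
    by (intro lborel.borel_measurable_lebesgue_integral) (simp add: split_beta)
  then show "(\<lambda>(s, \<omega>). LINT \<rho>:{t..s}|lborel. K s \<rho> (X \<rho> \<omega>)) \<in> borel_measurable ?R"
  proof (rule measurable_cong[THEN iffD1, rotated])
    fix x assume "x \<in> space ?R"
    then have "fst x \<in> {t..s'}" by (auto simp: space_pair_measure space_restrict_space)
    then show "(LINT \<rho>|lborel. (if t \<le> \<rho> \<and> \<rho> \<le> fst x
       then K (fst x) \<rho> (X (max t (min s' \<rho>)) (snd x)) else 0))
      = (case x of (s, \<omega>) \<Rightarrow> (LINT \<rho>:{t..s}|lborel. K s \<rho> (X \<rho> \<omega>)))"
      unfolding set_lebesgue_integral_def split_beta
      by (intro Bochner_Integration.integral_cong refl) auto
  qed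
qed

section \<open>Ito integrals of continuously differentiable functions\<close>

lemma elementary_process_eq:
  assumes e: "elementary F t s n p c" and i: "i < n" "\<rho> \<in> {p i<..p (Suc i)}"
  shows "elementary_process n p c \<rho> \<omega> = c i \<omega>"
proof -
  have "indicator {p j<..p (Suc j)} \<rho> *\<^sub>R c j \<omega> = (if j = i then c i \<omega> else 0)" if "j < n" for j
  proof (cases j i rule: linorder_cases)
    case less
    then show ?thesis using elementary_partition_mono[OF e, of "Suc j" i] i by auto
  next
    case greater
    then show ?thesis using elementary_partition_mono[OF e, of "Suc i" j] i that by auto
  qed (use i in auto)
  then have "elementary_process n p c \<rho> \<omega> = (\<Sum>j<n. if j = i then c i \<omega> else 0)"
    unfolding elementary_process_def by (intro sum.cong) auto
  then show ?thesis using i by simp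
qed

lemma partition_interval_ex:
  assumes "elementary F t s n p c" "t < \<rho>" "\<rho> \<le> s"
  shows "\<exists>i<n. \<rho> \<in> {p i<..p (Suc i)}"
  using assms
proof (induction n arbitrary: s)
  case 0
  then show ?case by (auto simp: elementary_def)
next
  case (Suc n)
  show ?case
  proof (cases "\<rho> \<le> p n")
    case True
    then show ?thesis using Suc.IH[OF elementary_butlast[OF Suc.prems(1)] Suc.prems(2)] by (meson less_SucI)
  next
    case False
    then show ?thesis using Suc.prems by (intro exI[of _ n]) (auto simp: elementary_def)
  qed
qed

lemma continuous_on_cont_W_Icc: "\<omega> \<in> space M \<Longrightarrow> 0 \<le> a \<Longrightarrow> continuous_on {a..b} (\<lambda>t. cont_W t \<omega>)"
  by (rule continuous_on_subset[OF continuous_on_cont_W]) auto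

lemma cont_W_increment_second_moment:
  assumes "0 \<le> a" "a \<le> b"
  shows "(\<integral>\<^sup>+\<omega>. ennreal ((cont_W a \<omega> - cont_W b \<omega>)\<^sup>2) \<partial>M) = ennreal (b - a)"
proof -
  have "(\<integral>\<^sup>+\<omega>. ennreal ((cont_W a \<omega> - cont_W b \<omega>)\<^sup>2) \<partial>M) = (\<integral>\<^sup>+\<omega>. ennreal ((W b \<omega> - W a \<omega>)\<^sup>2) \<partial>M)"
    by (rule nn_integral_cong_AE, use AE_cont_W_eq in eventually_elim) (simp add: power2_commute)
  also have "\<dots> = ennreal (expectation (\<lambda>\<omega>. (W b \<omega> - W a \<omega>)\<^sup>2))"
    by (rule nn_integral_eq_integral[OF increment_moments(3)[OF assms]]) simp
  finally show ?thesis using increment_moments(4)[OF assms] by simp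
qed

text \<open>The integral of \<open>f\<close> with respect to the Brownian path, written by integration by parts so that it
  is defined path by path; \<open>f'\<close> is meant to be the derivative of \<open>f\<close>.\<close>

definition parts_integral :: "(real \<Rightarrow> real) \<Rightarrow> (real \<Rightarrow> real) \<Rightarrow> real \<Rightarrow> real \<Rightarrow> 'a \<Rightarrow> real" where
  "parts_integral f f' a b \<omega> = f b * cont_W b \<omega> - f a * cont_W a \<omega> - (LINT \<rho>:{a..b}|lborel. f' \<rho> * cont_W \<rho> \<omega>)"

lemma parts_integral_measurable:
  assumes ab: "0 \<le> a" "a \<le> b" and f': "continuous_on UNIV f'"
  shows "parts_integral f f' a b \<in> borel_measurable M"
proof -
  note [measurable] = borel_measurable_continuous_onI[OF f']
  have "progressive F a b (\<lambda>s \<omega>. LINT \<rho>:{a..s}|lborel. f' \<rho> * cont_W \<rho> \<omega>)"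
    by (rule progressive_convolution[OF progressive_cont_W[OF ab(1)], where K="\<lambda>s \<rho> x. f' \<rho> * x"],
        unfold split_beta' split_beta, measurable)
  from progressive_section[OF this, of b] ab
  have "(\<lambda>\<omega>. LINT \<rho>:{a..b}|lborel. f' \<rho> * cont_W \<rho> \<omega>) \<in> borel_measurable M"
    by (intro measurable_F_M[of b]) auto
  then show ?thesis
    unfolding parts_integral_def[abs_def] using ab
    by (intro borel_measurable_diff borel_measurable_times borel_measurable_const cont_W_measurable) auto
qed

lemma parts_integral_combine:
  assumes "0 \<le> a" "a \<le> b" "b \<le> c" "\<omega> \<in> space M" and f': "continuous_on UNIV f'"
  shows "parts_integral f f' a c \<omega> = parts_integral f f' a b \<omega> + parts_integral f f' b c \<omega>"
proof -
  have cont: "continuous_on {u..v} (\<lambda>\<rho>. f' \<rho> * cont_W \<rho> \<omega>)" if "0 \<le> u" for u v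
    using that assms by (intro continuous_on_mult continuous_on_subset[OF f'] continuous_on_cont_W_Icc) auto
  have "integral {a..b} (\<lambda>\<rho>. f' \<rho> * cont_W \<rho> \<omega>) + integral {b..c} (\<lambda>\<rho>. f' \<rho> * cont_W \<rho> \<omega>)
      = integral {a..c} (\<lambda>\<rho>. f' \<rho> * cont_W \<rho> \<omega>)"
    using assms by (intro Henstock_Kurzweil_Integration.integral_combine integrable_continuous_real cont) auto
  then show ?thesis
    using assms by (simp add: parts_integral_def LINT_Icc_eq_integral cont)
qed

lemma parts_integral_error:
  assumes ab: "0 \<le> a" "a \<le> b" and \<omega>: "\<omega> \<in> space M"
    and f: "\<And>x. (f has_real_derivative f' x) (at x)" and f': "continuous_on UNIV f'"
  shows "f a * (cont_W b \<omega> - cont_W a \<omega>) - parts_integral f f' a b \<omega>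
    = integral {a..b} (\<lambda>\<rho>. f' \<rho> * (cont_W \<rho> \<omega> - cont_W b \<omega>))"
proof -
  have 1: "(\<lambda>\<rho>. f' \<rho> * cont_W \<rho> \<omega>) integrable_on {a..b}"
    and c1: "continuous_on {a..b} (\<lambda>\<rho>. f' \<rho> * cont_W \<rho> \<omega>)"
    using ab \<omega> by (auto intro!: integrable_continuous_real continuous_on_mult continuous_on_subset[OF f'] continuous_on_cont_W_Icc)
  have 2: "(f' has_integral (f b - f a)) {a..b}"
    using f by (intro fundamental_theorem_of_calculus ab)
      (auto simp: has_real_derivative_iff_has_vector_derivative[symmetric] intro: has_field_derivative_at_within)
  have "((\<lambda>\<rho>. f' \<rho> * cont_W \<rho> \<omega> - f' \<rho> * cont_W b \<omega>) has_integral
      (integral {a..b} (\<lambda>\<rho>. f' \<rho> * cont_W \<rho> \<omega>) - (f b - f a) * cont_W b \<omega>)) {a..b}"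
    by (intro has_integral_diff integrable_integral[OF 1] has_integral_mult_left 2)
  then have "integral {a..b} (\<lambda>\<rho>. f' \<rho> * (cont_W \<rho> \<omega> - cont_W b \<omega>))
     = integral {a..b} (\<lambda>\<rho>. f' \<rho> * cont_W \<rho> \<omega>) - (f b - f a) * cont_W b \<omega>"
    by (simp add: right_diff_distrib integral_unique)
  then show ?thesis
    by (simp add: parts_integral_def LINT_Icc_eq_integral[OF c1] algebra_simps)
qed

text \<open>The error of one step is an integral over \<open>[a, b]\<close> of an increment with second moment at most
  \<open>b - a\<close>; Cauchy--Schwarz in time gives another factor \<open>b - a\<close> in addition to the length of the interval.
  The third power leaves room for summing \<open>n\<close> errors with the crude bound by \<open>n\<close> times the sum of their
  squares.\<close>

lemma parts_integral_error_second_moment: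
  assumes ab: "0 \<le> a" "a \<le> b"
    and f: "\<And>x. (f has_real_derivative f' x) (at x)" and f': "continuous_on UNIV f'"
    and K: "0 \<le> K" "\<And>x. x \<in> {a..b} \<Longrightarrow> \<bar>f' x\<bar> \<le> K"
  shows "(\<integral>\<^sup>+\<omega>. ennreal ((f a * (cont_W b \<omega> - cont_W a \<omega>) - parts_integral f f' a b \<omega>)\<^sup>2) \<partial>M)
    \<le> ennreal (K\<^sup>2 * (b - a) ^ 3)"
proof -
  let ?L = "restrict_space lborel {a..b}"
  interpret L: sigma_finite_measure ?L by (rule sigma_finite_lborel_Icc)
  interpret P: pair_sigma_finite ?L M ..
  have [measurable]: "(\<lambda>(\<rho>, \<omega>). cont_W \<rho> \<omega>) \<in> borel_measurable (?L \<Otimes>\<^sub>M M)" "cont_W b \<in> borel_measurable M"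
    using progressive_measurable_product[OF progressive_cont_W[OF ab(1)] ab] cont_W_measurable ab by auto
  have pt: "ennreal ((f a * (cont_W b \<omega> - cont_W a \<omega>) - parts_integral f f' a b \<omega>)\<^sup>2)
      \<le> ennreal ((b - a) * K\<^sup>2) * (\<integral>\<^sup>+\<rho>. ennreal ((cont_W \<rho> \<omega> - cont_W b \<omega>)\<^sup>2) \<partial>?L)" if \<omega>: "\<omega> \<in> space M" for \<omega>
  proof -
    have "continuous_on {a..b} (\<lambda>\<rho>. f' \<rho> * (cont_W \<rho> \<omega> - cont_W b \<omega>))"
      using ab \<omega> by (intro continuous_intros continuous_on_subset[OF f'] continuous_on_cont_W_Icc) auto
    note integral_power2_le[OF ab(2) this]
    also have "(\<integral>\<^sup>+\<rho>. ennreal ((f' \<rho> * (cont_W \<rho> \<omega> - cont_W b \<omega>))\<^sup>2) \<partial>?L)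
        \<le> (\<integral>\<^sup>+\<rho>. ennreal (K\<^sup>2) * ennreal ((cont_W \<rho> \<omega> - cont_W b \<omega>)\<^sup>2) \<partial>?L)"
    proof (rule nn_integral_mono)
      fix \<rho> assume "\<rho> \<in> space ?L"
      then have "\<bar>f' \<rho>\<bar>\<^sup>2 \<le> K\<^sup>2" using K(2)[of \<rho>] by (intro power_mono) (auto simp: space_restrict_space)
      then show "ennreal ((f' \<rho> * (cont_W \<rho> \<omega> - cont_W b \<omega>))\<^sup>2) \<le> ennreal (K\<^sup>2) * ennreal ((cont_W \<rho> \<omega> - cont_W b \<omega>)\<^sup>2)"
        by (simp add: ennreal_mult[symmetric] power_mult_distrib mult_right_mono ennreal_leI)
    qed
    also have "\<dots> = ennreal (K\<^sup>2) * (\<integral>\<^sup>+\<rho>. ennreal ((cont_W \<rho> \<omega> - cont_W b \<omega>)\<^sup>2) \<partial>?L)"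
      using \<omega> by (intro nn_integral_cmult) measurable
    finally show ?thesis
      unfolding parts_integral_error[OF ab \<omega> f f'] using ab
      by (simp add: ennreal_mult mult.assoc mult_left_mono)
  qed
  have "(\<integral>\<^sup>+\<omega>. ennreal ((f a * (cont_W b \<omega> - cont_W a \<omega>) - parts_integral f f' a b \<omega>)\<^sup>2) \<partial>M)
    \<le> (\<integral>\<^sup>+\<omega>. ennreal ((b - a) * K\<^sup>2) * (\<integral>\<^sup>+\<rho>. ennreal ((cont_W \<rho> \<omega> - cont_W b \<omega>)\<^sup>2) \<partial>?L) \<partial>M)"
    by (rule nn_integral_mono) (rule pt)
  also have "\<dots> = ennreal ((b - a) * K\<^sup>2) * (\<integral>\<^sup>+\<omega>. (\<integral>\<^sup>+\<rho>. ennreal ((cont_W \<rho> \<omega> - cont_W b \<omega>)\<^sup>2) \<partial>?L) \<partial>M)"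
    by (rule nn_integral_cmult) measurable
  also have "(\<integral>\<^sup>+\<omega>. (\<integral>\<^sup>+\<rho>. ennreal ((cont_W \<rho> \<omega> - cont_W b \<omega>)\<^sup>2) \<partial>?L) \<partial>M)
      = (\<integral>\<^sup>+\<rho>. (\<integral>\<^sup>+\<omega>. ennreal ((cont_W \<rho> \<omega> - cont_W b \<omega>)\<^sup>2) \<partial>M) \<partial>?L)"
    by (rule P.Fubini') measurable
  also have "\<dots> \<le> (\<integral>\<^sup>+\<rho>. ennreal (b - a) \<partial>?L)"
    using ab by (intro nn_integral_mono) (simp add: cont_W_increment_second_moment space_restrict_space ennreal_leI)
  also have "\<dots> = ennreal (b - a) * ennreal (b - a)"
    using ab by (simp add: emeasure_restrict_space space_restrict_space)
  also have "ennreal ((b - a) * K\<^sup>2) * (ennreal (b - a) * ennreal (b - a)) = ennreal (K\<^sup>2 * (b - a) ^ 3)"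
  proof -
    have "ennreal (D * K\<^sup>2) * (ennreal D * ennreal D) = ennreal (K\<^sup>2 * D ^ 3)" if "0 \<le> D" for D
      using that by (simp add: ennreal_mult[symmetric] power3_eq_cube mult_ac)
    then show ?thesis using ab by simp
  qed
  finally show ?thesis by (simp add: mult_left_mono)
qed

lemma nn_integral_deterministic_product:
  assumes [measurable]: "h \<in> borel_measurable (restrict_space lborel S)"
  shows "(\<integral>\<^sup>+(\<rho>, \<omega>). h \<rho> \<partial>(restrict_space lborel S \<Otimes>\<^sub>M M)) = (\<integral>\<^sup>+\<rho>. h \<rho> \<partial>restrict_space lborel S)"
  by (subst nn_integral_fst[symmetric]) (simp_all add: emeasure_space_1)

lemma sum_parts_integral:
  assumes e: "elementary F t s n p c" and t: "0 \<le> t" and \<omega>: "\<omega> \<in> space M" and f': "continuous_on UNIV f'"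
  shows "(\<Sum>i<n. parts_integral f f' (p i) (p (Suc i)) \<omega>) = parts_integral f f' t s \<omega>"
  using e
proof (induction n arbitrary: s)
  case 0
  then have "s = t" by (auto simp: elementary_def)
  moreover have "(LINT \<rho>:{t..t}|lborel. f' \<rho> * cont_W \<rho> \<omega>) = 0"
    by (subst LINT_Icc_eq_integral) simp_all
  ultimately show ?case by (simp add: parts_integral_def)
next
  case (Suc n)
  have "t \<le> p n" "p n \<le> p (Suc n)" "p (Suc n) = s"
    using elementary_partition_bounds[OF Suc.prems, of n] Suc.prems by (auto simp: elementary_def)
  then show ?case
    using Suc.IH[OF elementary_butlast[OF Suc.prems]] parts_integral_combine[OF t _ _ \<omega> f', of "p n" s f] by simp
qed

text \<open>The elementary processes take the left endpoint values of \<open>f\<close> on an equidistant partition with mesh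
  \<open>\<delta>\<close>. The integrand is approximated uniformly because \<open>f\<close> is Lipschitz. For the integrals, \<open>n\<close> errors
  of second moment of order \<open>\<delta>\<^sup>3\<close> amount to a total of order \<open>n\<^sup>2\<delta>\<^sup>3\<close>, that is, of order \<open>\<delta>\<close>.\<close>

lemma has_ito_integral_C1:
  fixes g :: "'h::{banach, second_countable_topology}"
  assumes ts: "0 \<le> t" "t \<le> s"
    and f: "\<And>x. (f has_real_derivative f' x) (at x)" and f': "continuous_on UNIV f'"
  shows "has_ito_integral M F W t s (\<lambda>\<rho> \<omega>. f \<rho> *\<^sub>R g) (\<lambda>\<omega>. parts_integral f f' t s \<omega> *\<^sub>R g)"
proof -
  have fc: "continuous_on UNIV f" using f by (intro DERIV_continuous_on) (auto intro: has_field_derivative_at_within)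
  note [measurable] = borel_measurable_continuous_onI[OF fc] parts_integral_measurable[OF ts f', of f]
  have "bounded (f' ` {t..s})"
    by (intro compact_imp_bounded compact_continuous_image continuous_on_subset[OF f']) auto
  then obtain K where K: "K > 0" "\<And>x. x \<in> {t..s} \<Longrightarrow> \<bar>f' x\<bar> \<le> K"
    unfolding bounded_pos by auto
  define \<delta> where "\<delta> k = (s - t) / real (Suc k)" for k
  define p where "p k i = t + real i * \<delta> k" for k i
  define c where "c k i \<omega> = f (p k i) *\<^sub>R g" for k i and \<omega> :: 'a
  have \<delta>: "\<delta> k \<ge> 0" "real (Suc k) * \<delta> k = s - t" for k using ts by (simp_all add: \<delta>_def)
  have pS: "p k (Suc i) = p k i + \<delta> k" for k i by (simp add: p_def algebra_simps)
  have e: "elementary F t s (Suc k) (p k) (c k)" for k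
    unfolding elementary_def
  proof (intro conjI allI impI)
    show "p k (Suc k) = s" using \<delta>(2)[of k] by (simp only: p_def)
    show "c k i \<in> borel_measurable (F (p k i))" for i unfolding c_def[abs_def] by measurable
  qed (use \<delta>(1)[of k] in \<open>auto simp: pS c_def\<close>, simp add: p_def)
  have \<delta>0: "\<delta> \<longlonglongrightarrow> 0"
    using tendsto_mult[OF tendsto_const[of "s - t"] LIMSEQ_inverse_real_of_nat] by (simp add: \<delta>_def[abs_def] divide_inverse)
  have p_in: "p k i \<in> {t..s}" if "i \<le> Suc k" for k i
    using elementary_partition_bounds[OF e[of k] that] by simp
  let ?L = "restrict_space lborel {t..s}"
  have proc: "(\<lambda>k. \<integral>\<^sup>+(\<rho>, \<omega>). ennreal ((norm (elementary_process (Suc k) (p k) (c k) \<rho> \<omega> - f \<rho> *\<^sub>R g))\<^sup>2) \<partial>(?L \<Otimes>\<^sub>M M)) \<longlonglongrightarrow> 0"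
  proof (rule tendsto_sandwich[OF _ _ tendsto_const])
    have "(\<lambda>k. (K * \<delta> k * norm g)\<^sup>2 * (s - t)) \<longlonglongrightarrow> (K * 0 * norm g)\<^sup>2 * (s - t)"
      by (intro tendsto_intros \<delta>0)
    then show "(\<lambda>k. ennreal ((K * \<delta> k * norm g)\<^sup>2 * (s - t))) \<longlonglongrightarrow> 0"
      using tendsto_ennrealI by fastforce
    have "(\<integral>\<^sup>+(\<rho>, \<omega>). ennreal ((norm (elementary_process (Suc k) (p k) (c k) \<rho> \<omega> - f \<rho> *\<^sub>R g))\<^sup>2) \<partial>(?L \<Otimes>\<^sub>M M))
        \<le> ennreal ((K * \<delta> k * norm g)\<^sup>2 * (s - t))" for k
    proof -
      define h where "h \<rho> = (\<Sum>i<Suc k. indicator {p k i<..p k (Suc i)} \<rho> *\<^sub>R f (p k i) *\<^sub>R g)" for \<rho> :: real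
      have h: "elementary_process (Suc k) (p k) (c k) \<rho> \<omega> = h \<rho>" for \<rho> \<omega>
        by (simp only: elementary_process_def h_def c_def)
      have [measurable]: "h \<in> borel_measurable borel" unfolding h_def by measurable
      have "(\<integral>\<^sup>+(\<rho>, \<omega>). ennreal ((norm (h \<rho> - f \<rho> *\<^sub>R g))\<^sup>2) \<partial>(?L \<Otimes>\<^sub>M M))
          = (\<integral>\<^sup>+\<rho>. ennreal ((norm (h \<rho> - f \<rho> *\<^sub>R g))\<^sup>2) \<partial>?L)"
        by (rule nn_integral_deterministic_product) (rule measurable_restrict_space1, measurable)
      also have "\<dots> = (\<integral>\<^sup>+\<rho>. ennreal ((norm (h \<rho> - f \<rho> *\<^sub>R g))\<^sup>2) * indicator {t..s} \<rho> \<partial>lborel)"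
        by (subst nn_integral_restrict_space) simp_all
      also have "\<dots> \<le> (\<integral>\<^sup>+\<rho>. ennreal ((K * \<delta> k * norm g)\<^sup>2) * indicator {t..s} \<rho> \<partial>lborel)"
      \<comment> \<open>The half-open intervals of the partition miss the point \<open>t\<close>.\<close>
      proof (rule nn_integral_mono_AE, use AE_lborel_singleton[of t] in eventually_elim)
        fix \<rho> :: real assume "\<rho> \<noteq> t"
        show "ennreal ((norm (h \<rho> - f \<rho> *\<^sub>R g))\<^sup>2) * indicator {t..s} \<rho>
            \<le> ennreal ((K * \<delta> k * norm g)\<^sup>2) * indicator {t..s} \<rho>"
        proof (cases "\<rho> \<in> {t..s}")
          case True
          then obtain i where i: "i < Suc k" "\<rho> \<in> {p k i<..p k (Suc i)}"
            using partition_interval_ex[OF e[of k], of \<rho>] \<open>\<rho> \<noteq> t\<close> by auto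
          have "h \<rho> = f (p k i) *\<^sub>R g"
            using elementary_process_eq[OF e i] unfolding h c_def by blast
          moreover have "\<bar>f (p k i) - f \<rho>\<bar> \<le> K * \<delta> k"
          proof -
            obtain z where z: "p k i < z" "z < \<rho>" "f \<rho> - f (p k i) = (\<rho> - p k i) * f' z"
              using MVT2[of "p k i" \<rho> f f'] i f by auto
            have "\<bar>f' z\<bar> \<le> K" using z True p_in[of i k] i by (intro K(2)) auto
            then have "\<bar>\<rho> - p k i\<bar> * \<bar>f' z\<bar> \<le> \<delta> k * K"
              using i by (intro mult_mono \<delta>) (auto simp: pS)
            then show ?thesis using z(3) by (simp add: abs_minus_commute abs_mult mult.commute)
          qed
          ultimately have "norm (h \<rho> - f \<rho> *\<^sub>R g) \<le> K * \<delta> k * norm g"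
            by (simp add: scaleR_diff_left[symmetric] mult_right_mono)
          then show ?thesis using True by (simp add: ennreal_leI power_mono)
        qed simp
      qed
      also have "\<dots> = ennreal ((K * \<delta> k * norm g)\<^sup>2 * (s - t))"
        using ts by (simp add: nn_integral_cmult_indicator ennreal_mult)
      finally show ?thesis unfolding h .
    qed
    then show "\<forall>\<^sub>F k in sequentially. (\<integral>\<^sup>+(\<rho>, \<omega>). ennreal ((norm (elementary_process (Suc k) (p k) (c k) \<rho> \<omega> - f \<rho> *\<^sub>R g))\<^sup>2) \<partial>(?L \<Otimes>\<^sub>M M))
        \<le> ennreal ((K * \<delta> k * norm g)\<^sup>2 * (s - t))" by simp
  qed simp
  have int: "(\<lambda>k. \<integral>\<^sup>+\<omega>. ennreal ((norm (elementary_integral W (Suc k) (p k) (c k) \<omega> - parts_integral f f' t s \<omega> *\<^sub>R g))\<^sup>2) \<partial>M) \<longlonglongrightarrow> 0"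
  proof (rule tendsto_sandwich[OF _ _ tendsto_const])
    have "(\<lambda>k. (norm g)\<^sup>2 * (K\<^sup>2 * (s - t)\<^sup>2 * \<delta> k)) \<longlonglongrightarrow> (norm g)\<^sup>2 * (K\<^sup>2 * (s - t)\<^sup>2 * 0)"
      by (intro tendsto_intros \<delta>0)
    then show "(\<lambda>k. ennreal ((norm g)\<^sup>2 * (K\<^sup>2 * (s - t)\<^sup>2 * \<delta> k))) \<longlonglongrightarrow> 0"
      using tendsto_ennrealI by fastforce
    have "(\<integral>\<^sup>+\<omega>. ennreal ((norm (elementary_integral W (Suc k) (p k) (c k) \<omega> - parts_integral f f' t s \<omega> *\<^sub>R g))\<^sup>2) \<partial>M)
        \<le> ennreal ((norm g)\<^sup>2 * (K\<^sup>2 * (s - t)\<^sup>2 * \<delta> k))" for k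
    proof -
      define E where "E i \<omega> = f (p k i) * (cont_W (p k (Suc i)) \<omega> - cont_W (p k i) \<omega>)
          - parts_integral f f' (p k i) (p k (Suc i)) \<omega>" for i \<omega>
      have p0: "0 \<le> p k i" "p k i \<le> p k (Suc i)" for i using ts \<delta>(1)[of k] by (simp_all add: p_def algebra_simps)
      have [measurable]: "E i \<in> borel_measurable M" for i
        unfolding E_def[abs_def] using p0[of i] p0[of "Suc i"] cont_W_measurable parts_integral_measurable[OF p0 f'] by measurable
      have E: "(\<integral>\<^sup>+\<omega>. ennreal ((E i \<omega>)\<^sup>2) \<partial>M) \<le> ennreal (K\<^sup>2 * \<delta> k ^ 3)" if "i < Suc k" for i
      proof -
        have "\<bar>f' x\<bar> \<le> K" if "x \<in> {p k i..p k (Suc i)}" for x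
          using that p_in[of i k] p_in[of "Suc i" k] \<open>i < Suc k\<close> by (intro K(2)) auto
        from parts_integral_error_second_moment[OF p0 f f' less_imp_le[OF K(1)] this, of i]
        show ?thesis unfolding E_def by (simp add: pS)
      qed
      have "AE \<omega> in M. (norm (elementary_integral W (Suc k) (p k) (c k) \<omega> - parts_integral f f' t s \<omega> *\<^sub>R g))\<^sup>2
          \<le> (norm g)\<^sup>2 * (real (Suc k) * (\<Sum>i<Suc k. (E i \<omega>)\<^sup>2))"
        using AE_cont_W_eq AE_space
      proof eventually_elim
        case (elim \<omega>)
        have "elementary_integral W (Suc k) (p k) (c k) \<omega> - parts_integral f f' t s \<omega> *\<^sub>R g
            = (\<Sum>i<Suc k. E i \<omega>) *\<^sub>R g"
          unfolding elementary_integral_def c_def E_def sum_subtractf sum_parts_integral[OF e ts(1) elim(2) f']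
            scaleR_diff_left[of "sum _ _"] scaleR_sum_left
          using elim(1) by (simp add: mult.commute del: sum.lessThan_Suc)
        moreover have "(\<Sum>i<Suc k. E i \<omega>)\<^sup>2 \<le> real (Suc k) * (\<Sum>i<Suc k. (E i \<omega>)\<^sup>2)"
          using sum_squared_le_sum_of_squares[of "\<lambda>i. E i \<omega>" "{..<Suc k}"] by (simp only: card_lessThan mult.commute)
        ultimately show ?case
          by (simp add: power_mult_distrib mult.commute mult_left_mono del: sum.lessThan_Suc of_nat_Suc)
      qed
      then have "(\<integral>\<^sup>+\<omega>. ennreal ((norm (elementary_integral W (Suc k) (p k) (c k) \<omega> - parts_integral f f' t s \<omega> *\<^sub>R g))\<^sup>2) \<partial>M)
          \<le> (\<integral>\<^sup>+\<omega>. ennreal ((norm g)\<^sup>2 * real (Suc k)) * (\<Sum>i<Suc k. ennreal ((E i \<omega>)\<^sup>2)) \<partial>M)"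
        by (intro nn_integral_mono_AE) (auto elim!: eventually_mono
            simp: sum_ennreal ennreal_mult[symmetric] sum_nonneg mult.assoc ennreal_leI simp del: sum.lessThan_Suc of_nat_Suc)
      also have "\<dots> = ennreal ((norm g)\<^sup>2 * real (Suc k)) * (\<Sum>i<Suc k. \<integral>\<^sup>+\<omega>. ennreal ((E i \<omega>)\<^sup>2) \<partial>M)"
        by (subst nn_integral_cmult, measurable, subst nn_integral_sum) simp_all
      also have "\<dots> \<le> ennreal ((norm g)\<^sup>2 * real (Suc k)) * (\<Sum>i<Suc k. ennreal (K\<^sup>2 * \<delta> k ^ 3))"
        using E by (intro mult_left_mono sum_mono) auto
      also have "\<dots> = ennreal ((norm g)\<^sup>2 * real (Suc k) * (real (Suc k) * (K\<^sup>2 * \<delta> k ^ 3)))"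
        using \<delta>(1)[of k] by (simp add: ennreal_mult ennreal_of_nat_eq_real_of_nat del: of_nat_Suc)
      also have "(norm g)\<^sup>2 * real (Suc k) * (real (Suc k) * (K\<^sup>2 * \<delta> k ^ 3))
          = (norm g)\<^sup>2 * (K\<^sup>2 * (real (Suc k) * \<delta> k)\<^sup>2 * \<delta> k)"
        by (simp add: power2_eq_square power3_eq_cube del: of_nat_Suc)
      finally show ?thesis unfolding \<delta>(2) .
    qed
    then show "\<forall>\<^sub>F k in sequentially. (\<integral>\<^sup>+\<omega>. ennreal ((norm (elementary_integral W (Suc k) (p k) (c k) \<omega> - parts_integral f f' t s \<omega> *\<^sub>R g))\<^sup>2) \<partial>M)
        \<le> ennreal ((norm g)\<^sup>2 * (K\<^sup>2 * (s - t)\<^sup>2 * \<delta> k))" by simp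
  qed simp
  show ?thesis
    unfolding has_ito_integral_def
  proof (intro conjI exI[of _ Suc] exI[of _ p] exI[of _ c] allI)
    show "progressive F t s (\<lambda>\<rho> \<omega>. f \<rho> *\<^sub>R g)" by (rule progressive_deterministic) measurable
    show "(\<lambda>\<omega>. parts_integral f f' t s \<omega> *\<^sub>R g) \<in> borel_measurable M" by measurable
  qed (rule e proc int)+
qed

end

section \<open>Mild solutions\<close>

lemma square_integrable_ctrl_b1_scaleR:
  "square_integrable (\<lambda>\<xi>. rep_L2 (ctrl_b1 P) \<xi> *\<^sub>R (q :: real^2))"
proof (rule square_integrable_bound)
  have [measurable]: "rep_L2 (ctrl_b1 P) \<in> borel_measurable borel"
    by (rule square_integrable_measurable[OF square_integrable_rep])
  show "integrable lborel (\<lambda>\<xi>. (norm (rep_L2 (ctrl_b1 P) \<xi>))\<^sup>2 * (norm q)\<^sup>2)"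
    by (intro integrable_mult_left square_integrable_integrable square_integrable_rep)
  show "(\<lambda>\<xi>. rep_L2 (ctrl_b1 P) \<xi> *\<^sub>R q) \<in> borel_measurable lborel" by measurable
qed (simp add: power_mult_distrib)

lemma linear_op_B: "linear (op_B P)"
proof (rule linearI)
  note sq = square_integrable_ctrl_b1_scaleR[of P]
  show "op_B P (q + q') = op_B P q + op_B P q'" for q q'
    using sq by (simp add: op_B_def scaleR_add_right L2_of_add)
  show "op_B P (c *\<^sub>R q) = c *\<^sub>R op_B P q" for c q
    using L2_of_scaleR[OF sq[of q], of c] by (simp add: op_B_def mult.commute)
qed

text \<open>The support condition allows to extend the integral in \<open>op_B_adj\<close> from \<open>[-d, 0]\<close> to the whole line,
  where it is an inner product of classes.\<close>

lemma op_B_adj_duality: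
  assumes supp: "ctrl_b1 P \<in> supported_L2 {- delay P..0}"
  shows "op_B_adj P y \<bullet> q = y \<bullet> op_B P q"
proof -
  let ?b = "rep_L2 (ctrl_b1 P)" and ?y = "rep_L2 (snd y)"
  have b: "AE \<xi> in lborel. \<xi> \<notin> {- delay P..0} \<longrightarrow> ?b \<xi> = 0" using supp by (simp add: supported_L2_def)
  have [measurable]: "?b \<in> borel_measurable borel" "?y \<in> borel_measurable borel"
    by (rule square_integrable_measurable[OF square_integrable_rep])+
  have "integrable lborel (\<lambda>\<xi>. \<Sum>e\<in>Basis. ((?b \<xi> *\<^sub>R e) \<bullet> ?y \<xi>) *\<^sub>R e)"
    by (intro Bochner_Integration.integrable_sum integrable_scaleR_left
        integrable_inner_square_integrable square_integrable_ctrl_b1_scaleR square_integrable_rep)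
  moreover have "(\<Sum>e\<in>Basis. ((?b \<xi> *\<^sub>R e) \<bullet> ?y \<xi>) *\<^sub>R e) = ?b \<xi> *\<^sub>R ?y \<xi>" for \<xi>
  proof -
    have "(\<Sum>e\<in>Basis. ((?b \<xi> *\<^sub>R e) \<bullet> ?y \<xi>) *\<^sub>R e) = (\<Sum>e\<in>Basis. ((?b \<xi> *\<^sub>R ?y \<xi>) \<bullet> e) *\<^sub>R e)"
      by (simp add: inner_commute)
    then show ?thesis by (simp only: euclidean_representation)
  qed
  ultimately have int: "integrable lborel (\<lambda>\<xi>. ?b \<xi> *\<^sub>R ?y \<xi>)" by simp
  have "(LINT \<xi>:{- delay P..0}|lborel. ?b \<xi> *\<^sub>R ?y \<xi>) = (LINT \<xi>|lborel. ?b \<xi> *\<^sub>R ?y \<xi>)"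
    unfolding set_lebesgue_integral_def
    by (rule integral_cong_AE) (measurable, use b in eventually_elim, auto)
  moreover have "(LINT \<xi>|lborel. ?b \<xi> *\<^sub>R ?y \<xi>) \<bullet> q = snd y \<bullet> L2_of (\<lambda>\<xi>. ?b \<xi> *\<^sub>R q)"
  proof -
    have "(LINT \<xi>|lborel. ?b \<xi> *\<^sub>R ?y \<xi>) \<bullet> q = (LINT \<xi>|lborel. (?b \<xi> *\<^sub>R ?y \<xi>) \<bullet> q)"
      by (rule integral_inner_left[symmetric]) (rule int)
    also have "\<dots> = (LINT \<xi>|lborel. ?y \<xi> \<bullet> (?b \<xi> *\<^sub>R q))" by simp
    also have "\<dots> = L2_of ?y \<bullet> L2_of (\<lambda>\<xi>. ?b \<xi> *\<^sub>R q)"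
      by (simp only: inner_L2_of square_integrable_ctrl_b1_scaleR square_integrable_rep)
    finally show ?thesis by (simp add: L2_of_rep)
  qed
  ultimately show ?thesis
    by (simp add: op_B_adj_def op_B_def inner_prod_def inner_add_left)
qed

definition ctrl_response :: "lq_data \<Rightarrow> real \<Rightarrow> real^2 \<Rightarrow> hilb" where
  "ctrl_response P \<tau> q = semigroup_A P \<tau> (op_B P q)"

lemma ctrl_response_expand:
  "ctrl_response P \<tau> q = (\<Sum>e\<in>Basis. (q \<bullet> e) *\<^sub>R semigroup_A P \<tau> (op_B P e))"
proof -
  have lin: "linear (\<lambda>q. semigroup_A P \<tau> (op_B P q))"
    using linear_compose[OF linear_op_B linear_semigroup_A] by (simp add: comp_def)
  have "semigroup_A P \<tau> (op_B P (\<Sum>e\<in>Basis. (q \<bullet> e) *\<^sub>R e)) = (\<Sum>e\<in>Basis. (q \<bullet> e) *\<^sub>R semigroup_A P \<tau> (op_B P e))"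
    by (simp only: linear_sum[OF lin] linear_scale[OF lin])
  then show ?thesis by (simp add: ctrl_response_def euclidean_representation)
qed

lemma measurable_ctrl_response [measurable (raw)]:
  assumes [measurable]: "f \<in> borel_measurable N" "g \<in> borel_measurable N"
  shows "(\<lambda>x. ctrl_response P (f x) (g x)) \<in> borel_measurable N"
proof -
  have [measurable]: "(\<lambda>x. semigroup_A P (f x) (op_B P e)) \<in> borel_measurable N" for e
    by (rule measurable_compose[OF assms(1) measurable_semigroup_A])
  show ?thesis unfolding ctrl_response_expand by measurable
qed

lemma ctrl_vec_eq: "ctrl_vec uz s \<omega> = fst uz s \<omega> *\<^sub>R axis 1 1 + snd uz s \<omega> *\<^sub>R axis 2 1"
  by (simp add: ctrl_vec_def vec_eq_iff forall_2 axis_def)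

context brownian begin

lemma progressive_ctrl_vec:
  assumes "fst uz \<in> controls P M W" "snd uz \<in> controls P M W" "0 \<le> t"
  shows "progressive F t (horizon P) (ctrl_vec uz)"
proof -
  have "progressive F t (horizon P) (fst uz)" "progressive F t (horizon P) (snd uz)"
    using assms by (auto simp: controls_def intro: progressive_subinterval)
  then have "progressive F t (horizon P) (\<lambda>s \<omega>. fst uz s \<omega> *\<^sub>R axis 1 1 + snd uz s \<omega> *\<^sub>R (axis 2 1 :: real^2))"
    by (intro progressive_add progressive_compose[where K="\<lambda>\<rho> x. x *\<^sub>R _"]) measurable
  then show ?thesis by (simp add: ctrl_vec_eq[abs_def])
qed

text \<open>Every term of the mild equation has an explicit progressive version. For the kernel
  \<open>k \<tau> = e\<^bsup>a\<tau>\<^esup>\<close>, where \<open>a\<close> is the drift coefficient \<open>a\<^sub>0\<close>, integration by parts turns the stochastic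
  convolution into \<open>W s - k (s - t) W t\<close> plus \<open>a\<close> times the integral of \<open>k (s - \<rho>) W \<rho>\<close> over \<open>[t, s]\<close>. Existence
  for every control matters: the objective is defined by choosing some mild solution.\<close>

lemma mild_solution_exists:
  assumes u: "fst uz \<in> controls P M W" "snd uz \<in> controls P M W" and t: "0 \<le> t"
  shows "\<exists>Y. mild_solution P M W t y uz Y"
proof -
  define k where "k \<tau> = exp (\<tau> * drift_a0 P)" for \<tau>
  have [measurable]: "k \<in> borel_measurable borel" unfolding k_def by measurable
  define J where "J s = parts_integral (\<lambda>\<rho>. k (s - \<rho>)) (\<lambda>\<rho>. - drift_a0 P * k (s - \<rho>)) t s" for s
  define Y where "Y s \<omega> = semigroup_A P (s - t) y
      + (LINT \<rho>:{t..s}|lborel. ctrl_response P (s - \<rho>) (ctrl_vec uz \<rho> \<omega>)) + J s \<omega> *\<^sub>R op_G P 1" for s \<omega>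
  have "mild_solution P M W t y uz Y"
    unfolding mild_solution_def
  proof (intro conjI ballI exI)
    have "progressive F t (horizon P) (\<lambda>s \<omega>. LINT \<rho>:{t..s}|lborel. - drift_a0 P * k (s - \<rho>) * cont_W \<rho> \<omega>)"
      by (rule progressive_convolution[OF progressive_cont_W[OF t], where K="\<lambda>s \<rho> x. - drift_a0 P * k (s - \<rho>) * x"],
        unfold split_beta' split_beta, measurable)
    then have "progressive F t (horizon P) (\<lambda>s \<omega>. - 1 * (LINT \<rho>:{t..s}|lborel. - drift_a0 P * k (s - \<rho>) * cont_W \<rho> \<omega>))"
      by (rule progressive_compose[where K="\<lambda>\<rho> x. - 1 * x"]) measurable
    moreover have "progressive F t (horizon P) (\<lambda>s \<omega>. (- 1 * k (s - t)) * cont_W t \<omega>)"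
      by (rule progressive_compose[OF progressive_const[OF cont_W_adapted[OF t]], where K="\<lambda>\<rho> x. (- 1 * k (\<rho> - t)) * x"]) measurable
    moreover note progressive_cont_W[OF t, of "horizon P"]
    ultimately have "progressive F t (horizon P) (\<lambda>s \<omega>. cont_W s \<omega> + (- 1 * k (s - t)) * cont_W t \<omega>
        + - 1 * (LINT \<rho>:{t..s}|lborel. - drift_a0 P * k (s - \<rho>) * cont_W \<rho> \<omega>))"
      by (intro progressive_add)
    moreover have "J = (\<lambda>s \<omega>. cont_W s \<omega> + (- 1 * k (s - t)) * cont_W t \<omega>
        + - 1 * (LINT \<rho>:{t..s}|lborel. - drift_a0 P * k (s - \<rho>) * cont_W \<rho> \<omega>))"
      by (intro ext) (simp add: J_def parts_integral_def k_def)
    ultimately have "progressive F t (horizon P) J" by (simp only: )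
    then have "progressive F t (horizon P) (\<lambda>s \<omega>. J s \<omega> *\<^sub>R op_G P 1)"
      by (rule progressive_compose[where K="\<lambda>\<rho> x. x *\<^sub>R op_G P 1"]) measurable
    moreover have "progressive F t (horizon P) (\<lambda>s \<omega>. semigroup_A P (s - t) y)"
      by (rule progressive_deterministic) measurable
    moreover have "progressive F t (horizon P)
        (\<lambda>s \<omega>. LINT \<rho>:{t..s}|lborel. ctrl_response P (s - \<rho>) (ctrl_vec uz \<rho> \<omega>))"
      by (rule progressive_convolution[OF progressive_ctrl_vec[OF u t], where K="\<lambda>s \<rho> x. ctrl_response P (s - \<rho>) x"],
        unfold split_beta' split_beta, measurable)
    ultimately show "progressive F t (horizon P) Y"
      unfolding Y_def[abs_def] by (intro progressive_add)
  next
    fix s assume s: "s \<in> {t..horizon P}"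
    show "has_ito_integral M F W t s (\<lambda>\<rho> \<omega>. semigroup_A P (s - \<rho>) (op_G P 1)) (\<lambda>\<omega>. J s \<omega> *\<^sub>R op_G P 1)"
      unfolding semigroup_A_op_G J_def k_def using s t
      by (intro has_ito_integral_C1) (auto intro!: derivative_eq_intros continuous_intros)
    show "AE \<omega> in M. Y s \<omega> = semigroup_A P (s - t) y
        + (LINT \<rho>:{t..s}|lborel. semigroup_A P (s - \<rho>) (op_B P (ctrl_vec uz \<rho> \<omega>))) + J s \<omega> *\<^sub>R op_G P 1"
      by (simp add: Y_def ctrl_response_def)
  qed
  then show ?thesis by blast
qed

end

section \<open>The response of the state to the control\<close>

lemma op_B_norm_le:
  obtains K where "K \<ge> 0" "\<And>q. norm (op_B P q) \<le> K * norm q"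
proof (rule that[of "\<Sum>e\<in>(Basis :: (real^2) set). norm (op_B P e)"])
  fix q :: "real^2"
  have "op_B P q = op_B P (\<Sum>e\<in>Basis. (q \<bullet> e) *\<^sub>R e)" by (simp add: euclidean_representation)
  also have "\<dots> = (\<Sum>e\<in>Basis. (q \<bullet> e) *\<^sub>R op_B P e)"
    by (simp only: linear_sum[OF linear_op_B] linear_scale[OF linear_op_B])
  also have "norm \<dots> \<le> (\<Sum>e\<in>Basis. norm (op_B P e) * norm q)"
  proof (rule sum_norm_le)
    fix e :: "real^2" assume "e \<in> Basis"
    then have "\<bar>q \<bullet> e\<bar> \<le> norm q" by (rule Basis_le_norm)
    then show "norm ((q \<bullet> e) *\<^sub>R op_B P e) \<le> norm (op_B P e) * norm q"
      using mult_right_mono[OF _ norm_ge_zero] by (simp add: mult.commute)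
  qed
  finally show "norm (op_B P q) \<le> (\<Sum>e\<in>(Basis :: (real^2) set). norm (op_B P e)) * norm q"
    by (simp add: sum_distrib_right)
qed (simp add: sum_nonneg)

lemma ctrl_response_norm_le:
  obtains K where "K \<ge> 0" "\<And>\<tau> q. \<tau> \<in> {0..T} \<Longrightarrow> norm (ctrl_response P \<tau> q) \<le> K * norm q"
proof -
  obtain K1 where K1: "K1 \<ge> 0" "\<And>\<tau> y. \<tau> \<in> {0..T} \<Longrightarrow> norm (semigroup_A P \<tau> y) \<le> K1 * norm y"
    using semigroup_A_bounded[of T P] by blast
  obtain K2 where K2: "K2 \<ge> 0" "\<And>q. norm (op_B P q) \<le> K2 * norm q" using op_B_norm_le by blast
  show thesis
  proof (rule that[of "K1 * K2"])
    fix \<tau> q assume "\<tau> \<in> {0..T}"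
    then have "norm (ctrl_response P \<tau> q) \<le> K1 * norm (op_B P q)" unfolding ctrl_response_def by (rule K1)
    also have "\<dots> \<le> K1 * (K2 * norm q)" by (intro mult_left_mono K1 K2)
    finally show "norm (ctrl_response P \<tau> q) \<le> K1 * K2 * norm q" by (simp add: mult.assoc)
  qed (use K1 K2 in simp)
qed

text \<open>For \<open>b\<^sub>1\<close> supported in \<open>[-d, 0]\<close> this is \<open>B* e\<^bsup>\<tau>A*\<^esup>(w, 0)\<close>: the effect on \<open>\<langle>w, Y\<^sub>0\<rangle>\<close>, after the time \<open>\<tau>\<close>, of a unit impulse of each of
  the two controls.\<close>

definition adj_response :: "lq_data \<Rightarrow> real^2 \<Rightarrow> real \<Rightarrow> real^2" where
  "adj_response P w \<tau> = (\<Sum>e\<in>Basis. (w \<bullet> fst (ctrl_response P \<tau> e)) *\<^sub>R e)"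

lemma adj_response_inner: "adj_response P w \<tau> \<bullet> q = w \<bullet> fst (ctrl_response P \<tau> q)"
proof -
  have "w \<bullet> fst (ctrl_response P \<tau> q) = (\<Sum>e\<in>Basis. (q \<bullet> e) * (w \<bullet> fst (ctrl_response P \<tau> e)))"
    by (subst (1) ctrl_response_expand) (simp add: ctrl_response_def fst_sum inner_sum_right)
  also have "\<dots> = adj_response P w \<tau> \<bullet> q"
    by (simp add: adj_response_def inner_sum_left) (simp add: inner_commute mult.commute)
  finally show ?thesis ..
qed

lemma adj_response_inner': "adj_response P w \<tau> \<bullet> q = semigroup_A_adj P \<tau> (w, 0) \<bullet> op_B P q"
  by (simp add: adj_response_inner ctrl_response_def semigroup_A_duality)

lemma measurable_adj_response [measurable]: "adj_response P w \<in> borel_measurable borel"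
proof -
  have [measurable]: "(\<lambda>\<tau>. fst (ctrl_response P \<tau> e)) \<in> borel_measurable borel" for e
    by (rule measurable_compose[OF _ borel_measurable_continuous_onI[OF continuous_on_fst[OF continuous_on_id]]]) measurable
  show ?thesis unfolding adj_response_def[abs_def] by measurable
qed

lemma adj_response_inner_le:
  obtains K where "K \<ge> 0" "\<And>\<tau> q. \<tau> \<in> {0..T} \<Longrightarrow> \<bar>adj_response P w \<tau> \<bullet> q\<bar> \<le> K * norm q"
proof -
  obtain K where K: "K \<ge> 0" "\<And>\<tau> q. \<tau> \<in> {0..T} \<Longrightarrow> norm (ctrl_response P \<tau> q) \<le> K * norm q"
    using ctrl_response_norm_le[of T P] by blast
  show thesis
  proof (rule that[of "norm w * K"])
    fix \<tau> q assume \<tau>: "\<tau> \<in> {0..T}"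
    have "\<bar>adj_response P w \<tau> \<bullet> q\<bar> \<le> norm w * norm (fst (ctrl_response P \<tau> q))"
      unfolding adj_response_inner by (rule Cauchy_Schwarz_ineq2)
    also have "\<dots> \<le> norm w * (K * norm q)"
      using order_trans[OF _ K(2)[OF \<tau>], of "norm (fst (ctrl_response P \<tau> q))" q]
      by (intro mult_left_mono) (auto simp: norm_prod_def)
    finally show "\<bar>adj_response P w \<tau> \<bullet> q\<bar> \<le> norm w * K * norm q" by (simp add: mult.assoc)
  qed (use K in simp)
qed

lemma discounted_adj_integrable:
  "set_integrable lborel {t..T} (\<lambda>s. exp (- r * (s - t)) *\<^sub>R semigroup_A_adj P (s - t) (w, 0))"
proof -
  obtain K where K: "K \<ge> 0" "\<And>\<tau>. \<tau> \<in> {0..T - t} \<Longrightarrow> norm (semigroup_A_adj P \<tau> (w, 0)) \<le> K"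
    using semigroup_A_adj_bounded[of "T - t" P w] by blast
  define E where "E = exp (\<bar>r\<bar> * \<bar>T - t\<bar>)"
  show ?thesis
    unfolding set_integrable_def
  proof (rule Bochner_Integration.integrable_bound)
    show "integrable lborel (\<lambda>s. indicator {t..T} s * (E * K))" by (rule integrable_indicator_Icc_const)
    show "(\<lambda>s. indicator {t..T} s *\<^sub>R exp (- r * (s - t)) *\<^sub>R semigroup_A_adj P (s - t) (w, 0)) \<in> borel_measurable lborel"
      by measurable
    have "exp (- r * (s - t)) * norm (semigroup_A_adj P (s - t) (w, 0)) \<le> E * K" if "s \<in> {t..T}" for s
    proof (intro mult_mono)
      have "- r * (s - t) \<le> \<bar>- r\<bar> * \<bar>s - t\<bar>" by (metis abs_ge_self abs_mult)
      also have "\<dots> \<le> \<bar>r\<bar> * \<bar>T - t\<bar>" using that by (intro mult_mono) auto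
      finally show "exp (- r * (s - t)) \<le> E" by (simp add: E_def)
    qed (use K that in \<open>auto simp: E_def\<close>)
    then show "AE s in lborel. norm (indicator {t..T} s *\<^sub>R exp (- r * (s - t)) *\<^sub>R semigroup_A_adj P (s - t) (w, 0))
        \<le> norm (indicator {t..T} s * (E * K))"
      using K by (auto simp: indicator_def E_def)
  qed
qed

lemma inner_a_fun:
  "a_fun P t \<bullet> y = exp (- rate P * (horizon P - t)) * (semigroup_A_adj P (horizon P - t) (lambda_vec P, 0) \<bullet> y)
    + (LINT s:{t..horizon P}|lborel. exp (- rate P * (s - t)) * (semigroup_A_adj P (s - t) (alpha_vec P, 0) \<bullet> y))"
proof -
  have "(LINT s:{t..horizon P}|lborel. exp (- rate P * (s - t)) *\<^sub>R semigroup_A_adj P (s - t) (alpha_vec P, 0)) \<bullet> y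
      = (LINT s|lborel. (indicator {t..horizon P} s *\<^sub>R exp (- rate P * (s - t)) *\<^sub>R semigroup_A_adj P (s - t) (alpha_vec P, 0)) \<bullet> y)"
    unfolding set_lebesgue_integral_def
    using discounted_adj_integrable[unfolded set_integrable_def] by (intro integral_inner_left[symmetric])
  then show ?thesis
    by (simp add: a_fun_def inner_add_left set_lebesgue_integral_def mult.assoc)
qed

lemma op_B_adj_a_fun:
  assumes "ctrl_b1 P \<in> supported_L2 {- delay P..0}"
  shows "op_B_adj P (a_fun P t) \<bullet> q = exp (- rate P * (horizon P - t)) * (adj_response P (lambda_vec P) (horizon P - t) \<bullet> q)
    + (LINT s:{t..horizon P}|lborel. exp (- rate P * (s - t)) * (adj_response P (alpha_vec P) (s - t) \<bullet> q))"
  by (simp add: op_B_adj_duality[OF assms] inner_a_fun adj_response_inner')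

lemma measurable_op_B_adj_a_fun:
  assumes "ctrl_b1 P \<in> supported_L2 {- delay P..0}"
  shows "(\<lambda>t. op_B_adj P (a_fun P t)) \<in> borel_measurable borel"
proof -
  have 1: "(\<lambda>t. op_B_adj P (a_fun P t) \<bullet> q) \<in> borel_measurable borel" for q
  proof -
    have "(\<lambda>(t, s). (if t \<le> s \<and> s \<le> horizon P then exp (- rate P * (s - t)) * (adj_response P (alpha_vec P) (s - t) \<bullet> q) else 0))
        \<in> borel_measurable (borel \<Otimes>\<^sub>M lborel)"
      by measurable
    note [measurable] = lborel.borel_measurable_lebesgue_integral[OF this]
    have "(LINT s:{t..horizon P}|lborel. exp (- rate P * (s - t)) * (adj_response P (alpha_vec P) (s - t) \<bullet> q))
        = (LINT s|lborel. (if t \<le> s \<and> s \<le> horizon P then exp (- rate P * (s - t)) * (adj_response P (alpha_vec P) (s - t) \<bullet> q) else 0))" for t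
      unfolding set_lebesgue_integral_def by (intro Bochner_Integration.integral_cong) auto
    then show ?thesis unfolding op_B_adj_a_fun[OF assms] by simp
  qed
  have "op_B_adj P (a_fun P t) = (\<Sum>e\<in>Basis. (op_B_adj P (a_fun P t) \<bullet> e) *\<^sub>R e)" for t
    by (rule euclidean_representation[symmetric])
  then have "(\<lambda>t. op_B_adj P (a_fun P t)) = (\<lambda>t. \<Sum>e\<in>Basis. (op_B_adj P (a_fun P t) \<bullet> e) *\<^sub>R e)"
    by (intro ext)
  also have "\<dots> \<in> borel_measurable borel"
    by (intro borel_measurable_sum borel_measurable_scaleR 1) simp
  finally show ?thesis .
qed

lemma discount_le:
  fixes r :: real
  assumes "0 \<le> t" "t \<le> s" "s \<le> T"
  shows "exp (- r * (s - t)) \<le> exp (\<bar>r\<bar> * T)"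
proof -
  have "- r * (s - t) \<le> \<bar>- r\<bar> * \<bar>s - t\<bar>" by (metis abs_ge_self abs_mult)
  also have "\<dots> \<le> \<bar>r\<bar> * T" using assms by (intro mult_mono) auto
  finally show ?thesis by simp
qed

lemma op_B_adj_a_fun_bounded:
  assumes "ctrl_b1 P \<in> supported_L2 {- delay P..0}"
  obtains K where "K \<ge> 0" "\<And>t q. t \<in> {0..horizon P} \<Longrightarrow> \<bar>op_B_adj P (a_fun P t) \<bullet> q\<bar> \<le> K * norm q"
proof -
  let ?T = "horizon P"
  obtain K1 where K1: "K1 \<ge> 0" "\<And>\<tau> q. \<tau> \<in> {0..?T} \<Longrightarrow> \<bar>adj_response P (lambda_vec P) \<tau> \<bullet> q\<bar> \<le> K1 * norm q"
    using adj_response_inner_le[of ?T P "lambda_vec P"] by blast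
  obtain K2 where K2: "K2 \<ge> 0" "\<And>\<tau> q. \<tau> \<in> {0..?T} \<Longrightarrow> \<bar>adj_response P (alpha_vec P) \<tau> \<bullet> q\<bar> \<le> K2 * norm q"
    using adj_response_inner_le[of ?T P "alpha_vec P"] by blast
  define E where "E = exp (\<bar>rate P\<bar> * ?T)"
  have E: "E > 0" by (simp add: E_def)
  show thesis
  proof (rule that[of "E * K1 + \<bar>?T\<bar> * (E * K2)"])
    fix t and q :: "real^2" assume t: "t \<in> {0..?T}"
    have "exp (- rate P * (?T - t)) * \<bar>adj_response P (lambda_vec P) (?T - t) \<bullet> q\<bar> \<le> E * (K1 * norm q)"
      unfolding E_def using t K1 by (intro mult_mono discount_le) auto
    then have 1: "\<bar>exp (- rate P * (?T - t)) * (adj_response P (lambda_vec P) (?T - t) \<bullet> q)\<bar> \<le> E * (K1 * norm q)"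
      by (simp add: abs_mult)
    have "\<bar>LINT s:{t..?T}|lborel. exp (- rate P * (s - t)) * (adj_response P (alpha_vec P) (s - t) \<bullet> q)\<bar>
        \<le> (LINT s|lborel. indicator {t..?T} s * (E * (K2 * norm q)))"
      unfolding set_lebesgue_integral_def
    proof (rule order_trans[OF integral_abs_bound], rule integral_mono_AE')
      have "exp (- rate P * (s - t)) * \<bar>adj_response P (alpha_vec P) (s - t) \<bullet> q\<bar> \<le> E * (K2 * norm q)" if "s \<in> {t..?T}" for s
        unfolding E_def using t K2 that by (intro mult_mono discount_le) auto
      then show "AE s in lborel. \<bar>indicator {t..?T} s *\<^sub>R (exp (- rate P * (s - t)) * (adj_response P (alpha_vec P) (s - t) \<bullet> q))\<bar>
          \<le> indicator {t..?T} s * (E * (K2 * norm q))"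
        using K2(1) E by (auto simp: indicator_def abs_mult)
      show "integrable lborel (\<lambda>s. indicator {t..?T} s * (E * (K2 * norm q)))"
        by (rule integrable_indicator_Icc_const)
    qed (use K2(1) E in auto)
    also have "\<dots> = (?T - t) * (E * (K2 * norm q))" using t by simp
    also have "\<dots> \<le> \<bar>?T\<bar> * (E * (K2 * norm q))" using t E K2 by (intro mult_right_mono) auto
    finally have "\<bar>op_B_adj P (a_fun P t) \<bullet> q\<bar> \<le> E * (K1 * norm q) + \<bar>?T\<bar> * (E * (K2 * norm q))"
      unfolding op_B_adj_a_fun[OF assms] by (intro order_trans[OF abs_triangle_ineq add_mono[OF 1]])
    then show "\<bar>op_B_adj P (a_fun P t) \<bullet> q\<bar> \<le> (E * K1 + \<bar>?T\<bar> * (E * K2)) * norm q"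
      by (simp add: algebra_simps)
  qed (use K1 K2 E in simp)
qed

section \<open>The mean of the state\<close>

lemma (in finite_measure) integrable_pair_snd:
  fixes g :: "'b \<Rightarrow> 'c::{banach, second_countable_topology}"
  assumes N: "sigma_finite_measure N" and g: "integrable N g"
  shows "integrable (M \<Otimes>\<^sub>M N) (\<lambda>x. g (snd x))"
proof -
  interpret N: sigma_finite_measure N by fact
  interpret pair_sigma_finite M N ..
  show ?thesis
    by (rule Fubini_integrable) (use g in simp_all)
qed

locale lq_problem = brownian M W for M :: "'a measure" and W +
  fixes P :: lq_data
  assumes horizon_pos: "0 < horizon P"
    and ctrl_b1_supported: "ctrl_b1 P \<in> supported_L2 {- delay P..0}"
    and gamma_pos: "0 < gamma0 P" "0 < gamma1 P"
begin

abbreviation "T \<equiv> horizon P"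
abbreviation "L \<equiv> restrict_space lborel {0..T}"
abbreviation "Q \<equiv> L \<Otimes>\<^sub>M M"

sublocale L: finite_measure L
  by (rule finite_measureI) (use horizon_pos in \<open>simp add: emeasure_restrict_space space_restrict_space\<close>)

sublocale LM: pair_sigma_finite L M ..

sublocale Q: finite_measure Q
  by (rule finite_measure_pair_measure) (unfold_locales)

lemma set_integral_eq_L:
  fixes f :: "real \<Rightarrow> 'b::{banach, second_countable_topology}"
  assumes "A \<subseteq> {0..T}"
  shows "(LINT s:A|lborel. f s) = (LINT s|L. indicator A s *\<^sub>R f s)"
  unfolding set_lebesgue_integral_def
  by (subst integral_restrict_space) (use assms in \<open>auto intro!: Bochner_Integration.integral_cong simp: indicator_def\<close>)

lemma measurable_on_L: "f \<in> borel_measurable borel \<Longrightarrow> f \<in> borel_measurable L"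
  by (rule measurable_restrict_space1) simp

lemma measurable_fst_Q [measurable]: "fst \<in> borel_measurable Q"
  by (rule measurable_compose[OF measurable_fst measurable_on_L]) simp

lemma space_L [simp]: "s \<in> space L \<longleftrightarrow> s \<in> {0..T}"
  by (simp add: space_restrict_space)

lemma progressive_indicator_measurable:
  fixes X :: "real \<Rightarrow> 'a \<Rightarrow> 'b::real_normed_vector"
  assumes X: "progressive F t T X" and t: "0 \<le> t" "t \<le> T"
    and [measurable]: "(\<lambda>(s, x). g s x) \<in> borel_measurable (borel \<Otimes>\<^sub>M borel)"
  shows "(\<lambda>(s, \<omega>). indicator {t..T} s *\<^sub>R (g s (X s \<omega>) :: real)) \<in> borel_measurable Q"
proof -
  have "(\<lambda>\<omega>. \<omega>) \<in> measurable M (F T)"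
    using t by (intro measurable_F_M[of T]) auto
  then have "(\<lambda>x. (fst x, snd x)) \<in> measurable Q (borel \<Otimes>\<^sub>M F T)"
    by (intro measurable_Pair measurable_fst_Q measurable_compose[OF measurable_snd])
  from measurable_compose[OF this progressive_clamp[OF X, of T]] t
  have [measurable]: "(\<lambda>x. X (max t (min T (fst x))) (snd x)) \<in> borel_measurable Q" by simp
  have "(\<lambda>x. indicator {t..T} (fst x) *\<^sub>R g (fst x) (X (max t (min T (fst x))) (snd x))) \<in> borel_measurable Q"
    by measurable
  then show ?thesis
    by (rule measurable_cong[THEN iffD1, rotated]) (auto simp: indicator_def)
qed

lemma controls_integrable:
  assumes "u \<in> controls P M W"
  shows "integrable Q (\<lambda>(s, \<omega>). u s \<omega>)" "integrable Q (\<lambda>(s, \<omega>). (u s \<omega>)\<^sup>2)"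
proof -
  have m: "(\<lambda>(s, \<omega>). u s \<omega>) \<in> borel_measurable Q"
    using assms horizon_pos by (intro progressive_measurable_product) (auto simp: controls_def)
  show 2: "integrable Q (\<lambda>(s, \<omega>). (u s \<omega>)\<^sup>2)" using assms by (simp add: controls_def)
  show "integrable Q (\<lambda>(s, \<omega>). u s \<omega>)"
    by (rule Q.square_integrable_imp_integrable[OF m]) (use 2 in \<open>simp add: split_beta'\<close>)
qed

lemma ctrl_vec_integrable:
  assumes "fst uz \<in> controls P M W" "snd uz \<in> controls P M W"
  shows "integrable Q (\<lambda>(s, \<omega>). ctrl_vec uz s \<omega>)"
  unfolding ctrl_vec_eq split_beta'
  using controls_integrable(1)[OF assms(1)] controls_integrable(1)[OF assms(2)]
  by (intro Bochner_Integration.integrable_add integrable_scaleR_left) (simp_all add: split_beta')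

definition mean_ctrl :: "'a control \<Rightarrow> real \<Rightarrow> real^2" where
  "mean_ctrl uz \<rho> = (LINT \<omega>|M. ctrl_vec uz \<rho> \<omega>)"

lemma mean_ctrl_integrable:
  assumes "fst uz \<in> controls P M W" "snd uz \<in> controls P M W"
  shows "integrable L (mean_ctrl uz)"
  unfolding mean_ctrl_def[abs_def] using LM.integrable_fst[OF ctrl_vec_integrable[OF assms]] .

lemma op_G_ito_second_moment:
  assumes "0 \<le> t" "t \<le> s" "s \<le> T"
  shows "(\<integral>\<^sup>+(\<rho>, \<omega>). ennreal ((w \<bullet> fst (semigroup_A P (s - \<rho>) (op_G P 1)))\<^sup>2) \<partial>(restrict_space lborel {t..s} \<Otimes>\<^sub>M M))
    \<le> ennreal ((exp (\<bar>drift_a0 P\<bar> * T) * (w \<bullet> fst (op_G P 1)))\<^sup>2 * T)"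
proof -
  define B where "B = exp (\<bar>drift_a0 P\<bar> * T) * \<bar>w \<bullet> fst (op_G P 1)\<bar>"
  have b: "\<bar>w \<bullet> fst (semigroup_A P (s - \<rho>) (op_G P 1))\<bar> \<le> B" if "\<rho> \<in> {t..s}" for \<rho>
  proof -
    have "exp (- (- drift_a0 P) * (s - \<rho>)) \<le> exp (\<bar>- drift_a0 P\<bar> * T)"
      using that assms by (intro discount_le) auto
    then show ?thesis
      by (simp add: semigroup_A_op_G B_def abs_mult mult_right_mono mult.commute[of "s - \<rho>"])
  qed
  have "(\<integral>\<^sup>+(\<rho>, \<omega>). ennreal ((w \<bullet> fst (semigroup_A P (s - \<rho>) (op_G P 1)))\<^sup>2) \<partial>(restrict_space lborel {t..s} \<Otimes>\<^sub>M M))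
      \<le> (\<integral>\<^sup>+(\<rho>, \<omega>). ennreal (B\<^sup>2) \<partial>(restrict_space lborel {t..s} \<Otimes>\<^sub>M M))"
  proof (rule nn_integral_mono)
    fix x assume "x \<in> space (restrict_space lborel {t..s} \<Otimes>\<^sub>M M)"
    then have "fst x \<in> {t..s}" by (auto simp: space_pair_measure space_restrict_space)
    from power_mono[OF b[OF this] abs_ge_zero, of 2]
    show "(case x of (\<rho>, \<omega>) \<Rightarrow> ennreal ((w \<bullet> fst (semigroup_A P (s - \<rho>) (op_G P 1)))\<^sup>2)) \<le> (case x of (\<rho>, \<omega>) \<Rightarrow> ennreal (B\<^sup>2))"
      by (simp add: split_beta ennreal_leI)
  qed
  also have "\<dots> = (\<integral>\<^sup>+\<rho>. ennreal (B\<^sup>2) \<partial>restrict_space lborel {t..s})"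
    by (rule nn_integral_deterministic_product) simp
  also have "\<dots> = ennreal (B\<^sup>2 * (s - t))"
    using assms by (simp add: emeasure_restrict_space space_restrict_space ennreal_mult)
  also have "\<dots> \<le> ennreal (B\<^sup>2 * T)"
    using assms by (intro ennreal_leI mult_left_mono) auto
  finally show ?thesis by (simp add: B_def power_mult_distrib)
qed

text \<open>The mild equation tested against \<open>(w, 0)\<close>. Almost every path of a square integrable control is
  integrable in time, so the functional may be taken under the Bochner integral.\<close>

lemma state_response:
  assumes u: "fst uz \<in> controls P M W" "snd uz \<in> controls P M W" and s: "0 \<le> t" "t \<le> s" "s \<le> T"
    and I: "AE \<omega> in M. X \<omega> = semigroup_A P (s - t) y
           + (LINT \<rho>:{t..s}|lborel. semigroup_A P (s - \<rho>) (op_B P (ctrl_vec uz \<rho> \<omega>))) + I \<omega>"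
  shows "AE \<omega> in M. w \<bullet> fst (X \<omega>) = semigroup_A_adj P (s - t) (w, 0) \<bullet> y
     + (LINT \<rho>|L. indicator {t..s} \<rho> * (adj_response P w (s - \<rho>) \<bullet> ctrl_vec uz \<rho> \<omega>)) + w \<bullet> fst (I \<omega>)"
  using I LM.AE_integrable_snd[OF ctrl_vec_integrable[OF u]]
proof eventually_elim
  case (elim \<omega>)
  obtain K where K: "K \<ge> 0" "\<And>\<tau> q. \<tau> \<in> {0..T} \<Longrightarrow> norm (ctrl_response P \<tau> q) \<le> K * norm q"
    using ctrl_response_norm_le[of T P] by blast
  have [measurable]: "(\<lambda>\<rho>. ctrl_vec uz \<rho> \<omega>) \<in> borel_measurable L" using elim(2) by simp
  have [measurable]: "(\<lambda>\<rho>. \<rho>) \<in> borel_measurable L" by (rule measurable_on_L) simp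
  have int: "integrable L (\<lambda>\<rho>. indicator {t..s} \<rho> *\<^sub>R ctrl_response P (s - \<rho>) (ctrl_vec uz \<rho> \<omega>))"
  proof (rule Bochner_Integration.integrable_bound)
    show "integrable L (\<lambda>\<rho>. K * norm (ctrl_vec uz \<rho> \<omega>))" using elim(2) by simp
    show "(\<lambda>\<rho>. indicator {t..s} \<rho> *\<^sub>R ctrl_response P (s - \<rho>) (ctrl_vec uz \<rho> \<omega>)) \<in> borel_measurable L"
      by measurable
    show "AE \<rho> in L. norm (indicator {t..s} \<rho> *\<^sub>R ctrl_response P (s - \<rho>) (ctrl_vec uz \<rho> \<omega>)) \<le> norm (K * norm (ctrl_vec uz \<rho> \<omega>))"
      using K s by (intro AE_I2) (auto simp: indicator_def)
  qed
  have "w \<bullet> fst (LINT \<rho>:{t..s}|lborel. semigroup_A P (s - \<rho>) (op_B P (ctrl_vec uz \<rho> \<omega>)))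
      = w \<bullet> fst (LINT \<rho>|L. indicator {t..s} \<rho> *\<^sub>R ctrl_response P (s - \<rho>) (ctrl_vec uz \<rho> \<omega>))"
    unfolding ctrl_response_def using s by (subst set_integral_eq_L) auto
  also have "\<dots> = (LINT \<rho>|L. w \<bullet> fst (indicator {t..s} \<rho> *\<^sub>R ctrl_response P (s - \<rho>) (ctrl_vec uz \<rho> \<omega>)))"
    by (rule integral_bounded_linear[OF bounded_linear_compose[OF bounded_linear_inner_right bounded_linear_fst] int, symmetric])
  also have "\<dots> = (LINT \<rho>|L. indicator {t..s} \<rho> * (adj_response P w (s - \<rho>) \<bullet> ctrl_vec uz \<rho> \<omega>))"
    by (simp add: adj_response_inner)
  finally show ?case
    unfolding elim(1) by (simp add: inner_add_right semigroup_A_duality)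
qed

text \<open>Fubini gives the mean of the control term, and the Ito term has mean zero. The bound on the
  absolute moments is uniform in \<open>s\<close>, which makes the state integrable jointly in time and chance.\<close>

lemma state_mean:
  assumes u: "fst uz \<in> controls P M W" "snd uz \<in> controls P M W" and t: "0 \<le> t"
    and Y: "mild_solution P M W t y uz Y"
  obtains C where "\<And>s. s \<in> {t..T} \<Longrightarrow> integrable M (\<lambda>\<omega>. w \<bullet> fst (Y s \<omega>))"
    "\<And>s. s \<in> {t..T} \<Longrightarrow> expectation (\<lambda>\<omega>. w \<bullet> fst (Y s \<omega>)) = semigroup_A_adj P (s - t) (w, 0) \<bullet> y
     + (LINT \<rho>|L. indicator {t..s} \<rho> * (adj_response P w (s - \<rho>) \<bullet> mean_ctrl uz \<rho>))"
    "\<And>s. s \<in> {t..T} \<Longrightarrow> expectation (\<lambda>\<omega>. \<bar>w \<bullet> fst (Y s \<omega>)\<bar>) \<le> C"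
proof -
  obtain K where K: "K \<ge> 0" "\<And>\<tau> q. \<tau> \<in> {0..T} \<Longrightarrow> \<bar>adj_response P w \<tau> \<bullet> q\<bar> \<le> K * norm q"
    using adj_response_inner_le[of T P w] by blast
  obtain K2 where K2: "K2 \<ge> 0" "\<And>\<tau>. \<tau> \<in> {0..T} \<Longrightarrow> norm (semigroup_A_adj P \<tau> (w, 0)) \<le> K2"
    using semigroup_A_adj_bounded[of T P w] by blast
  define A where "A = (exp (\<bar>drift_a0 P\<bar> * T) * (w \<bullet> fst (op_G P 1)))\<^sup>2 * T"
  have A0: "A \<ge> 0" using horizon_pos by (simp add: A_def)
  note U = ctrl_vec_integrable[OF u]
  define C where "C = K2 * norm y + K * (LINT x|Q. norm (ctrl_vec uz (fst x) (snd x))) + (1 + 4 * A)"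
  have main: "integrable M (\<lambda>\<omega>. w \<bullet> fst (Y s \<omega>)) \<and>
    expectation (\<lambda>\<omega>. w \<bullet> fst (Y s \<omega>)) = semigroup_A_adj P (s - t) (w, 0) \<bullet> y
     + (LINT \<rho>|L. indicator {t..s} \<rho> * (adj_response P w (s - \<rho>) \<bullet> mean_ctrl uz \<rho>)) \<and>
    expectation (\<lambda>\<omega>. \<bar>w \<bullet> fst (Y s \<omega>)\<bar>) \<le> C" if s: "s \<in> {t..T}" for s
  proof -
    obtain I where I: "has_ito_integral M F W t s (\<lambda>\<rho> \<omega>. semigroup_A P (s - \<rho>) (op_G P 1)) I"
      and YI: "AE \<omega> in M. Y s \<omega> = semigroup_A P (s - t) y
           + (LINT \<rho>:{t..s}|lborel. semigroup_A P (s - \<rho>) (op_B P (ctrl_vec uz \<rho> \<omega>))) + I \<omega>"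
      using Y s unfolding mild_solution_def by blast
    have ts: "t \<le> s" "s \<le> T" using s by auto
    note resp = state_response[where X="Y s" and I=I and y=y and w=w, OF u t ts YI]
    have Ys: "Y s \<in> borel_measurable M"
      using progressive_section[of t T Y s] Y s t by (intro measurable_F_M[of s]) (auto simp: mild_solution_def)
    have Ym [measurable]: "(\<lambda>\<omega>. w \<bullet> fst (Y s \<omega>)) \<in> borel_measurable M"
      by (rule borel_measurable_inner[OF borel_measurable_const measurable_compose[OF Ys borel_measurable_continuous_onI[OF continuous_on_fst[OF continuous_on_id]]]])
    note ito = ito_integral_moments[OF I t ts(1) bounded_linear_compose[OF bounded_linear_inner_right bounded_linear_fst] A0,
        of w, OF op_G_ito_second_moment[OF t ts, of w, folded A_def]]
    let ?V = "\<lambda>(\<rho>, \<omega>). indicator {t..s} \<rho> * (adj_response P w (s - \<rho>) \<bullet> ctrl_vec uz \<rho> \<omega>)"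
    have Vb: "\<bar>?V x\<bar> \<le> K * norm (ctrl_vec uz (fst x) (snd x))" for x
      using K ts t by (auto simp: indicator_def split_beta)
    have [measurable]: "(\<lambda>x. ctrl_vec uz (fst x) (snd x)) \<in> borel_measurable Q"
      using borel_measurable_integrable[OF U] by (simp add: split_beta')
    have V: "integrable Q ?V"
    proof (rule Bochner_Integration.integrable_bound)
      show "integrable Q (\<lambda>x. K * norm (ctrl_vec uz (fst x) (snd x)))" using U by (simp add: split_beta')
      show "?V \<in> borel_measurable Q" unfolding split_beta' by measurable
      show "AE x in Q. norm (?V x) \<le> norm (K * norm (ctrl_vec uz (fst x) (snd x)))"
        using Vb K(1) by (intro AE_I2) simp
    qed
    let ?v = "\<lambda>\<omega>. LINT \<rho>|L. indicator {t..s} \<rho> * (adj_response P w (s - \<rho>) \<bullet> ctrl_vec uz \<rho> \<omega>)"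
    have v: "integrable M ?v" using LM.integrable_snd[OF V] .
    have Ev: "expectation ?v = (LINT \<rho>|L. indicator {t..s} \<rho> * (adj_response P w (s - \<rho>) \<bullet> mean_ctrl uz \<rho>))"
      unfolding LM.Fubini_integral[OF V]
    proof (rule integral_cong_AE)
      show "AE \<rho> in L. (LINT \<omega>|M. indicator {t..s} \<rho> * (adj_response P w (s - \<rho>) \<bullet> ctrl_vec uz \<rho> \<omega>))
          = indicator {t..s} \<rho> * (adj_response P w (s - \<rho>) \<bullet> mean_ctrl uz \<rho>)"
        using LM.AE_integrable_fst[OF U]
        by eventually_elim (simp add: mean_ctrl_def)
      have [measurable]: "mean_ctrl uz \<in> borel_measurable L" using mean_ctrl_integrable[OF u] by simp
      have [measurable]: "(\<lambda>\<rho>. \<rho>) \<in> borel_measurable L" by (rule measurable_on_L) simp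
      show "(\<lambda>\<rho>. indicator {t..s} \<rho> * (adj_response P w (s - \<rho>) \<bullet> mean_ctrl uz \<rho>)) \<in> borel_measurable L"
        by measurable
      show "(\<lambda>\<rho>. LINT \<omega>|M. indicator {t..s} \<rho> * (adj_response P w (s - \<rho>) \<bullet> ctrl_vec uz \<rho> \<omega>)) \<in> borel_measurable L"
        using LM.integrable_fst[OF V] by simp
    qed
    let ?Z = "\<lambda>\<omega>. semigroup_A_adj P (s - t) (w, 0) \<bullet> y + ?v \<omega> + w \<bullet> fst (I \<omega>)"
    have Z: "integrable M ?Z" using v ito(1) by simp
    have YZ: "integrable M (\<lambda>\<omega>. w \<bullet> fst (Y s \<omega>))"
      by (rule integrable_cong_AE_imp[OF Z Ym]) (use resp in eventually_elim, simp)
    have EZ: "expectation (\<lambda>\<omega>. w \<bullet> fst (Y s \<omega>)) = expectation ?Z"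
      by (rule integral_cong_AE) (use Z resp in auto)
    have I2: "integrable M (\<lambda>\<omega>. (w \<bullet> fst (I \<omega>))\<^sup>2)"
    proof (rule integrableI_bounded)
      show "(\<integral>\<^sup>+\<omega>. ennreal (norm ((w \<bullet> fst (I \<omega>))\<^sup>2)) \<partial>M) < \<infinity>" using le_less_trans[OF ito(3)] by simp
      show "(\<lambda>\<omega>. (w \<bullet> fst (I \<omega>))\<^sup>2) \<in> borel_measurable M" using ito(1) by (intro borel_measurable_power) simp
    qed
    have EI2: "expectation (\<lambda>\<omega>. (w \<bullet> fst (I \<omega>))\<^sup>2) \<le> 4 * A"
      using ito(3) A0 nn_integral_eq_integral[OF I2] by simp
    have n: "integrable Q (\<lambda>(\<rho>, \<omega>). norm (ctrl_vec uz \<rho> \<omega>))" using integrable_norm[OF U] by (simp add: split_beta')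
    have "expectation (\<lambda>\<omega>. \<bar>w \<bullet> fst (Y s \<omega>)\<bar>)
        \<le> expectation (\<lambda>\<omega>. K2 * norm y + K * (LINT \<rho>|L. norm (ctrl_vec uz \<rho> \<omega>)) + (1 + (w \<bullet> fst (I \<omega>))\<^sup>2))"
    proof (rule integral_mono_AE)
      show "integrable M (\<lambda>\<omega>. K2 * norm y + K * (LINT \<rho>|L. norm (ctrl_vec uz \<rho> \<omega>)) + (1 + (w \<bullet> fst (I \<omega>))\<^sup>2))"
        using LM.integrable_snd[OF n] I2 by simp
      show "AE \<omega> in M. \<bar>w \<bullet> fst (Y s \<omega>)\<bar> \<le> K2 * norm y + K * (LINT \<rho>|L. norm (ctrl_vec uz \<rho> \<omega>)) + (1 + (w \<bullet> fst (I \<omega>))\<^sup>2)"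
        using resp LM.AE_integrable_snd[OF n]
      proof eventually_elim
        case (elim \<omega>)
        have "\<bar>semigroup_A_adj P (s - t) (w, 0) \<bullet> y\<bar> \<le> norm (semigroup_A_adj P (s - t) (w, 0)) * norm y"
          by (rule Cauchy_Schwarz_ineq2)
        also have "\<dots> \<le> K2 * norm y" using K2(2)[of "s - t"] ts t by (intro mult_right_mono) auto
        finally have 1: "\<bar>semigroup_A_adj P (s - t) (w, 0) \<bullet> y\<bar> \<le> K2 * norm y" .
        have "\<bar>?v \<omega>\<bar> \<le> (LINT \<rho>|L. K * norm (ctrl_vec uz \<rho> \<omega>))"
          by (rule order_trans[OF integral_abs_bound], rule integral_mono_AE')
            (use elim(2) K(1) Vb[of "(_, \<omega>)"] in \<open>auto\<close>)
        then have 2: "\<bar>?v \<omega>\<bar> \<le> K * (LINT \<rho>|L. norm (ctrl_vec uz \<rho> \<omega>))" by simp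
        \<comment> \<open>The absolute value of the noise is bounded by 1 plus its square, whose mean is under control.\<close>
        have "0 \<le> (\<bar>w \<bullet> fst (I \<omega>)\<bar> - 1)\<^sup>2" by simp
        then have "2 * \<bar>w \<bullet> fst (I \<omega>)\<bar> \<le> 1 + (w \<bullet> fst (I \<omega>))\<^sup>2" by (simp add: power2_diff)
        with 1 2 elim(1) show ?case by linarith
      qed
    qed (use YZ in simp)
    also have "\<dots> = K2 * norm y + K * (LINT \<omega>|M. LINT \<rho>|L. norm (ctrl_vec uz \<rho> \<omega>)) + (1 + expectation (\<lambda>\<omega>. (w \<bullet> fst (I \<omega>))\<^sup>2))"
      using LM.integrable_snd[OF n] I2 by (simp add: prob_space)
    also have "(LINT \<omega>|M. LINT \<rho>|L. norm (ctrl_vec uz \<rho> \<omega>)) = (LINT x|Q. norm (ctrl_vec uz (fst x) (snd x)))"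
      using LM.integral_snd[OF n] by (simp add: split_beta')
    finally have "expectation (\<lambda>\<omega>. \<bar>w \<bullet> fst (Y s \<omega>)\<bar>) \<le> C" using EI2 by (simp add: C_def)
    moreover have "expectation ?Z = semigroup_A_adj P (s - t) (w, 0) \<bullet> y
     + (LINT \<rho>|L. indicator {t..s} \<rho> * (adj_response P w (s - \<rho>) \<bullet> mean_ctrl uz \<rho>))"
      using v ito(1,2) Ev by (simp add: prob_space)
    ultimately show ?thesis using YZ EZ by simp
  qed
  show thesis by (rule that[of C]) (use main in blast)+
qed

section \<open>The gain of a control\<close>

text \<open>Both iterated integrals extend over the triangle \<open>t \<le> \<rho> \<le> s \<le> T\<close>.\<close>

lemma discounted_response_Fubini:
  fixes m :: "real \<Rightarrow> real^2"
  assumes t: "0 \<le> t" and m: "integrable L m"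
  defines "e \<equiv> \<lambda>s. exp (- rate P * (s - t))"
  shows "integrable L (\<lambda>s. indicator {t..T} s * (e s * (LINT \<rho>|L. indicator {t..s} \<rho> * (adj_response P w (s - \<rho>) \<bullet> m \<rho>))))"
    and "integrable L (\<lambda>\<rho>. indicator {t..T} \<rho> * (LINT s:{\<rho>..T}|lborel. e s * (adj_response P w (s - \<rho>) \<bullet> m \<rho>)))"
    and "(LINT s|L. indicator {t..T} s * (e s * (LINT \<rho>|L. indicator {t..s} \<rho> * (adj_response P w (s - \<rho>) \<bullet> m \<rho>))))
     = (LINT \<rho>|L. indicator {t..T} \<rho> * (LINT s:{\<rho>..T}|lborel. e s * (adj_response P w (s - \<rho>) \<bullet> m \<rho>)))"
proof -
  interpret LL: pair_sigma_finite L L ..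
  obtain K where K: "K \<ge> 0" "\<And>\<tau> q. \<tau> \<in> {0..T} \<Longrightarrow> \<bar>adj_response P w \<tau> \<bullet> q\<bar> \<le> K * norm q"
    using adj_response_inner_le[of T P w] by blast
  define E where "E = exp (\<bar>rate P\<bar> * T)"
  let ?h = "\<lambda>(s, \<rho>). indicator {t..T} s * (e s * (indicator {t..s} \<rho> * (adj_response P w (s - \<rho>) \<bullet> m \<rho>)))"
  have [measurable]: "m \<in> borel_measurable L" using m by simp
  have [measurable]: "(\<lambda>x. fst x) \<in> borel_measurable (L \<Otimes>\<^sub>M L)" "(\<lambda>x. snd x) \<in> borel_measurable (L \<Otimes>\<^sub>M L)"
    by (rule measurable_compose[OF measurable_fst measurable_on_L] measurable_compose[OF measurable_snd measurable_on_L], simp)+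
  have h: "integrable (L \<Otimes>\<^sub>M L) ?h"
  proof (rule Bochner_Integration.integrable_bound)
    show "integrable (L \<Otimes>\<^sub>M L) (\<lambda>x. E * (K * norm (m (snd x))))"
      using L.integrable_pair_snd[OF L.sigma_finite_measure_axioms, of "\<lambda>\<rho>. E * (K * norm (m \<rho>))"] m by simp
    show "?h \<in> borel_measurable (L \<Otimes>\<^sub>M L)"
    proof -
      have "(\<lambda>x. indicator {t..T} (fst x) * (e (fst x) * (if t \<le> snd x \<and> snd x \<le> fst x then adj_response P w (fst x - snd x) \<bullet> m (snd x) else 0)))
          \<in> borel_measurable (L \<Otimes>\<^sub>M L)"
        unfolding e_def by measurable
      then show ?thesis
        by (rule measurable_cong[THEN iffD1, rotated]) (auto simp: indicator_def)
    qed
    have "\<bar>?h x\<bar> \<le> E * (K * norm (m (snd x)))" for x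
    proof (cases "fst x \<in> {t..T} \<and> snd x \<in> {t..fst x}")
      case True
      then have "e (fst x) * \<bar>adj_response P w (fst x - snd x) \<bullet> m (snd x)\<bar> \<le> E * (K * norm (m (snd x)))"
        unfolding E_def e_def using t K by (intro mult_mono discount_le) auto
      with True show ?thesis by (simp add: split_beta abs_mult e_def)
    next
      case False
      then show ?thesis using K by (auto simp: split_beta E_def)
    qed
    then show "AE x in L \<Otimes>\<^sub>M L. norm (?h x) \<le> norm (E * (K * norm (m (snd x))))"
      by (intro AE_I2) (simp add: order_trans[OF _ abs_ge_self])
  qed
  have in1: "(LINT \<rho>|L. indicator {t..T} s * (e s * (indicator {t..s} \<rho> * (adj_response P w (s - \<rho>) \<bullet> m \<rho>))))
      = indicator {t..T} s * (e s * (LINT \<rho>|L. indicator {t..s} \<rho> * (adj_response P w (s - \<rho>) \<bullet> m \<rho>)))" for s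
    by simp
  have in2: "(LINT s|L. indicator {t..T} s * (e s * (indicator {t..s} \<rho> * (adj_response P w (s - \<rho>) \<bullet> m \<rho>))))
      = indicator {t..T} \<rho> * (LINT s:{\<rho>..T}|lborel. e s * (adj_response P w (s - \<rho>) \<bullet> m \<rho>))" for \<rho>
  proof (cases "\<rho> \<in> {t..T}")
    case True
    then have "(LINT s:{\<rho>..T}|lborel. e s * (adj_response P w (s - \<rho>) \<bullet> m \<rho>))
        = (LINT s|L. indicator {\<rho>..T} s *\<^sub>R (e s * (adj_response P w (s - \<rho>) \<bullet> m \<rho>)))"
      using t by (intro set_integral_eq_L) auto
    also have "\<dots> = (LINT s|L. indicator {t..T} s * (e s * (indicator {t..s} \<rho> * (adj_response P w (s - \<rho>) \<bullet> m \<rho>))))"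
      using True by (intro Bochner_Integration.integral_cong refl) (auto simp: indicator_def)
    finally show ?thesis using True by simp
  next
    case False
    then have "indicator {t..T} s * (e s * (indicator {t..s} \<rho> * (adj_response P w (s - \<rho>) \<bullet> m \<rho>))) = 0" for s
      by (auto simp: indicator_def)
    then show ?thesis using False by (simp only: indicator_simps(2)[OF False] mult_zero_left Bochner_Integration.integral_zero)
  qed
  show "integrable L (\<lambda>s. indicator {t..T} s * (e s * (LINT \<rho>|L. indicator {t..s} \<rho> * (adj_response P w (s - \<rho>) \<bullet> m \<rho>))))"
    using LL.integrable_fst[OF h] unfolding in1 .
  show "integrable L (\<lambda>\<rho>. indicator {t..T} \<rho> * (LINT s:{\<rho>..T}|lborel. e s * (adj_response P w (s - \<rho>) \<bullet> m \<rho>)))"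
    using LL.integrable_snd[OF h] unfolding in2 .
  show "(LINT s|L. indicator {t..T} s * (e s * (LINT \<rho>|L. indicator {t..s} \<rho> * (adj_response P w (s - \<rho>) \<bullet> m \<rho>))))
     = (LINT \<rho>|L. indicator {t..T} \<rho> * (LINT s:{\<rho>..T}|lborel. e s * (adj_response P w (s - \<rho>) \<bullet> m \<rho>)))"
    using LL.Fubini_integral[OF h] unfolding in1 in2 by (rule sym)
qed

text \<open>The discounted future reward, seen from time \<open>s\<close>, of a unit of each control applied at time \<open>s\<close>.\<close>

definition shadow_price :: "real \<Rightarrow> real^2" where
  "shadow_price s = op_B_adj P (a_fun P s)"

lemma measurable_shadow_price [measurable]: "shadow_price \<in> borel_measurable borel"
  unfolding shadow_price_def[abs_def] by (rule measurable_op_B_adj_a_fun[OF ctrl_b1_supported])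

text \<open>The integrand of the gain once the reward on the state has been credited to the controls that
  cause it, at the time when they are applied.\<close>

definition running_gain :: "real \<Rightarrow> 'a control \<Rightarrow> real \<Rightarrow> 'a \<Rightarrow> real" where
  "running_gain t uz s \<omega> = indicator {t..T} s * (exp (- rate P * (s - t)) *
     ((shadow_price s - beta_vec P) \<bullet> ctrl_vec uz s \<omega> - gamma0 P * (fst uz s \<omega>)\<^sup>2 - gamma1 P * (snd uz s \<omega>)\<^sup>2))"

lemma discounted_integrable:
  assumes f: "integrable Q f" and t: "0 \<le> t"
  shows "integrable Q (\<lambda>x. indicator {t..T} (fst x) * (exp (- rate P * (fst x - t)) * (f x :: real)))"
proof (rule Bochner_Integration.integrable_bound)
  have [measurable]: "f \<in> borel_measurable Q" using f by simp
  show "integrable Q (\<lambda>x. exp (\<bar>rate P\<bar> * T) * norm (f x))" using f by simp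
  show "(\<lambda>x. indicator {t..T} (fst x) * (exp (- rate P * (fst x - t)) * f x)) \<in> borel_measurable Q" by measurable
  have "norm (indicator {t..T} (fst x) * (exp (- rate P * (fst x - t)) * f x)) \<le> exp (\<bar>rate P\<bar> * T) * norm (f x)" for x
    using discount_le[of t "fst x" T "rate P"] t
    by (cases "fst x \<in> {t..T}") (auto simp: abs_mult intro: mult_right_mono)
  then show "AE x in Q. norm (indicator {t..T} (fst x) * (exp (- rate P * (fst x - t)) * f x))
      \<le> norm (exp (\<bar>rate P\<bar> * T) * norm (f x))"
    by (intro AE_I2) simp
qed

lemma shadow_price_inner_integrable:
  assumes "fst uz \<in> controls P M W" "snd uz \<in> controls P M W"
  shows "integrable Q (\<lambda>x. shadow_price (fst x) \<bullet> ctrl_vec uz (fst x) (snd x))"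
proof -
  obtain K where K: "K \<ge> 0" "\<And>t q. t \<in> {0..T} \<Longrightarrow> \<bar>shadow_price t \<bullet> q\<bar> \<le> K * norm q"
    using op_B_adj_a_fun_bounded[OF ctrl_b1_supported] unfolding shadow_price_def by blast
  note U = ctrl_vec_integrable[OF assms, unfolded split_beta']
  have [measurable]: "(\<lambda>x. ctrl_vec uz (fst x) (snd x)) \<in> borel_measurable Q" using U by simp
  show ?thesis
  proof (rule Bochner_Integration.integrable_bound)
    show "integrable Q (\<lambda>x. K * norm (ctrl_vec uz (fst x) (snd x)))" using U by simp
    show "AE x in Q. norm (shadow_price (fst x) \<bullet> ctrl_vec uz (fst x) (snd x)) \<le> norm (K * norm (ctrl_vec uz (fst x) (snd x)))"
      using K by (intro AE_I2) (auto simp: space_pair_measure)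
  qed measurable
qed

lemma running_gain_integrable:
  assumes u: "fst uz \<in> controls P M W" "snd uz \<in> controls P M W" and t: "0 \<le> t"
  shows "integrable Q (\<lambda>(s, \<omega>). running_gain t uz s \<omega>)"
proof -
  note U = ctrl_vec_integrable[OF u, unfolded split_beta']
  note sq = controls_integrable(2)[OF u(1), unfolded split_beta'] controls_integrable(2)[OF u(2), unfolded split_beta']
  show ?thesis
    unfolding running_gain_def split_beta' inner_diff_left
    using shadow_price_inner_integrable[OF u] U sq
    by (intro discounted_integrable t Bochner_Integration.integrable_diff) auto
qed

text \<open>The state enters the gain linearly, so only its mean matters, and the mean is affine in the control.
  The initial datum contributes \<open>\<langle>a(t), y\<rangle>\<close>. Exchanging the order of integration over the triangle
  \<open>t \<le> \<rho> \<le> s \<le> T\<close> collects, for every \<open>\<rho>\<close>, all later rewards caused by the control at time \<open>\<rho>\<close>, and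
  together with the terminal reward they form \<open>B* a(\<rho>)\<close>.\<close>

lemma gain_eq:
  assumes u: "fst uz \<in> controls P M W" "snd uz \<in> controls P M W" and t: "0 \<le> t" "t \<le> T"
    and Y: "mild_solution P M W t y uz Y"
  shows "gain P M t uz Y = a_fun P t \<bullet> y + (LINT (s, \<omega>)|Q. running_gain t uz s \<omega>)"
proof -
  define e where "e s = exp (- rate P * (s - t))" for s
  let ?\<alpha> = "alpha_vec P" and ?\<beta> = "beta_vec P" and ?lam = "lambda_vec P" and ?m = "mean_ctrl uz"
  let ?S = "\<lambda>w s. semigroup_A_adj P (s - t) (w, 0) \<bullet> y"
  let ?C = "\<lambda>w s. LINT \<rho>|L. indicator {t..s} \<rho> * (adj_response P w (s - \<rho>) \<bullet> ?m \<rho>)"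
  let ?U = "\<lambda>x. ctrl_vec uz (fst x) (snd x)"
  let ?cost = "\<lambda>s \<omega>. ?\<beta> \<bullet> ctrl_vec uz s \<omega> + gamma0 P * (fst uz s \<omega>)\<^sup>2 + gamma1 P * (snd uz s \<omega>)\<^sup>2"
  have [measurable]: "e \<in> borel_measurable borel" unfolding e_def by measurable
  have [measurable]: "e \<in> borel_measurable L" "(\<lambda>s. s) \<in> borel_measurable L" by (rule measurable_on_L, simp)+
  have m: "integrable L ?m" by (rule mean_ctrl_integrable[OF u])
  then have [measurable]: "?m \<in> borel_measurable L" by simp
  note U = ctrl_vec_integrable[OF u, unfolded split_beta']
  note sq = controls_integrable(2)[OF u(1), unfolded split_beta'] controls_integrable(2)[OF u(2), unfolded split_beta']
  obtain CA where A: "\<And>s. s \<in> {t..T} \<Longrightarrow> integrable M (\<lambda>\<omega>. ?\<alpha> \<bullet> fst (Y s \<omega>))"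
      "\<And>s. s \<in> {t..T} \<Longrightarrow> expectation (\<lambda>\<omega>. ?\<alpha> \<bullet> fst (Y s \<omega>)) = ?S ?\<alpha> s + ?C ?\<alpha> s"
      "\<And>s. s \<in> {t..T} \<Longrightarrow> expectation (\<lambda>\<omega>. \<bar>?\<alpha> \<bullet> fst (Y s \<omega>)\<bar>) \<le> CA"
    using state_mean[OF u t(1) Y, of ?\<alpha>] by blast
  obtain CB where B: "\<And>s. s \<in> {t..T} \<Longrightarrow> integrable M (\<lambda>\<omega>. ?lam \<bullet> fst (Y s \<omega>))"
      "\<And>s. s \<in> {t..T} \<Longrightarrow> expectation (\<lambda>\<omega>. ?lam \<bullet> fst (Y s \<omega>)) = ?S ?lam s + ?C ?lam s"
      "\<And>s. s \<in> {t..T} \<Longrightarrow> expectation (\<lambda>\<omega>. \<bar>?lam \<bullet> fst (Y s \<omega>)\<bar>) \<le> CB"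
    using state_mean[OF u t(1) Y, of ?lam] by blast
  let ?X = "\<lambda>(s, \<omega>). indicator {t..T} s *\<^sub>R (e s * (?\<alpha> \<bullet> fst (Y s \<omega>)))"
  have X: "integrable Q ?X"
  proof (rule LM.Fubini_integrable)
    have "(\<lambda>(s, x). e s * (?\<alpha> \<bullet> fst (x :: hilb))) \<in> borel_measurable (borel \<Otimes>\<^sub>M borel)"
    proof -
      have [measurable]: "(fst :: hilb \<Rightarrow> _) \<in> borel_measurable borel"
        by (rule borel_measurable_continuous_onI[OF continuous_on_fst[OF continuous_on_id]])
      show ?thesis by measurable
    qed
    then show Xm [measurable]: "?X \<in> borel_measurable Q"
      using Y t by (intro progressive_indicator_measurable) (auto simp: mild_solution_def)
    have "(\<lambda>s. \<integral>\<omega>. norm (?X (s, \<omega>)) \<partial>M) \<in> borel_measurable L" by measurable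
    moreover have "norm (\<integral>\<omega>. norm (?X (s, \<omega>)) \<partial>M) \<le> exp (\<bar>rate P\<bar> * T) * \<bar>CA\<bar>" for s
    proof (cases "s \<in> {t..T}")
      case True
      then have "norm (\<integral>\<omega>. norm (?X (s, \<omega>)) \<partial>M) = e s * expectation (\<lambda>\<omega>. \<bar>?\<alpha> \<bullet> fst (Y s \<omega>)\<bar>)"
        by (simp add: abs_mult e_def)
      also have "\<dots> \<le> exp (\<bar>rate P\<bar> * T) * \<bar>CA\<bar>"
        unfolding e_def using True t A(3)[OF True] by (intro mult_mono discount_le) auto
      finally show ?thesis .
    qed simp
    ultimately show "integrable L (\<lambda>s. \<integral>\<omega>. norm (?X (s, \<omega>)) \<partial>M)"
      by (intro L.integrable_const_bound[where B="exp (\<bar>rate P\<bar> * T) * \<bar>CA\<bar>"] AE_I2)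
    show "AE s in L. integrable M (\<lambda>\<omega>. ?X (s, \<omega>))"
    proof (rule AE_I2)
      fix s show "integrable M (\<lambda>\<omega>. ?X (s, \<omega>))" using A(1)[of s] by (cases "s \<in> {t..T}") auto
    qed
  qed
  let ?Z = "\<lambda>(s, \<omega>). indicator {t..T} s * (e s * ?cost s \<omega>)"
  have Z: "integrable Q ?Z"
    unfolding split_beta' e_def using U sq
    by (intro discounted_integrable t Bochner_Integration.integrable_add) auto
  let ?V = "\<lambda>(s, \<omega>). indicator {t..T} s * (e s * (shadow_price s \<bullet> ctrl_vec uz s \<omega>))"
  have V: "integrable Q ?V"
    unfolding split_beta' e_def by (intro discounted_integrable t shadow_price_inner_integrable u)
  have XZ: "integrable Q (\<lambda>(s, \<omega>). ?X (s, \<omega>) - ?Z (s, \<omega>))"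
    using Bochner_Integration.integrable_diff[OF X Z] by (simp add: split_beta')
  have pay: "(LINT s:{t..T}|lborel. e s * (?\<alpha> \<bullet> fst (Y s \<omega>) - ?\<beta> \<bullet> ctrl_vec uz s \<omega>
          - gamma0 P * (fst uz s \<omega>)\<^sup>2 - gamma1 P * (snd uz s \<omega>)\<^sup>2)) = (LINT s|L. ?X (s, \<omega>) - ?Z (s, \<omega>))" for \<omega>
    using t by (subst set_integral_eq_L) (auto intro!: Bochner_Integration.integral_cong simp: algebra_simps)
  have "gain P M t uz Y = expectation (\<lambda>\<omega>. (LINT s|L. ?X (s, \<omega>) - ?Z (s, \<omega>)) + e T * (?lam \<bullet> fst (Y T \<omega>)))"
    unfolding gain_def e_def[symmetric] pay ..
  also have "\<dots> = expectation (\<lambda>\<omega>. LINT s|L. ?X (s, \<omega>) - ?Z (s, \<omega>)) + e T * expectation (\<lambda>\<omega>. ?lam \<bullet> fst (Y T \<omega>))"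
    using LM.integrable_snd[OF XZ] B(1)[of T] t by simp
  also have "expectation (\<lambda>\<omega>. LINT s|L. ?X (s, \<omega>) - ?Z (s, \<omega>)) = (LINT x|Q. ?X x) - (LINT x|Q. ?Z x)"
    using LM.integral_snd[OF XZ] Bochner_Integration.integral_diff[OF X Z] by (simp add: split_beta')
  also have "(LINT x|Q. ?X x) = (LINT s|L. indicator {t..T} s * (e s * (?S ?\<alpha> s + ?C ?\<alpha> s)))"
  proof -
    have "(LINT \<omega>|M. ?X (s, \<omega>)) = indicator {t..T} s * (e s * (?S ?\<alpha> s + ?C ?\<alpha> s))" for s
      using A(2)[of s] by (cases "s \<in> {t..T}") auto
    then show ?thesis unfolding LM.integral_fst'[OF X, symmetric] by (simp only:)
  qed
  also have "\<dots> = (LINT s|L. indicator {t..T} s * (e s * ?S ?\<alpha> s)) + (LINT s|L. indicator {t..T} s * (e s * ?C ?\<alpha> s))"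
  proof -
    have "integrable lborel (\<lambda>s. (indicator {t..T} s *\<^sub>R e s *\<^sub>R semigroup_A_adj P (s - t) (?\<alpha>, 0)) \<bullet> y)"
      using discounted_adj_integrable[of t T "rate P" P ?\<alpha>]
      by (intro integrable_inner_left) (simp add: set_integrable_def e_def)
    moreover have "(indicator {t..T} s *\<^sub>R e s *\<^sub>R semigroup_A_adj P (s - t) (?\<alpha>, 0)) \<bullet> y
        = indicator {0..T} s *\<^sub>R (indicator {t..T} s * (e s * ?S ?\<alpha> s))" for s
      using t by (cases "s \<in> {t..T}") auto
    ultimately have "integrable L (\<lambda>s. indicator {t..T} s * (e s * ?S ?\<alpha> s))"
      by (subst integrable_restrict_space) (simp_all only: space_lborel sets_lborel space_borel Int_UNIV_right atLeastAtMost_borel)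
    with discounted_response_Fubini(1)[OF t(1) m, folded e_def] show ?thesis
      by (subst Bochner_Integration.integral_add[symmetric]) (simp_all add: distrib_left)
  qed
  also have "(LINT s|L. indicator {t..T} s * (e s * ?C ?\<alpha> s))
      = (LINT \<rho>|L. indicator {t..T} \<rho> * (LINT s:{\<rho>..T}|lborel. e s * (adj_response P ?\<alpha> (s - \<rho>) \<bullet> ?m \<rho>)))"
    unfolding e_def by (rule discounted_response_Fubini(3)[OF t(1) m])
  also have "expectation (\<lambda>\<omega>. ?lam \<bullet> fst (Y T \<omega>)) = ?S ?lam T + ?C ?lam T" using B(2)[of T] t by simp
  finally have g1: "gain P M t uz Y = ((LINT s|L. indicator {t..T} s * (e s * ?S ?\<alpha> s)) + e T * ?S ?lam T)
      + ((LINT \<rho>|L. indicator {t..T} \<rho> * (LINT s:{\<rho>..T}|lborel. e s * (adj_response P ?\<alpha> (s - \<rho>) \<bullet> ?m \<rho>)))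
         + e T * ?C ?lam T) - (LINT x|Q. ?Z x)"
    by (simp add: algebra_simps)
  have g2: "(LINT s|L. indicator {t..T} s * (e s * ?S ?\<alpha> s)) + e T * ?S ?lam T = a_fun P t \<bullet> y"
    unfolding inner_a_fun e_def[symmetric] using t by (subst set_integral_eq_L) auto
  have "(LINT \<rho>|L. indicator {t..T} \<rho> * (LINT s:{\<rho>..T}|lborel. e s * (adj_response P ?\<alpha> (s - \<rho>) \<bullet> ?m \<rho>))) + e T * ?C ?lam T
     = (LINT \<rho>|L. indicator {t..T} \<rho> * (LINT s:{\<rho>..T}|lborel. e s * (adj_response P ?\<alpha> (s - \<rho>) \<bullet> ?m \<rho>))
          + e T * (indicator {t..T} \<rho> * (adj_response P ?lam (T - \<rho>) \<bullet> ?m \<rho>)))"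
  proof (subst Bochner_Integration.integral_add)
    show "integrable L (\<lambda>\<rho>. indicator {t..T} \<rho> * (LINT s:{\<rho>..T}|lborel. e s * (adj_response P ?\<alpha> (s - \<rho>) \<bullet> ?m \<rho>)))"
      unfolding e_def by (rule discounted_response_Fubini(2)[OF t(1) m])
    obtain K where K: "K \<ge> 0" "\<And>\<tau> q. \<tau> \<in> {0..T} \<Longrightarrow> \<bar>adj_response P ?lam \<tau> \<bullet> q\<bar> \<le> K * norm q"
      using adj_response_inner_le[of T P ?lam] by blast
    have "integrable L (\<lambda>\<rho>. indicator {t..T} \<rho> * (adj_response P ?lam (T - \<rho>) \<bullet> ?m \<rho>))"
    proof (rule Bochner_Integration.integrable_bound)
      show "integrable L (\<lambda>\<rho>. K * norm (?m \<rho>))" using m by simp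
      show "AE \<rho> in L. norm (indicator {t..T} \<rho> * (adj_response P ?lam (T - \<rho>) \<bullet> ?m \<rho>)) \<le> norm (K * norm (?m \<rho>))"
        using K t by (intro AE_I2) (auto simp: indicator_def)
    qed measurable
    then show "integrable L (\<lambda>\<rho>. e T * (indicator {t..T} \<rho> * (adj_response P ?lam (T - \<rho>) \<bullet> ?m \<rho>)))" by simp
  qed simp
  also have "\<dots> = (LINT \<rho>|L. indicator {t..T} \<rho> * (e \<rho> * (shadow_price \<rho> \<bullet> ?m \<rho>)))"
  proof (rule Bochner_Integration.integral_cong[OF refl])
    fix \<rho>
    have es: "e s = e \<rho> * exp (- rate P * (s - \<rho>))" for s
      by (simp add: e_def exp_add[symmetric] algebra_simps)
    have es': "e \<rho> * (exp (- rate P * (s - \<rho>)) * x) = e s * x" for s x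
      unfolding es[of s] by simp
    have "e \<rho> * (shadow_price \<rho> \<bullet> ?m \<rho>) = e T * (adj_response P ?lam (T - \<rho>) \<bullet> ?m \<rho>)
        + (LINT s:{\<rho>..T}|lborel. e \<rho> * (exp (- rate P * (s - \<rho>)) * (adj_response P ?\<alpha> (s - \<rho>) \<bullet> ?m \<rho>)))"
      unfolding shadow_price_def op_B_adj_a_fun[OF ctrl_b1_supported] set_integral_mult_right es[of T] by (simp add: distrib_left)
    also have "(LINT s:{\<rho>..T}|lborel. e \<rho> * (exp (- rate P * (s - \<rho>)) * (adj_response P ?\<alpha> (s - \<rho>) \<bullet> ?m \<rho>)))
        = (LINT s:{\<rho>..T}|lborel. e s * (adj_response P ?\<alpha> (s - \<rho>) \<bullet> ?m \<rho>))"
      by (simp only: es')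
    finally show "indicator {t..T} \<rho> * (LINT s:{\<rho>..T}|lborel. e s * (adj_response P ?\<alpha> (s - \<rho>) \<bullet> ?m \<rho>))
          + e T * (indicator {t..T} \<rho> * (adj_response P ?lam (T - \<rho>) \<bullet> ?m \<rho>))
        = indicator {t..T} \<rho> * (e \<rho> * (shadow_price \<rho> \<bullet> ?m \<rho>))"
      by (simp add: algebra_simps)
  qed
  also have "\<dots> = (LINT x|Q. ?V x)"
    unfolding LM.integral_fst[OF V, symmetric]
  proof (rule integral_cong_AE)
    have [measurable]: "shadow_price \<in> borel_measurable L" by (rule measurable_on_L) measurable
    show "(\<lambda>\<rho>. indicator {t..T} \<rho> * (e \<rho> * (shadow_price \<rho> \<bullet> ?m \<rho>))) \<in> borel_measurable L" by measurable
    show "(\<lambda>s. LINT \<omega>|M. indicator {t..T} s * (e s * (shadow_price s \<bullet> ctrl_vec uz s \<omega>))) \<in> borel_measurable L"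
      using LM.integrable_fst[OF V] by simp
    show "AE s in L. indicator {t..T} s * (e s * (shadow_price s \<bullet> ?m s))
        = (LINT \<omega>|M. indicator {t..T} s * (e s * (shadow_price s \<bullet> ctrl_vec uz s \<omega>)))"
      using LM.AE_integrable_fst[OF ctrl_vec_integrable[OF u]]
      by eventually_elim (simp add: mean_ctrl_def)
  qed
  finally have "gain P M t uz Y = a_fun P t \<bullet> y + ((LINT x|Q. ?V x) - (LINT x|Q. ?Z x))"
    using g1 g2 by simp
  also have "(LINT x|Q. ?V x) - (LINT x|Q. ?Z x) = (LINT (s, \<omega>)|Q. running_gain t uz s \<omega>)"
    unfolding Bochner_Integration.integral_diff[OF V Z, symmetric]
    by (intro Bochner_Integration.integral_cong refl)
      (simp add: split_beta running_gain_def e_def inner_diff_left algebra_simps)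
  finally show ?thesis .
qed

section \<open>Optimality\<close>

lemma control_star_controls: "fst (control_star P) \<in> controls P M W" "snd (control_star P) \<in> controls P M W"
proof -
  define f where "f s = u_star P (op_B_adj P (a_fun P s))" for s
  have f: "f s = ((shadow_price s - beta_vec P) \<bullet> vector [1, 1]) / (2 * (gamma0 P + gamma1 P))" for s
    by (simp add: f_def u_star_def shadow_price_def)
  have fm [measurable]: "f \<in> borel_measurable borel" unfolding f[abs_def] by measurable
  obtain K where K: "K \<ge> 0" "\<And>t q. t \<in> {0..T} \<Longrightarrow> \<bar>shadow_price t \<bullet> q\<bar> \<le> K * norm q"
    using op_B_adj_a_fun_bounded[OF ctrl_b1_supported] unfolding shadow_price_def by blast
  define B where "B = (K * norm (vector [1, 1] :: real^2) + \<bar>beta_vec P \<bullet> vector [1, 1]\<bar>) / (2 * (gamma0 P + gamma1 P))"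
  have B: "\<bar>f s\<bar> \<le> B" if "s \<in> {0..T}" for s
    unfolding f B_def abs_divide inner_diff_left
    using K(2)[OF that, of "vector [1, 1]"] gamma_pos by (intro frac_le) auto
  have "(\<lambda>s \<omega>. f s) \<in> controls P M W"
    unfolding controls_def
  proof (intro CollectI conjI)
    show "progressive F 0 T (\<lambda>s \<omega>. f s)" by (rule progressive_deterministic) measurable
    have "norm (case x of (s, \<omega>) \<Rightarrow> (f s)\<^sup>2) \<le> B\<^sup>2" if "x \<in> space Q" for x
    proof -
      have "fst x \<in> {0..T}" using that by (auto simp: space_pair_measure)
      from power_mono[OF B[OF this] abs_ge_zero, of 2] show ?thesis by (simp add: split_beta)
    qed
    moreover have "(\<lambda>(s, \<omega>). (f s)\<^sup>2) \<in> borel_measurable Q" unfolding split_beta' by measurable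
    ultimately show "integrable Q (\<lambda>(s, \<omega>). (f s)\<^sup>2)"
      by (intro Q.integrable_const_bound[where B="B\<^sup>2"] AE_I2)
  qed
  then show "fst (control_star P) \<in> controls P M W" "snd (control_star P) \<in> controls P M W"
    by (simp_all add: control_star_def f_def)
qed

lemma control_star_admissible: "control_star P \<in> admissible P M W"
  using control_star_controls by (simp add: admissible_def control_star_def)

definition max_running_gain :: "real \<Rightarrow> real \<Rightarrow> real" where
  "max_running_gain t s = indicator {t..T} s * (exp (- rate P * (s - t)) *
     (((shadow_price s - beta_vec P) \<bullet> vector [1, 1])\<^sup>2 / (4 * (gamma0 P + gamma1 P))))"

text \<open>For equal controls the integrand is a concave quadratic polynomial in their common value, with
  vertex at \<open>u_star\<close>.\<close>

lemma running_gain_complete_square: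
  assumes "fst uz s \<omega> = snd uz s \<omega>"
  shows "running_gain t uz s \<omega> = max_running_gain t s
    - indicator {t..T} s * (exp (- rate P * (s - t)) * ((gamma0 P + gamma1 P) * (fst uz s \<omega> - u_star P (shadow_price s))\<^sup>2))"
proof -
  define G where "G = gamma0 P + gamma1 P"
  define c where "c = (shadow_price s - beta_vec P) \<bullet> vector [1, 1]"
  have G: "G > 0" using gamma_pos by (simp add: G_def)
  have "ctrl_vec uz s \<omega> = fst uz s \<omega> *\<^sub>R vector [1, 1]"
    using assms by (simp add: ctrl_vec_def vec_eq_iff forall_2)
  then have 1: "(shadow_price s - beta_vec P) \<bullet> ctrl_vec uz s \<omega> = fst uz s \<omega> * c" by (simp add: c_def)
  have 2: "u_star P (shadow_price s) = c / (2 * G)" by (simp add: u_star_def c_def G_def)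
  have "fst uz s \<omega> * c - G * (fst uz s \<omega>)\<^sup>2 = c\<^sup>2 / (4 * G) - G * (fst uz s \<omega> - c / (2 * G))\<^sup>2"
    using G by (simp add: power2_eq_square field_simps)
  then have "fst uz s \<omega> * c - gamma0 P * (fst uz s \<omega>)\<^sup>2 - gamma1 P * (snd uz s \<omega>)\<^sup>2
      = c\<^sup>2 / (4 * G) - G * (fst uz s \<omega> - c / (2 * G))\<^sup>2"
    using assms by (simp add: G_def algebra_simps)
  then show ?thesis
    unfolding running_gain_def max_running_gain_def 1 2 c_def[symmetric] G_def[symmetric]
    by (simp only: right_diff_distrib)
qed

lemma running_gain_control_star: "running_gain t (control_star P) s \<omega> = max_running_gain t s"
  by (subst running_gain_complete_square) (simp_all add: control_star_def shadow_price_def)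

lemma integral_max_running_gain:
  assumes "0 \<le> t"
  shows "integrable Q (\<lambda>(s, \<omega>). max_running_gain t s)" "(LINT (s, \<omega>)|Q. max_running_gain t s) = b_fun P t"
proof -
  show i: "integrable Q (\<lambda>(s, \<omega>). max_running_gain t s)"
    using running_gain_integrable[OF control_star_controls assms] by (simp add: running_gain_control_star)
  have "(LINT (s, \<omega>)|Q. max_running_gain t s) = (LINT s|L. max_running_gain t s)"
    unfolding LM.integral_fst[OF i, symmetric] by (simp add: prob_space)
  also have "\<dots> = b_fun P t"
    unfolding b_fun_def max_running_gain_def[abs_def] shadow_price_def
    by (subst set_integral_eq_L) (use assms in \<open>auto simp only: atLeastatMost_subset_iff real_scaleR_def order_refl simp_thms\<close>)
  finally show "(LINT (s, \<omega>)|Q. max_running_gain t s) = b_fun P t" .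
qed

lemma admissible_controls:
  "uz \<in> admissible P M W \<Longrightarrow> fst uz \<in> controls P M W \<and> snd uz \<in> controls P M W"
  by (auto simp: admissible_def)

lemma gain_le_v_fun:
  assumes uz: "uz \<in> admissible P M W" and t: "0 \<le> t" "t \<le> T" and Y: "mild_solution P M W t y uz Y"
  shows "gain P M t uz Y \<le> v_fun P t y"
proof -
  have u: "fst uz \<in> controls P M W" "snd uz \<in> controls P M W"
    using admissible_controls[OF uz] by auto
  have ae: "AE x in Q. fst uz (fst x) (snd x) = snd uz (fst x) (snd x)"
    using uz by (auto simp: admissible_def split_beta')
  have "(LINT (s, \<omega>)|Q. running_gain t uz s \<omega>) \<le> (LINT (s, \<omega>)|Q. max_running_gain t s)"
  proof (rule integral_mono_AE[OF running_gain_integrable[OF u t(1)] integral_max_running_gain(1)[OF t(1)]])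
    show "AE x in Q. (case x of (s, \<omega>) \<Rightarrow> running_gain t uz s \<omega>) \<le> (case x of (s, \<omega>) \<Rightarrow> max_running_gain t s)"
      using ae by eventually_elim (use gamma_pos in \<open>simp add: split_beta running_gain_complete_square\<close>)
  qed
  then show ?thesis
    unfolding gain_eq[OF u t Y] v_fun_def integral_max_running_gain(2)[OF t(1)] by simp
qed

lemma gain_control_star:
  assumes t: "0 \<le> t" "t \<le> T" and Y: "mild_solution P M W t y (control_star P) Y"
  shows "gain P M t (control_star P) Y = v_fun P t y"
  unfolding gain_eq[OF control_star_controls t Y] v_fun_def running_gain_control_star
    integral_max_running_gain(2)[OF t(1)] ..

lemma mild_solution_state:
  assumes "uz \<in> admissible P M W" "0 \<le> t"
  shows "mild_solution P M W t y uz (state P M W t y uz)"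
  unfolding state_def using mild_solution_exists[of uz P t y] admissible_controls[OF assms(1)] assms(2)
  by (intro someI_ex[of "mild_solution P M W t y uz"]) auto

end

theorem theorem4p3:
  fixes P :: lq_data and M :: "'a measure" and W :: "real \<Rightarrow> 'a \<Rightarrow> real"
  assumes "prob_space M" and "complete_measure M"
    and "brownian_motion M (augmented_filtration M W) W"
    and "0 < horizon P" and "0 < delay P"
    and "0 \<le> ctrl_b0 P"
    and "ctrl_b1 P \<in> supported_L2 {- delay P..0}"
    and "AE \<xi> in lborel. 0 \<le> rep_L2 (ctrl_b1 P) \<xi>"
    and "0 < gamma0 P" and "0 < gamma1 P"
  shows
    "(\<forall>t\<in>{0..horizon P}. \<forall>y\<in>H_space P. ereal (v_fun P t y) \<ge> value_fun P M W t y) \<and>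
     (\<forall>t\<in>{0..horizon P}. \<forall>y\<in>H_space P.
        optimal_pair P M W t y (control_star P) (state P M W t y (control_star P)) \<and>
        value_fun P M W t y = ereal (v_fun P t y) \<and>
        v_fun P t y = objective P M W t y (control_star P))"
proof -
  interpret lq_problem M W P
    using assms by (intro lq_problem.intro brownian.intro brownian_axioms.intro lq_problem_axioms.intro)
  have le: "objective P M W t y uz \<le> v_fun P t y"
    if "t \<in> {0..horizon P}" "uz \<in> admissible P M W" for t y uz
    unfolding objective_def using that by (intro gain_le_v_fun mild_solution_state) auto
  have star: "objective P M W t y (control_star P) = v_fun P t y" if "t \<in> {0..horizon P}" for t y
    unfolding objective_def using that by (intro gain_control_star mild_solution_state control_star_admissible) auto
  have ub: "value_fun P M W t y \<le> ereal (v_fun P t y)" if "t \<in> {0..horizon P}" for t y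
    unfolding value_fun_def using le[OF that] by (intro SUP_least) simp
  have "ereal (v_fun P t y) \<le> value_fun P M W t y" if "t \<in> {0..horizon P}" for t y
    unfolding value_fun_def using star[OF that] control_star_admissible by (metis SUP_upper)
  then have val: "value_fun P M W t y = ereal (v_fun P t y)" if "t \<in> {0..horizon P}" for t y
    using ub that by (metis antisym)
  have opt: "optimal_pair P M W t y (control_star P) (state P M W t y (control_star P))" if "t \<in> {0..horizon P}" for t y
    unfolding optimal_pair_def
    using that le[OF that] star[OF that] control_star_admissible mild_solution_state[OF control_star_admissible]
    by (auto simp: objective_def)
  show ?thesis using ub val opt star by simp
qed

end
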